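(* Let $n\ge2$ and let $\mathbf{Y}_n^>$ be the $\mathbb{Z}[\frac12]$-subalgebra of $Y_n^>$ generated by $e_{i,r}^t/t!$ ($i\in I$, $r,t\in\mathbb{N}$). For each finitely supported function $h:\Delta^+\times\mathbb{N}\to\mathbb{N}$ put $$\mathbf{E}_h:=\prod^{\rightarrow}_{(\beta,r)\in\Delta^+\times\mathbb{N}}\frac{e_\beta(r)^{h(\beta,r)}}{h(\beta,r)!},$$ the product taken in increasing order with respect to the total order on $\Delta^+\times\mathbb{N}$ described in the context. Then $\{\mathbf{E}_h\}_{h}$, $h$ ranging over all finitely supported functions $\Delta^+\times\mathbb{N}\to\mathbb{N}$, is a basis of the $\mathbb{Z}[\frac12]$-module $\mathbf{Y}_n^>$.
   Context: $\mathbb{N}=\{0,1,2,\dots\}$, $I=\{1,\dots,n-1\}$, $(c_{ij})$ the Cartan matrix of $\mathfrak{sl}_n$ ($c_{ii}=2$, $c_{i,i\pm1}=-1$, otherwise $0$). $Y_n^>$ is the $\mathbb{C}$-algebra generated by $e_{i,r}$ ($i\in I,r\in\mathbb{N}$) with relations $[e_{i,r+1},e_{j,s}]-[e_{i,r},e_{j,s+1}]=\frac{c_{ij}}{2}(e_{i,r}e_{j,s}+e_{j,s}e_{i,r})$; $[e_{i,r},e_{j,s}]=0$ if $c_{ij}=0$; $[e_{i,r_1},[e_{i,r_2},e_{j,s}]]+[e_{i,r_2},[e_{i,r_1},e_{j,s}]]=0$ if $c_{ij}=-1$. $\Delta^+=\{[i,j]:1\le i\le j\le n-1\}$ where $[i,j]=\alpha_i+\dots+\alpha_j$.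 For $\beta=[i,j]$, $e_\beta(r):=[\cdots[[e_{i,r},e_{i+1,0}],e_{i+2,0}],\dots,e_{j,0}]$. Order on $\Delta^+$: $[i,j]\le[i',j']$ iff $i<i'$, or $i=i'$ and $j\le j'$. Order on $\Delta^+\times\mathbb{N}$: $(\beta,r)\le(\beta',r')$ iff $\beta<\beta'$, or $\beta=\beta'$ and $r\ge r'$. *)

theory Defs
  imports Complex_Main "HOL-Library.Function_Algebras"
begin

text \<open>Free associative C-algebra on generators (i,r) :: nat \<times> nat, elements represented
  as finitely supported functions from words (lists of generators) to complex numbers.\<close>

type_synonym falg = "(nat \<times> nat) list \<Rightarrow> complex"

definition Iset :: "nat \<Rightarrow> nat set" where
  "Iset n = {1..<n}"

definition fin_alg :: "nat \<Rightarrow> falg set" where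
  "fin_alg n = {f. finite {w. f w \<noteq> 0} \<and> (\<forall>w. f w \<noteq> 0 \<longrightarrow> (\<forall>x\<in>set w. fst x \<in> Iset n))}"

definition fmul :: "falg \<Rightarrow> falg \<Rightarrow> falg" where
  "fmul f g = (\<lambda>w. \<Sum>k\<le>length w. f (take k w) * g (drop k w))"

definition fone :: falg where
  "fone = (\<lambda>w. if w = [] then 1 else 0)"

definition gen :: "nat \<times> nat \<Rightarrow> falg" where
  "gen x = (\<lambda>w. if w = [x] then 1 else 0)"

definition scal :: "complex \<Rightarrow> falg \<Rightarrow> falg" where
  "scal c f = (\<lambda>w. c * f w)"

definition fpow :: "falg \<Rightarrow> nat \<Rightarrow> falg" where
  "fpow f t = ((fmul f) ^^ t) fone"

definition comm :: "falg \<Rightarrow> falg \<Rightarrow> falg" where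
  "comm f g = fmul f g - fmul g f"

definition cartan :: "nat \<Rightarrow> nat \<Rightarrow> complex" where
  "cartan i j = (if i = j then 2 else if i = Suc j \<or> j = Suc i then -1 else 0)"

definition rels :: "nat \<Rightarrow> falg set" where
  "rels n =
    {comm (gen (i, Suc r)) (gen (j, s)) - comm (gen (i, r)) (gen (j, Suc s))
       - scal (cartan i j / 2) (fmul (gen (i, r)) (gen (j, s)) + fmul (gen (j, s)) (gen (i, r)))
     | i j r s. i \<in> Iset n \<and> j \<in> Iset n}
   \<union> {comm (gen (i, r)) (gen (j, s)) | i j r s. i \<in> Iset n \<and> j \<in> Iset n \<and> cartan i j = 0}
   \<union> {comm (gen (i, r1)) (comm (gen (i, r2)) (gen (j, s)))
       + comm (gen (i, r2)) (comm (gen (i, r1)) (gen (j, s)))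
     | i j r1 r2 s. i \<in> Iset n \<and> j \<in> Iset n \<and> cartan i j = -1}"

text \<open>Two-sided ideal of the free algebra generated by the relations; Y_n^> = fin_alg n / Jid n.\<close>
inductive_set Jid :: "nat \<Rightarrow> falg set" for n :: nat where
  Jid_zero: "0 \<in> Jid n"
| Jid_gen: "\<rho> \<in> rels n \<Longrightarrow> a \<in> fin_alg n \<Longrightarrow> b \<in> fin_alg n \<Longrightarrow> fmul (fmul a \<rho>) b \<in> Jid n"
| Jid_add: "x \<in> Jid n \<Longrightarrow> y \<in> Jid n \<Longrightarrow> x + y \<in> Jid n"

definition dyadic :: "complex set" where
  "dyadic = {of_int k / 2 ^ m | k m. True}"

definition divpow_gens :: "nat \<Rightarrow> falg set" where
  "divpow_gens n = {scal (1 / fact t) (fpow (gen (i, r)) t) | i r t. i \<in> Iset n}"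

text \<open>Z[1/2]-subalgebra (with 1) of the free algebra generated by divided powers;
  its image modulo Jid n is the bold Y_n^>.\<close>
inductive_set zsub :: "nat \<Rightarrow> falg set" for n :: nat where
  zsub_one: "fone \<in> zsub n"
| zsub_gen: "x \<in> divpow_gens n \<Longrightarrow> x \<in> zsub n"
| zsub_mul: "x \<in> zsub n \<Longrightarrow> y \<in> zsub n \<Longrightarrow> fmul x y \<in> zsub n"
| zsub_add: "x \<in> zsub n \<Longrightarrow> y \<in> zsub n \<Longrightarrow> x + y \<in> zsub n"
| zsub_scal: "c \<in> dyadic \<Longrightarrow> x \<in> zsub n \<Longrightarrow> scal c x \<in> zsub n"

text \<open>Positive roots [i,j] encoded as pairs (i,j), 1 \<le> i \<le> j \<le> n-1.\<close>
definition posroots :: "nat \<Rightarrow> (nat \<times> nat) set" where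
  "posroots n = {(i, j). 1 \<le> i \<and> i \<le> j \<and> j \<le> n - 1}"

fun root_vec :: "nat \<times> nat \<Rightarrow> nat \<Rightarrow> falg" where
  "root_vec (i, j) r = foldl (\<lambda>x k. comm x (gen (k, 0))) (gen (i, r)) [Suc i..<Suc j]"

text \<open>Positive roots listed in increasing order w.r.t. the given order on Delta^+.\<close>
definition roots_list :: "nat \<Rightarrow> (nat \<times> nat) list" where
  "roots_list n = concat (map (\<lambda>i. map (\<lambda>j. (i, j)) [i..<n]) [1..<n])"

definition FS :: "nat \<Rightarrow> ((nat \<times> nat) \<times> nat \<Rightarrow> nat) set" where
  "FS n = {h. finite {p. h p \<noteq> 0} \<and> (\<forall>\<beta> r. h (\<beta>, r) \<noteq> 0 \<longrightarrow> \<beta> \<in> posroots n)}"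

definition rbound :: "((nat \<times> nat) \<times> nat \<Rightarrow> nat) \<Rightarrow> nat" where
  "rbound h = Suc (Max {r. \<exists>\<beta>. h (\<beta>, r) \<noteq> 0})"

text \<open>Ordered product: beta increasing, and for equal beta, r decreasing (factors with
  h = 0 equal 1).\<close>
definition Eh :: "nat \<Rightarrow> ((nat \<times> nat) \<times> nat \<Rightarrow> nat) \<Rightarrow> falg" where
  "Eh n h = foldr fmul
     (concat (map (\<lambda>\<beta>. map (\<lambda>r. scal (1 / fact (h (\<beta>, r))) (fpow (root_vec \<beta> r) (h (\<beta>, r))))
                             (rev [0..<rbound h])) (roots_list n))) fone"

end

theory Submission
  imports Defs "HOL-Library.Product_Lexorder" "HOL-Library.List_Lexorder"
    "HOL-Computational_Algebra.Formal_Laurent_Series"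
begin

text \<open>
  \<^emph>\<open>Divided powers.\<close> Let \<open>x\<close> be the root vector of \<open>[i, j - 1]\<close> at level \<open>r\<close>, let \<open>y\<close> be the
  generator of colour \<open>j\<close> at level 0, and put \<open>z = [x, y]\<close>. The Serre relations make \<open>z\<close> commute with \<open>x\<close>
  and \<open>y\<close>. Hence, with \<open>D a t\<close> the divided power \<open>a ^ t / t!\<close>,
  \<open>D x t * D y t = (\<Sum>k\<le>t. D y (t - k) * D z k * D x (t - k))\<close>, which expresses \<open>D z t\<close> through smaller
  divided powers; so the ordered monomials lie in the integral form.

  \<^emph>\<open>Spanning over the complex numbers.\<close> Filter by the total level. Modulo lower terms the root vectors
  span a Lie algebra, so every word can be straightened into ordered monomials.

  \<^emph>\<open>Coefficients.\<close> The algebra maps to functions of finite sets of coloured points in a field, with the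
  shuffle product twisted by the factors \<open>1 + (c/2) / (x - y)\<close> for Cartan entries \<open>c\<close>. The divided
  power of a generator becomes a monomial, by Lagrange interpolation. Evaluate at unions of strings: a string for the
  root \<open>[i, j]\<close> has the points \<open>y - k/2\<close> of colour \<open>k\<close>. The twist vanishes from colour \<open>k\<close> to colour
  \<open>k + 1\<close> of a string, so an ordered monomial vanishes unless its list of roots is lexicographically at
  least that of the strings, and in case of equality only the assignments of whole strings contribute.
  With each \<open>y\<close> a power of the inverse variable of a Laurent series, with rapidly decreasing exponents,
  the leading term of such a monomial is a power of \<open>-2\<close> and its position determines the monomial.
  Elements of the integral form take values with dyadic coefficients; hence the coefficients of an
  expansion are dyadic, and they vanish if the element is zero.
\<close>

text \<open>Straightening divided powers over \<open>dyadic\<close> is never attempted: it would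
  need commutation formulas with controlled denominators for every pair of roots. Straightening
  takes place over the complex numbers, and integrality of the coefficients is read off afterwards
  from values, so one detection argument serves both spanning and independence. Laurent series are
  used because those with dyadic coefficients form a ring in which leading coefficient 1 or -1
  implies invertibility; all differences of points on different strings are of this kind, so the
  twist stays dyadic. Inside one string the spacing 1/2 makes the twist 0 in one direction and 2 in
  the other, and every bracket of a root vector contributes 0 - 2; the leading coefficients become
  units only once 2 is inverted. Equal factors of a monomial can be matched with strings in several
  ways. Their number is the product of the factorials in the denominator of \<open>Eh\<close>, which
  it cancels.\<close>

definition cm :: "'a::ring \<Rightarrow> 'a \<Rightarrow> 'a" where
  "cm x y = x * y - y * x"

lemma cm_add_left: "cm (x + y) z = cm x z + cm y z"
  and cm_diff_left: "cm (x - y) z = cm x z - cm y z"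
  and cm_minus_left: "cm (- x) z = - cm x z"
  and cm_minus_right: "cm x (- z) = - cm x z"
  and cm_zero_left [simp]: "cm 0 z = 0"
  and cm_zero_right [simp]: "cm z 0 = 0"
  by (simp_all add: cm_def algebra_simps)

lemma cm_swap: "cm x y = - cm y x"
  by (simp add: cm_def)

lemma cm_jacobi_left: "cm (cm x y) z = cm (cm x z) y + cm x (cm y z)"
  by (simp add: cm_def algebra_simps)

lemma cm_jacobi_right: "cm x (cm y z) = cm (cm x y) z - cm (cm x z) y"
  by (simp add: cm_def algebra_simps)

lemma cm_jacobi_deriv: "cm x (cm y z) = cm (cm x y) z + cm y (cm x z)"
  by (simp add: cm_def algebra_simps)

lemma cm_eq_0_swap: "cm x y = 0 \<Longrightarrow> cm y x = 0"
  by (simp add: cm_def)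

lemma cm_eq_0_iff: "cm x y = 0 \<longleftrightarrow> x * y = y * x"
  by (simp add: cm_def)

text \<open>Scalars enter through central elements \<open>cc a\<close>, so a bare ring suffices. The
  relations are assumed for all colours, which keeps the bound \<open>n\<close> out of the
  algebra.\<close>

locale yangian =
  fixes cc :: "complex \<Rightarrow> 'a::ring_1" and e :: "nat \<Rightarrow> nat \<Rightarrow> 'a"
  assumes cc_add: "cc (a + b) = cc a + cc b"
    and cc_mult: "cc (a * b) = cc a * cc b"
    and cc_1: "cc 1 = 1"
    and cc_central: "cc a * x = x * cc a"
    and rel_quad: "cm (e i (Suc r)) (e j s) - cm (e i r) (e j (Suc s)) =
        cc (cartan i j / 2) * (e i r * e j s + e j s * e i r)"
    and rel_far: "cartan i j = 0 \<Longrightarrow> cm (e i r) (e j s) = 0"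
    and rel_serre: "cartan i j = - 1 \<Longrightarrow>
        cm (e i r1) (cm (e i r2) (e j s)) + cm (e i r2) (cm (e i r1) (e j s)) = 0"
begin

lemma cc_0: "cc 0 = 0"
  using cc_add[of 0 0] by simp

lemma cc_minus: "cc (- a) = - cc a"
  using cc_add[of a "- a"] by (simp add: cc_0 eq_neg_iff_add_eq_0 add.commute)

lemma cc_of_nat: "cc (of_nat k) = of_nat k"
  by (induction k) (simp_all add: cc_0 cc_add cc_1)

lemma cc_commute: "x * (cc a * y) = cc a * (x * y)"
  by (metis cc_central mult.assoc)

lemma half_double: "x = cc (1/2) * (x + x)"
proof -
  have "cc (1/2) * (x + x) = (cc (1/2) + cc (1/2)) * x" by (simp add: algebra_simps)
  also have "\<dots> = x" by (simp add: cc_add[symmetric] cc_1)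
  finally show ?thesis by simp
qed

lemma double_eq_0: "x + x = 0 \<Longrightarrow> x = (0::'a)"
  using half_double[of x] by simp

fun rv :: "nat \<times> nat \<Rightarrow> nat \<Rightarrow> 'a" where
  "rv (i, j) r = foldl (\<lambda>x k. cm x (e k 0)) (e i r) [Suc i..<Suc j]"

lemma rv_simple [simp]: "rv (i, i) r = e i r"
  by simp

lemma rv_Suc: "i \<le> j \<Longrightarrow> rv (i, Suc j) r = cm (rv (i, j) r) (e (Suc j) 0)"
  by simp

declare rv.simps [simp del]

lemma rv_far: "i \<le> j \<Longrightarrow> Suc j < k \<or> Suc k < i \<Longrightarrow> cm (rv (i, j) r) (e k s) = 0"
proof (induction j rule: dec_induct)
  case base
  then show ?case by (auto intro!: rel_far simp: cartan_def)
next
  case (step m)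
  have "cm (e (Suc m) 0) (e k s) = 0"
    using step by (intro rel_far) (auto simp: cartan_def)
  then show ?case using step by (auto simp: rv_Suc cm_jacobi_left[of _ "e (Suc m) 0"])
qed

subsection \<open>Divided powers\<close>

definition Dv :: "'a \<Rightarrow> nat \<Rightarrow> 'a" where
  "Dv x t = cc (1 / fact t) * x ^ t"

lemma Dv_0 [simp]: "Dv x 0 = 1"
  by (simp add: Dv_def cc_1)

lemma Dv_Suc: "x * Dv x t = of_nat (Suc t) * Dv x (Suc t)"
proof -
  have "of_nat (Suc t) * Dv x (Suc t) = cc (of_nat (Suc t) * (1 / fact (Suc t))) * x ^ Suc t"
    unfolding Dv_def cc_mult cc_of_nat by (simp add: mult.assoc)
  also have "of_nat (Suc t) * (1 / fact (Suc t)) = (1 / fact t :: complex)"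
    by (simp del: of_nat_Suc)
  finally show ?thesis by (simp add: Dv_def cc_commute)
qed

lemma of_nat_cancel: "of_nat (Suc t) * x = of_nat (Suc t) * y \<Longrightarrow> x = (y::'a)"
proof -
  assume *: "of_nat (Suc t) * x = of_nat (Suc t) * y"
  have "cc (1 / of_nat (Suc t)) * (of_nat (Suc t) * z) = z" for z
    by (simp only: cc_of_nat[symmetric] mult.assoc[symmetric] cc_mult[symmetric])
       (simp add: cc_1 del: of_nat_Suc)
  then show "x = y" using * by metis
qed

lemma commute_Dv: "x * z = z * x \<Longrightarrow> x * Dv z t = Dv z t * x"
  by (simp add: Dv_def cc_commute mult.assoc power_commuting_commutes)

text \<open>The bracket with \<open>x\<close> is a derivation sending \<open>y\<close> to
  \<open>z\<close>, and \<open>z\<close> commutes with \<open>y\<close>, so it lowers the divided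
  power of \<open>y\<close> by one. The case \<open>b = 0\<close> is separate because
  \<open>b - 1\<close> would be 0 there.\<close>

lemma left_commute_Dv:
  assumes "cm x y = z" "z * y = y * z"
  shows "x * Dv y b = Dv y b * x + (if b = 0 then 0 else z * Dv y (b - 1))"
proof (induction b)
  case (Suc b)
  have xy: "x * y = y * x + z" using assms by (auto simp: cm_def)
  have "of_nat (Suc b) * (x * Dv y (Suc b)) = x * y * Dv y b"
    by (metis Dv_Suc mult.assoc mult_of_nat_commute)
  also have "\<dots> = y * (x * Dv y b) + z * Dv y b"
    by (simp add: xy distrib_right mult.assoc)
  also have "\<dots> = y * Dv y b * x + (if b = 0 then 0 else y * z * Dv y (b - 1)) + z * Dv y b"
    by (simp add: Suc distrib_left mult.assoc)
  also have "(if b = 0 then 0 else y * z * Dv y (b - 1)) = of_nat b * (z * Dv y b)"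
  proof (cases b)
    case (Suc c)
    then have "y * z * Dv y (b - 1) = z * (y * Dv y c)"
      using assms(2) by (simp flip: mult.assoc)
    then show ?thesis using Suc by (metis Dv_Suc mult.assoc mult_of_nat_commute nat.distinct(1))
  qed simp
  also have "y * Dv y b * x + of_nat b * (z * Dv y b) + z * Dv y b =
      of_nat (Suc b) * (Dv y (Suc b) * x + z * Dv y b)"
    by (simp add: Dv_Suc algebra_simps)
  finally have "x * Dv y (Suc b) = Dv y (Suc b) * x + z * Dv y b"
    by (rule of_nat_cancel)
  then show ?case by simp
qed simp

text \<open>Divided power with exponent \<open>b - k\<close>, set to 0 when that exponent is
  negative; truncated subtraction would give 1. Sums may then run past \<open>b\<close>.\<close>

definition Dd :: "'a \<Rightarrow> nat \<Rightarrow> nat \<Rightarrow> 'a" where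
  "Dd y b k = (if k \<le> b then Dv y (b - k) else 0)"

text \<open>Induction on \<open>a\<close>: multiplication by \<open>x\<close> turns summand
  \<open>k\<close> into multiples of the summands \<open>k\<close> and \<open>Suc k\<close> for
  \<open>Suc a\<close>. The two multiplicities meeting at one index add up to \<open>Suc a\<close>,
  which is then cancelled.\<close>

lemma Dv_times_Dv:
  assumes z: "cm x y = z" and zx: "z * x = x * z" and zy: "z * y = y * z"
  shows "Dv x a * Dv y b = (\<Sum>k\<le>a. Dd y b k * Dv z k * Dv x (a - k))"
proof (induction a)
  case 0
  show ?case by (simp add: Dd_def)
next
  case (Suc a)
  have x: "x * Dd y b k = Dd y b k * x + z * Dd y b (Suc k)" for k
    using left_commute_Dv[OF z zy, of "b - k"] by (auto simp: Dd_def)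
  have zD: "z * Dd y b k = Dd y b k * z" for k
    by (simp add: Dd_def commute_Dv zy)
  have xz: "x * Dv z k = Dv z k * x" for k
    by (rule commute_Dv) (simp add: zx)
  have t: "x * (Dd y b k * Dv z k * Dv x (a - k)) =
      of_nat (Suc a - k) * (Dd y b k * Dv z k * Dv x (Suc a - k)) +
      of_nat (Suc k) * (Dd y b (Suc k) * Dv z (Suc k) * Dv x (Suc a - Suc k))" if "k \<le> a" for k
  proof -
    have "x * (Dd y b k * Dv z k * Dv x (a - k)) =
       Dd y b k * (x * Dv z k) * Dv x (a - k) + Dd y b (Suc k) * (z * Dv z k) * Dv x (a - k)"
      by (simp add: x zD distrib_right mult.assoc[symmetric])
    also have "Dd y b k * (x * Dv z k) * Dv x (a - k) =
        Dd y b k * Dv z k * (x * Dv x (a - k))" by (simp add: xz mult.assoc)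
    also have "x * Dv x (a - k) = of_nat (Suc a - k) * Dv x (Suc a - k)"
      using that by (simp add: Dv_Suc Suc_diff_le)
    finally show ?thesis
      by (simp add: Dv_Suc mult.assoc mult_of_nat_commute del: of_nat_Suc)
  qed
  have "of_nat (Suc a) * (Dv x (Suc a) * Dv y b) = x * (Dv x a * Dv y b)"
    by (simp add: Dv_Suc mult.assoc[symmetric] del: of_nat_Suc)
  also have "\<dots> = (\<Sum>k\<le>a. x * (Dd y b k * Dv z k * Dv x (a - k)))"
    by (simp add: Suc sum_distrib_left)
  also have "\<dots> = (\<Sum>k\<le>a. of_nat (Suc a - k) * (Dd y b k * Dv z k * Dv x (Suc a - k))) +
      (\<Sum>k\<le>a. of_nat (Suc k) * (Dd y b (Suc k) * Dv z (Suc k) * Dv x (Suc a - Suc k)))"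
    unfolding sum.distrib[symmetric] by (intro sum.cong refl t) auto
  \<comment> \<open>The added summand \<open>k = Suc a\<close> has coefficient 0, and so has the
    summand \<open>k = 0\<close> created by the index shift below.\<close>
  also have "(\<Sum>k\<le>a. of_nat (Suc a - k) * (Dd y b k * Dv z k * Dv x (Suc a - k))) =
      (\<Sum>k\<le>Suc a. of_nat (Suc a - k) * (Dd y b k * Dv z k * Dv x (Suc a - k)))" by simp
  also have "(\<Sum>k\<le>a. of_nat (Suc k) * (Dd y b (Suc k) * Dv z (Suc k) * Dv x (Suc a - Suc k))) =
      (\<Sum>k\<le>Suc a. of_nat k * (Dd y b k * Dv z k * Dv x (Suc a - k)))"
    by (subst sum.atMost_Suc_shift) simp
  also have "(\<Sum>k\<le>Suc a. of_nat (Suc a - k) * (Dd y b k * Dv z k * Dv x (Suc a - k))) + \<dots> =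
      (\<Sum>k\<le>Suc a. of_nat (Suc a) * (Dd y b k * Dv z k * Dv x (Suc a - k)))"
    unfolding sum.distrib[symmetric]
    by (intro sum.cong refl) (simp flip: distrib_right of_nat_add del: of_nat_Suc)
  also have "\<dots> = of_nat (Suc a) * (\<Sum>k\<le>Suc a. Dd y b k * Dv z k * Dv x (Suc a - k))"
    by (simp only: sum_distrib_left)
  finally show ?case by (rule of_nat_cancel)
qed

section \<open>The integral form and the divided powers of root vectors\<close>

inductive_set Zalg :: "'a set" where
  Zalg_one: "1 \<in> Zalg"
| Zalg_gen: "Dv (e i r) t \<in> Zalg"
| Zalg_mult: "x \<in> Zalg \<Longrightarrow> y \<in> Zalg \<Longrightarrow> x * y \<in> Zalg"
| Zalg_add: "x \<in> Zalg \<Longrightarrow> y \<in> Zalg \<Longrightarrow> x + y \<in> Zalg"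
| Zalg_scal: "c \<in> dyadic \<Longrightarrow> x \<in> Zalg \<Longrightarrow> cc c * x \<in> Zalg"

lemma Zalg_uminus: "x \<in> Zalg \<Longrightarrow> - x \<in> Zalg"
proof -
  assume "x \<in> Zalg"
  moreover have "- 1 \<in> dyadic" unfolding dyadic_def
    by (rule CollectI, rule exI[of _ "-1"], rule exI[of _ 0]) simp
  ultimately have "cc (- 1) * x \<in> Zalg" by (intro Zalg_scal)
  then show ?thesis by (simp add: cc_minus cc_1)
qed

lemma Zalg_zero: "0 \<in> Zalg"
  using Zalg_add[OF Zalg_one Zalg_uminus[OF Zalg_one]] by simp

lemma Zalg_sum: "(\<And>a. a \<in> A \<Longrightarrow> f a \<in> Zalg) \<Longrightarrow> sum f A \<in> Zalg"
  by (induction A rule: infinite_finite_induct) (auto intro: Zalg_zero Zalg_add)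

lemma Zalg_Dv_cm:
  assumes z: "cm x y = z" and zx: "cm x z = 0" and zy: "cm y z = 0"
    and x: "\<And>t. Dv x t \<in> Zalg" and y: "\<And>t. Dv y t \<in> Zalg"
  shows "Dv z t \<in> Zalg"
proof (induction t rule: less_induct)
  case (less t)
  have "Dv x t * Dv y t = (\<Sum>k\<le>t. Dd y t k * Dv z k * Dv x (t - k))"
    using zx zy by (intro Dv_times_Dv z) (simp_all add: cm_eq_0_iff)
  \<comment> \<open>In the summand \<open>k = t\<close> both outer factors are 1, so
    \<open>Dv z t\<close> stands alone and can be solved for.\<close>
  also have "{..t} = insert t {..<t}" by auto
  finally have "Dv z t = Dv x t * Dv y t - (\<Sum>k<t. Dd y t k * Dv z k * Dv x (t - k))"
    by (simp add: Dd_def)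
  moreover have "(\<Sum>k<t. Dd y t k * Dv z k * Dv x (t - k)) \<in> Zalg"
    by (intro Zalg_sum Zalg_mult) (auto simp: Dd_def x y less)
  ultimately show ?case
    using Zalg_add[OF Zalg_mult[OF x y] Zalg_uminus] by simp
qed

lemma serre_sq: "cartan i j = - 1 \<Longrightarrow> cm (e i r) (cm (e i r) (e j s)) = 0"
  using rel_serre[of i j r r s] by (rule double_eq_0)

text \<open>All of the root vector before colour \<open>j\<close> commutes with colour
  \<open>Suc j\<close>, so the double bracket acts on the generator of colour \<open>j\<close>
  alone, where the Serre relation applies.\<close>

lemma rv_serre_right:
  "i \<le> j \<Longrightarrow> cm (e (Suc j) 0) (rv (i, Suc j) r) = 0"
proof (cases "i = j")
  case True
  have "cm (e (Suc j) 0) (cm (e (Suc j) 0) (e j r)) = 0"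
    by (rule serre_sq) (simp add: cartan_def)
  then show ?thesis using True
    by (simp add: rv_Suc cm_swap[of "e j r"] cm_minus_right)
next
  case False
  assume "i \<le> j"
  then obtain k where k: "j = Suc k" "i \<le> k" using False by (cases j) auto
  let ?x = "rv (i, k) r" and ?b = "e j 0" and ?c = "e (Suc j) 0"
  have 1: "cm ?x ?c = 0" using k by (intro rv_far) auto
  have 2: "cm ?c (cm ?c ?b) = 0" by (rule serre_sq) (simp add: cartan_def)
  have "cm (cm ?b ?c) ?c = cm ?c (cm ?c ?b)" by (simp add: cm_def algebra_simps)
  then have "cm (cm (cm ?x ?b) ?c) ?c = 0"
    by (simp add: cm_jacobi_left[of ?x _ ?c] 1 2)
  then have "cm ?c (cm (cm ?x ?b) ?c) = 0" by (rule cm_eq_0_swap)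
  then show ?thesis using k \<open>i \<le> j\<close> by (simp add: rv_Suc)
qed

text \<open>With \<open>?x = cm ?x' ?b\<close>, it is enough that \<open>?x'\<close> and
  \<open>?b\<close> both commute with \<open>?w\<close>. For \<open>?x'\<close> this is the
  induction hypothesis; for \<open>?b\<close>, two Jacobi expansions of the bracket differ by a
  sign.\<close>

lemma rv_serre_left: "i \<le> j \<Longrightarrow> cm (rv (i, j) r) (rv (i, Suc j) r) = 0"
proof (induction j rule: dec_induct)
  case base
  show ?case by (simp add: rv_Suc) (rule serre_sq, simp add: cartan_def)
next
  case (step k)
  let ?x' = "rv (i, k) r" and ?b = "e (Suc k) 0" and ?c = "e (Suc (Suc k)) 0"
  let ?x = "rv (i, Suc k) r" and ?w = "rv (i, Suc (Suc k)) r"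
  have x: "?x = cm ?x' ?b" and w: "?w = cm ?x ?c" using step by (simp_all add: rv_Suc)
  have 1: "cm ?x' ?c = 0" using step by (intro rv_far) auto
  have 2: "cm ?b ?x = 0" using step by (intro rv_serre_right) auto
  have 3: "cm ?b (cm ?b ?c) = 0" by (rule serre_sq) (simp add: cartan_def)
  have 4: "cm ?x' ?w = 0" using step.IH 1 by (simp add: w cm_jacobi_right[of ?x'])
  have w': "?w = cm ?x' (cm ?b ?c)" by (simp add: w x cm_jacobi_left[of ?x'] 1)
  have "cm ?b ?w = cm (cm ?b ?x') (cm ?b ?c) + cm ?x' (cm ?b (cm ?b ?c))"
    unfolding w' by (rule cm_jacobi_deriv)
  also have "\<dots> = - cm ?x (cm ?b ?c)" by (simp add: 3 x cm_swap[of ?b ?x'] cm_minus_left)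
  finally have 5: "cm ?b ?w = - cm ?x (cm ?b ?c)" .
  \<comment> \<open>The second expansion: the first summand is 0 by \<open>rv_serre_right\<close>,
    and what remains is the negative of the value found before.\<close>
  have "cm ?b ?w = cm (cm ?b ?x) ?c + cm ?x (cm ?b ?c)"
    unfolding w by (rule cm_jacobi_deriv)
  then have "cm ?b ?w + cm ?b ?w = 0" using 5 by (metis 2 add.left_inverse cm_zero_left add_0)
  then have 6: "cm ?b ?w = 0" by (rule double_eq_0)
  show ?case using 4 6 by (simp add: x cm_jacobi_left[of ?x' ?b])
qed

lemma Zalg_Dv_rv: "i \<le> j \<Longrightarrow> Dv (rv (i, j) r) t \<in> Zalg"
proof (induction j arbitrary: t rule: dec_induct)
  case base
  show ?case by (simp add: Zalg_gen)
next
  case (step k)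
  show ?case
    by (rule Zalg_Dv_cm[of "rv (i, k) r" "e (Suc k) 0"])
       (use step in \<open>auto simp: rv_Suc[symmetric] rv_serre_left rv_serre_right Zalg_gen\<close>)
qed

subsection \<open>Straightening\<close>

definition ew :: "(nat \<times> nat) list \<Rightarrow> 'a" where
  "ew w = prod_list (map (\<lambda>(i, r). e i r) w)"

definition dg :: "('b \<times> nat) list \<Rightarrow> nat" where
  "dg w = sum_list (map snd w)"

lemma ew_append: "ew (u @ v) = ew u * ew v"
  by (simp add: ew_def)

lemma dg_simps [simp]: "dg [] = 0" "dg (p # w) = snd p + dg w" "dg (u @ v) = dg u + dg v"
  by (simp_all add: dg_def)

text \<open>The strict bound on the level makes congruence modulo \<open>Lf m\<close> the equality
  of leading parts of level \<open>m\<close>. Building elements term by term turns linearity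
  arguments into inductions.\<close>

inductive_set Lf :: "nat \<Rightarrow> 'a set" for m where
  Lf_zero: "0 \<in> Lf m"
| Lf_word: "dg w < m \<Longrightarrow> x \<in> Lf m \<Longrightarrow> cc c * ew w + x \<in> Lf m"

lemma Lf_add: "x \<in> Lf m \<Longrightarrow> y \<in> Lf m \<Longrightarrow> x + y \<in> Lf m"
  by (induction rule: Lf.induct) (auto simp: add.assoc intro: Lf_word)

lemma Lf_scal: "x \<in> Lf m \<Longrightarrow> cc c * x \<in> Lf m"
  by (induction rule: Lf.induct)
     (auto simp: distrib_left mult.assoc[symmetric] cc_mult[symmetric] intro: Lf_zero Lf_word)

lemma Lf_minus: "x \<in> Lf m \<Longrightarrow> - x \<in> Lf m"
  using Lf_scal[of x m "- 1"] by (simp add: cc_minus cc_1)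

lemma Lf_diff: "x \<in> Lf m \<Longrightarrow> y \<in> Lf m \<Longrightarrow> x - y \<in> Lf m"
  using Lf_add[of x m "- y"] Lf_minus[of y m] by simp

lemma Lf_ew: "dg w < m \<Longrightarrow> ew w \<in> Lf m"
  using Lf_word[OF _ Lf_zero, of w m 1] by (simp add: cc_1)

lemma Lf_e: "e i r \<in> Lf (Suc r)"
  using Lf_ew[of "[(i, r)]" "Suc r"] by (simp add: ew_def)

lemma Lf_mono: "x \<in> Lf m \<Longrightarrow> m \<le> m' \<Longrightarrow> x \<in> Lf m'"
  by (induction rule: Lf.induct) (auto intro: Lf_zero Lf_word)

text \<open>Words of level at most \<open>a - 1\<close> and \<open>b - 1\<close> concatenate to
  level at most \<open>a + b - 2\<close>, again one below the bound; for \<open>a = 0\<close> or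
  \<open>b = 0\<close> the product is 0.\<close>

lemma Lf_mult:
  assumes "x \<in> Lf a" "y \<in> Lf b" shows "x * y \<in> Lf (a + b - 1)"
  using assms(1)
proof (induction rule: Lf.induct)
  case Lf_zero
  then show ?case by (simp add: Lf.Lf_zero)
next
  case (Lf_word u x c)
  have "ew u * y \<in> Lf (a + b - 1)" using assms(2)
  proof (induction rule: Lf.induct)
    case Lf_zero
    then show ?case by (simp add: Lf.Lf_zero)
  next
    case (Lf_word v z d)
    then show ?case using \<open>dg u < a\<close>
      by (simp add: distrib_left cc_commute ew_append[symmetric] Lf.Lf_word)
  qed
  then show ?case using Lf_word by (simp add: distrib_right mult.assoc Lf_add Lf_scal)
qed

lemma Lf_mult1: "x \<in> Lf (Suc a) \<Longrightarrow> y \<in> Lf (Suc b) \<Longrightarrow> x * y \<in> Lf (Suc (a + b))"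
  using Lf_mult[of x "Suc a" y "Suc b"] by simp

lemma Lf_half: "x + x \<in> Lf m \<Longrightarrow> x \<in> Lf m"
  using Lf_scal[of "x + x" m "1/2"] half_double[of x] by simp

lemma Lf_cm: "x \<in> Lf m \<Longrightarrow> z \<in> Lf (Suc k) \<Longrightarrow> cm x z \<in> Lf (m + k)"
  using Lf_mult[of x m z "Suc k"] Lf_mult[of z "Suc k" x m]
  by (auto simp: cm_def add.commute intro: Lf_diff)

lemma Lf_cm1: "x \<in> Lf (Suc m) \<Longrightarrow> z \<in> Lf (Suc k) \<Longrightarrow> cm x z \<in> Lf (Suc (m + k))"
  using Lf_cm[of x "Suc m" z k] by simp

section \<open>Commutators modulo terms of lower level\<close>

definition eqv :: "nat \<Rightarrow> 'a \<Rightarrow> 'a \<Rightarrow> bool" where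
  "eqv m x y \<longleftrightarrow> x - y \<in> Lf m"

lemma eqv_refl [simp]: "eqv m x x"
  by (simp add: eqv_def Lf_zero)

lemma eqv_sym: "eqv m x y \<Longrightarrow> eqv m y x"
  using Lf_minus[of "x - y" m] by (simp add: eqv_def)

lemma eqv_trans [trans]: "eqv m x y \<Longrightarrow> eqv m y z \<Longrightarrow> eqv m x z"
  using Lf_add[of "x - y" m "y - z"] by (simp add: eqv_def)

lemma eqv_eq_trans [trans]: "eqv m x y \<Longrightarrow> y = z \<Longrightarrow> eqv m x z"
  and eq_eqv_trans [trans]: "x = y \<Longrightarrow> eqv m y z \<Longrightarrow> eqv m x z"
  by simp_all

lemma eqv_add: "eqv m x y \<Longrightarrow> eqv m x' y' \<Longrightarrow> eqv m (x + x') (y + y')"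
  using Lf_add[of "x - y" m "x' - y'"] by (simp add: eqv_def algebra_simps)

lemma eqv_minus: "eqv m x y \<Longrightarrow> eqv m (- x) (- y)"
  using Lf_minus[of "x - y" m] by (simp add: eqv_def)

lemma eqv_diff: "eqv m x y \<Longrightarrow> eqv m x' y' \<Longrightarrow> eqv m (x - x') (y - y')"
  using Lf_diff[of "x - y" m "x' - y'"] by (simp add: eqv_def algebra_simps)

lemma eqv_cm_left: "eqv m x y \<Longrightarrow> z \<in> Lf (Suc k) \<Longrightarrow> m' = m + k \<Longrightarrow> eqv m' (cm x z) (cm y z)"
  using Lf_cm[of "x - y" m z k] by (simp add: eqv_def cm_diff_left)

lemma eqv_cm_right: "eqv m x y \<Longrightarrow> z \<in> Lf (Suc k) \<Longrightarrow> m' = m + k \<Longrightarrow> eqv m' (cm z x) (cm z y)"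
  using eqv_minus[OF eqv_cm_left[of m x y z k m']] by (simp add: cm_swap[of z])

lemma eqv_half: "eqv m x (- x) \<Longrightarrow> eqv m x 0"
  using Lf_half[of x m] by (simp add: eqv_def)

text \<open>The right side of the quadratic relation is one level below the commutators. Hence a
  leading commutator depends only on the sum of the levels, as in a Lie algebra of polynomial
  loops.\<close>

lemma eqv_shift1: "eqv (Suc (r + s)) (cm (e i (Suc r)) (e j s)) (cm (e i r) (e j (Suc s)))"
proof -
  have "e i r * e j s \<in> Lf (Suc (r + s))" "e j s * e i r \<in> Lf (Suc (r + s))"
    using Lf_mult1[OF Lf_e Lf_e, of i r j s] Lf_mult1[OF Lf_e Lf_e, of j s i r]
    by (simp_all add: add.commute)
  then show ?thesis unfolding eqv_def rel_quad by (intro Lf_scal Lf_add)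
qed

lemma eqv_shift: "eqv (r + s) (cm (e i r) (e j s)) (cm (e i (r + s)) (e j 0))"
proof (induction s arbitrary: r)
  case (Suc s)
  show ?case using eqv_trans[OF eqv_sym[OF eqv_shift1[of r s i j]]] Suc[of "Suc r"] by simp
qed simp

lemma eqv_shift_right: "eqv (r + s) (cm (e i r) (e j s)) (cm (e i 0) (e j (r + s)))"
  using eqv_trans[OF eqv_shift[of r s i j] eqv_sym[OF eqv_shift[of 0 "r + s" i j, simplified]]] .

text \<open>Shifting the whole level to the other side and using antisymmetry shows that the
  commutator is congruent to its own negative.\<close>

lemma eqv_same: "eqv (r + s) (cm (e i r) (e i s)) 0"
proof -
  have "eqv (r + s) (cm (e i r) (e i s)) (cm (e i 0) (e i (r + s)))" by (rule eqv_shift_right)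
  also have "\<dots> = - cm (e i (r + s)) (e i 0)" by (rule cm_swap)
  also have "eqv (r + s) (- cm (e i (r + s)) (e i 0)) (- cm (e i r) (e i s))"
    by (rule eqv_minus[OF eqv_sym[OF eqv_shift]])
  finally show ?thesis by (rule eqv_half)
qed

text \<open>The Serre relation kills only the part symmetric in the levels \<open>b\<close> and
  \<open>s\<close>. The antisymmetric part is a bracket with \<open>cm (e j b) (e j s)\<close>,
  which is of lower level by \<open>eqv_same\<close>.\<close>

lemma eqv_serre:
  assumes "cartan j i = - 1"
  shows "eqv (a + b + s) (cm (cm (e i a) (e j b)) (e j s)) 0"
proof -
  let ?x = "cm (e j s) (cm (e j b) (e i a))"
  have "cm (cm (e j b) (e j s)) (e i a) + ?x + ?x = 0"
    using rel_serre[OF assms, of b s a] cm_jacobi_deriv[of "e j b" "e j s" "e i a"] by simp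
  then have "?x + ?x = - cm (cm (e j b) (e j s)) (e i a)"
    by (metis add.assoc minus_unique)
  moreover have "eqv (a + b + s) (cm (cm (e j b) (e j s)) (e i a)) (cm 0 (e i a))"
    by (rule eqv_cm_left[OF eqv_same Lf_e]) simp
  ultimately have "?x + ?x \<in> Lf (a + b + s)" by (simp add: eqv_def Lf_minus)
  then have "?x \<in> Lf (a + b + s)" by (rule Lf_half)
  moreover have "cm (cm (e i a) (e j b)) (e j s) = ?x" by (simp add: cm_def algebra_simps)
  ultimately show ?thesis by (simp add: eqv_def)
qed

lemma eqv_serre':
  assumes "cartan j i = - 1"
  shows "eqv (a + b + s) (cm (cm (e j b) (e i a)) (e j s)) 0"
  using eqv_minus[OF eqv_serre[OF assms, of a b s]] by (simp add: cm_swap[of "e j b"] cm_minus_left)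

lemma Lf_rv: "i \<le> j \<Longrightarrow> rv (i, j) r \<in> Lf (Suc r)"
proof (induction j rule: dec_induct)
  case base
  show ?case by (simp add: Lf_e)
next
  case (step k)
  show ?case using Lf_cm1[OF step.IH Lf_e[of "Suc k" 0]] step by (simp add: rv_Suc)
qed

text \<open>Everything before the last generator commutes with colour \<open>Suc j\<close>, so the
  level \<open>s\<close> is handed down one colour by the shift for two generators and then absorbed
  by induction.\<close>

lemma eqv_rv_above:
  "i \<le> j \<Longrightarrow> eqv (r + s) (cm (rv (i, j) r) (e (Suc j) s)) (rv (i, Suc j) (r + s))"
proof (induction j rule: dec_induct)
  case base
  show ?case using eqv_shift[of r s i "Suc i"] by (simp add: rv_Suc)
next
  case (step k)
  let ?x = "rv (i, k) r" and ?b = "\<lambda>s. e (Suc k) s" and ?c = "\<lambda>s. e (Suc (Suc k)) s"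
  have x: "cm ?x (?c t) = 0" for t using step by (intro rv_far) auto
  have "cm (rv (i, Suc k) r) (?c s) = cm ?x (cm (?b 0) (?c s))"
    using step by (simp add: rv_Suc cm_jacobi_left[of ?x] x)
  also have "eqv (r + s) \<dots> (cm ?x (cm (?b s) (?c 0)))"
    by (rule eqv_cm_right[OF eqv_shift[of 0 s, simplified] Lf_rv]) (use step in auto)
  also have "\<dots> = cm (cm ?x (?b s)) (?c 0)" by (simp add: cm_jacobi_right[of ?x] x)
  also have "eqv (r + s) \<dots> (cm (rv (i, Suc k) (r + s)) (?c 0))"
    by (rule eqv_cm_left[OF step.IH Lf_e]) simp
  also have "\<dots> = rv (i, Suc (Suc k)) (r + s)" using step by (simp add: rv_Suc)
  finally show ?case .
qed

lemma eqv_rv_below: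
  "Suc i \<le> j \<Longrightarrow> eqv (r + s) (cm (rv (Suc i, j) r) (e i s)) (- rv (i, j) (r + s))"
proof (induction j rule: dec_induct)
  case base
  have "eqv (r + s) (- cm (e i s) (e (Suc i) r)) (- cm (e i (r + s)) (e (Suc i) 0))"
    using eqv_minus[OF eqv_shift[of s r i "Suc i"]] by (simp add: add.commute)
  then show ?case by (simp add: rv_Suc cm_swap[of "e (Suc i) r"])
next
  case (step k)
  let ?x = "rv (Suc i, k) r" and ?c = "e (Suc k) 0"
  have x: "cm ?c (e i s) = 0" using step by (intro rel_far) (auto simp: cartan_def)
  have "cm (rv (Suc i, Suc k) r) (e i s) = cm (cm ?x (e i s)) ?c"
    using step by (simp add: rv_Suc cm_jacobi_left[of ?x ?c "e i s"] x)
  also have "eqv (r + s) \<dots> (cm (- rv (i, k) (r + s)) ?c)"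
    by (rule eqv_cm_left[OF step.IH Lf_e]) simp
  also have "\<dots> = - rv (i, Suc k) (r + s)" using step by (simp add: rv_Suc cm_minus_left)
  finally show ?case .
qed

text \<open>The part before the last two colours commutes with colour \<open>j\<close>; the bracket
  passes to these two colours and becomes a Serre expression.\<close>

lemma eqv_rv_end:
  assumes "i \<le> j"
  shows "eqv (r + s) (cm (rv (i, j) r) (e j s)) 0"
proof (cases "i = j")
  case True
  then show ?thesis by (simp add: eqv_same)
next
  case False
  then obtain k where k: "j = Suc k" "i \<le> k" using assms by (cases j) auto
  let ?b = "\<lambda>a. e k a" and ?c = "\<lambda>a. e (Suc k) a"
  show ?thesis
  proof (cases "i = k")
    case True
    then show ?thesis using eqv_serre[of "Suc k" k r 0 s] k by (simp add: rv_Suc cartan_def)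
  next
    case False
    then obtain l where l: "k = Suc l" "i \<le> l" using k by (cases k) auto
    let ?x = "rv (i, l) r"
    have x: "cm ?x (?c t) = 0" for t using l by (intro rv_far) auto
    have "rv (i, k) r = cm ?x (?b 0)" using l by (simp add: rv_Suc)
    then have "rv (i, j) r = cm (cm ?x (?b 0)) (?c 0)" using k by (simp add: rv_Suc)
    then have "cm (rv (i, j) r) (?c s) = cm ?x (cm (cm (?b 0) (?c 0)) (?c s))"
      by (simp add: cm_jacobi_left[of ?x "?b 0"] cm_jacobi_left[of ?x "cm (?b 0) (?c 0)"] x)
    also have "eqv (r + s) \<dots> (cm ?x 0)"
      by (rule eqv_cm_right[OF eqv_serre Lf_rv]) (use l in \<open>auto simp: cartan_def\<close>)
    finally show ?thesis using k by simp
  qed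
qed

text \<open>No Serre relation applies directly when both neighbours of colour \<open>k\<close> occur
  in the root. Two evaluations of the bracket give opposite leading parts, so it vanishes modulo
  lower level.\<close>

lemma eqv_rv_penultimate:
  assumes "i \<le> k"
  shows "eqv (r + s) (cm (rv (i, Suc k) r) (e k s)) 0"
proof (cases "i = k")
  case True
  then show ?thesis using eqv_serre'[of k "Suc k" 0 r s] by (simp add: rv_Suc cartan_def)
next
  case False
  then obtain l where l: "k = Suc l" "i \<le> l" using assms by (cases k) auto
  let ?b = "\<lambda>a. e k a" and ?c = "\<lambda>a. e (Suc k) a"
  let ?u = "\<lambda>r. rv (i, k) r" and ?A = "\<lambda>r. rv (i, Suc k) r" and ?x = "rv (i, l) r"
  have A: "?A t = cm (?u t) (?c 0)" for t using assms by (simp add: rv_Suc)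
  have u: "?u t \<in> Lf (Suc t)" for t using assms by (rule Lf_rv)
  have x: "?x \<in> Lf (Suc r)" using l by (intro Lf_rv) auto
  have xc: "cm ?x (?c t) = 0" for t using l by (intro rv_far) auto
  have ub: "eqv (t + t') (cm (?u t) (?b t')) 0" for t t' using assms by (rule eqv_rv_end)
  have uc: "eqv (t + t') (cm (?u t) (?c t')) (?A (t + t'))" for t t' using assms by (rule eqv_rv_above)
  have ubc: "eqv (t + t') (cm (?u t) (cm (?b 0) (?c t'))) (- cm (?A (t + t')) (?b 0))" for t t'
  proof -
    have "cm (?u t) (cm (?b 0) (?c t')) = cm (cm (?u t) (?b 0)) (?c t') - cm (cm (?u t) (?c t')) (?b 0)"
      by (rule cm_jacobi_right)
    also have "eqv (t + t') \<dots> (cm 0 (?c t') - cm (?A (t + t')) (?b 0))"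
      by (intro eqv_diff eqv_cm_left[OF ub Lf_e] eqv_cm_left[OF uc Lf_e]) simp_all
    finally show ?thesis by simp
  qed
  \<comment> \<open>First evaluation: split off the last colour and hand the level \<open>s\<close>
    to it. The result is the bracket with \<open>?A (r + s)\<close>, with a plus sign.\<close>
  have "cm (?A r) (?b s) = cm (cm (?u r) (?b s)) (?c 0) - cm (?u r) (cm (?b s) (?c 0))"
    unfolding A by (simp add: cm_def algebra_simps)
  also have "eqv (r + s) \<dots> (cm 0 (?c 0) - cm (?u r) (cm (?b 0) (?c s)))"
    by (intro eqv_diff eqv_cm_left[OF ub Lf_e] eqv_cm_right[OF eqv_sym[OF eqv_shift[of 0 s, simplified]] u])
       simp_all
  also have "eqv (r + s) \<dots> (cm 0 (?c 0) - (- cm (?A (r + s)) (?b 0)))"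
    by (intro eqv_diff ubc eqv_refl)
  finally have 1: "eqv (r + s) (cm (?A r) (?b s)) (cm (?A (r + s)) (?b 0))" by simp
  have "?u r = cm ?x (?b 0)" using l by (simp add: rv_Suc)
  then have "?A r = cm ?x (cm (?b 0) (?c 0))"
    by (simp add: A cm_jacobi_left[of ?x "?b 0"] xc)
  \<comment> \<open>Second evaluation: split off \<open>?x\<close> at the front instead. The level
    \<open>s\<close> is absorbed into \<open>?u (r + s)\<close>, and the sign is reversed.\<close>
  then have "cm (?A r) (?b s) = cm (cm ?x (?b s)) (cm (?b 0) (?c 0)) + cm ?x (cm (cm (?b 0) (?c 0)) (?b s))"
    using cm_jacobi_left[of ?x "cm (?b 0) (?c 0)" "?b s"] by simp
  also have "eqv (r + s) \<dots> (cm (?u (r + s)) (cm (?b 0) (?c 0)) + cm ?x 0)"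
  proof (intro eqv_add)
    have bc: "cm (?b 0) (?c 0) \<in> Lf (Suc 0)" using Lf_cm1[OF Lf_e Lf_e, of k 0 "Suc k" 0] by simp
    show "eqv (r + s) (cm (cm ?x (?b s)) (cm (?b 0) (?c 0))) (cm (?u (r + s)) (cm (?b 0) (?c 0)))"
      using eqv_cm_left[OF eqv_rv_above[OF l(2), of r s] bc] l by simp
    show "eqv (r + s) (cm ?x (cm (cm (?b 0) (?c 0)) (?b s))) (cm ?x 0)"
      by (rule eqv_cm_right[OF eqv_serre' x]) (auto simp: cartan_def)
  qed
  also have "eqv (r + s) \<dots> (- cm (?A (r + s)) (?b 0) + cm ?x 0)"
    using ubc[of "r + s" 0] by (intro eqv_add eqv_refl) simp
  finally have "eqv (r + s) (cm (?A r) (?b s)) (- cm (?A (r + s)) (?b 0))" by simp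
  also have "eqv (r + s) \<dots> (- cm (?A r) (?b s))" by (rule eqv_minus[OF eqv_sym[OF 1]])
  finally show ?thesis by (rule eqv_half)
qed

lemma eqv_rv_inner:
  assumes "i \<le> k" "k < j"
  shows "eqv (r + s) (cm (rv (i, j) r) (e k s)) 0"
proof -
  have "Suc k \<le> j" using assms by simp
  then show ?thesis
  proof (induction j rule: dec_induct)
    case base
    show ?case using assms by (intro eqv_rv_penultimate)
  next
    case (step m)
    have x: "cm (e (Suc m) 0) (e k s) = 0" using step by (intro rel_far) (auto simp: cartan_def)
    have "cm (rv (i, Suc m) r) (e k s) = cm (cm (rv (i, m) r) (e k s)) (e (Suc m) 0)"
      using step assms by (simp add: rv_Suc cm_jacobi_left[of "rv (i, m) r" "e (Suc m) 0" "e k s"] x)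
    also have "eqv (r + s) \<dots> (cm 0 (e (Suc m) 0))"
      by (rule eqv_cm_left[OF step.IH Lf_e]) simp
    finally show ?case by simp
  qed
qed

section \<open>The Lie algebra formed by the leading parts\<close>

inductive_set Lie :: "nat \<Rightarrow> 'a set" for m where
  Lie_Lf: "x \<in> Lf m \<Longrightarrow> x \<in> Lie m"
| Lie_rv: "i \<le> j \<Longrightarrow> x \<in> Lie m \<Longrightarrow> cc c * rv (i, j) m + x \<in> Lie m"

lemma Lie_add: "x \<in> Lie m \<Longrightarrow> y \<in> Lie m \<Longrightarrow> x + y \<in> Lie m"
proof (induction rule: Lie.induct)
  case (Lie_Lf x)
  from Lie_Lf(2,1) show ?case
  proof (induction rule: Lie.induct)
    case (Lie_rv i j y c)
    have "cc c * rv (i, j) m + (x + y) \<in> Lie m" using Lie_rv by (intro Lie.Lie_rv) auto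
    then show ?case by (simp add: add.left_commute)
  qed (auto intro: Lf_add Lie.Lie_Lf)
qed (simp add: add.assoc Lie.Lie_rv)

lemma Lie_scal: "x \<in> Lie m \<Longrightarrow> cc c * x \<in> Lie m"
  by (induction rule: Lie.induct)
     (auto simp: distrib_left mult.assoc[symmetric] cc_mult[symmetric] intro: Lie_rv Lie_Lf Lf_scal)

lemma Lie_minus: "x \<in> Lie m \<Longrightarrow> - x \<in> Lie m"
  using Lie_scal[of x m "- 1"] by (simp add: cc_minus cc_1)

lemma Lie_diff: "x \<in> Lie m \<Longrightarrow> y \<in> Lie m \<Longrightarrow> x - y \<in> Lie m"
  using Lie_add[of x m "- y"] Lie_minus[of y m] by simp

lemma Lie_root: "i \<le> j \<Longrightarrow> rv (i, j) m \<in> Lie m"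
  using Lie_rv[OF _ Lie_Lf[OF Lf_zero], of i j 1 m] by (simp add: cc_1)

lemma eqv_Lie: "eqv m x y \<Longrightarrow> y \<in> Lie m \<Longrightarrow> x \<in> Lie m"
  using Lie_add[of "x - y" m y] by (simp add: eqv_def Lie_Lf)

lemma Lie_cm_rv_e:
  assumes "i \<le> j"
  shows "cm (rv (i, j) r) (e k s) \<in> Lie (r + s)"
proof -
  have 0: "0 \<in> Lie m" for m by (intro Lie_Lf Lf_zero)
  consider "Suc k < i \<or> Suc j < k" | "Suc k = i" | "i \<le> k" "k < j" | "k = j" | "k = Suc j"
    by linarith
  then show ?thesis
  proof cases
    case 1
    then show ?thesis using rv_far[OF assms, of k r s] 0 by auto
  next
    case 2
    then show ?thesis using assms by (auto intro!: eqv_Lie[OF eqv_rv_below] Lie_minus Lie_root)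
  next
    case 3
    then show ?thesis using eqv_Lie[OF eqv_rv_inner 0] by auto
  next
    case 4
    then show ?thesis using eqv_Lie[OF eqv_rv_end 0] assms by auto
  next
    case 5
    then show ?thesis using assms by (auto intro!: eqv_Lie[OF eqv_rv_above] Lie_root)
  qed
qed

lemma Lie_cm:
  assumes "\<And>i j. i \<le> j \<Longrightarrow> cm (rv (i, j) m) y \<in> Lie (m + s)" "y \<in> Lf (Suc s)" "x \<in> Lie m"
  shows "cm x y \<in> Lie (m + s)"
  using assms(3)
proof (induction rule: Lie.induct)
  case (Lie_Lf x)
  then show ?case using assms(2) by (intro Lie.Lie_Lf Lf_cm)
next
  case (Lie_rv i j x c)
  have "cm (cc c * rv (i, j) m) y = cc c * cm (rv (i, j) m) y"
    by (simp add: cm_def algebra_simps cc_commute)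
  then show ?case using Lie_rv assms(1) by (simp add: cm_add_left Lie_add Lie_scal)
qed

text \<open>The Jacobi identity peels the last generator off the second root vector. The first root
  stays arbitrary in the induction because the inner bracket is again a combination of root vectors
  modulo lower terms.\<close>

lemma Lie_cm_rv_rv:
  "i' \<le> j' \<Longrightarrow> i \<le> j \<Longrightarrow> cm (rv (i, j) r) (rv (i', j') s) \<in> Lie (r + s)"
proof (induction j' arbitrary: i j r rule: dec_induct)
  case base
  then show ?case by (simp add: Lie_cm_rv_e)
next
  case (step k)
  let ?a = "rv (i, j) r" and ?b = "rv (i', k) s" and ?c = "e (Suc k) 0"
  have "cm ?a (rv (i', Suc k) s) = cm (cm ?a ?b) ?c - cm (cm ?a ?c) ?b"
    using step by (simp add: rv_Suc cm_jacobi_right[of ?a ?b ?c])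
  moreover have "cm (cm ?a ?b) ?c \<in> Lie (r + s + 0)"
    by (rule Lie_cm[OF Lie_cm_rv_e Lf_e]) (use step in auto)
  moreover have "cm (cm ?a ?c) ?b \<in> Lie (r + 0 + s)"
    by (rule Lie_cm[OF step.IH Lf_rv Lie_cm_rv_e]) (use step in auto)
  ultimately show ?case by (simp add: Lie_diff)
qed

end

section \<open>Sorting products of root vectors\<close>

abbreviation pkey :: "(nat \<times> nat) \<times> nat \<Rightarrow> (nat \<times> nat) \<times> int" where
  "pkey p \<equiv> (fst p, - int (snd p))"

definition pvalid :: "((nat \<times> nat) \<times> nat) list \<Rightarrow> bool" where
  "pvalid L \<longleftrightarrow> (\<forall>p\<in>set L. fst (fst p) \<le> snd (fst p))"

text \<open>The negated level in \<open>pkey\<close> makes larger levels come first within one root,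
  as in the order of the theorem. Entries may repeat: a power is written out as equal
  neighbours.\<close>

definition psorted :: "((nat \<times> nat) \<times> nat) list \<Rightarrow> bool" where
  "psorted L \<longleftrightarrow> sorted (map pkey L)"

lemma pvalid_simps [simp]: "pvalid []" "pvalid (p # L) \<longleftrightarrow> fst (fst p) \<le> snd (fst p) \<and> pvalid L"
  "pvalid (K @ L) \<longleftrightarrow> pvalid K \<and> pvalid L"
  by (auto simp: pvalid_def)

context yangian
begin

definition Pl :: "((nat \<times> nat) \<times> nat) list \<Rightarrow> 'a" where
  "Pl L = prod_list (map (\<lambda>p. rv (fst p) (snd p)) L)"

lemma Pl_simps [simp]: "Pl [] = 1" "Pl (p # L) = rv (fst p) (snd p) * Pl L" "Pl (K @ L) = Pl K * Pl L"
  by (simp_all add: Pl_def)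

inductive_set Sp :: "'a set" where
  Sp_zero: "0 \<in> Sp"
| Sp_word: "pvalid L \<Longrightarrow> psorted L \<Longrightarrow> x \<in> Sp \<Longrightarrow> cc c * Pl L + x \<in> Sp"

lemma Sp_add: "x \<in> Sp \<Longrightarrow> y \<in> Sp \<Longrightarrow> x + y \<in> Sp"
  by (induction rule: Sp.induct) (auto simp: add.assoc intro: Sp_word)

lemma Sp_scal: "x \<in> Sp \<Longrightarrow> cc c * x \<in> Sp"
  by (induction rule: Sp.induct)
     (auto simp: distrib_left mult.assoc[symmetric] cc_mult[symmetric] intro: Sp_zero Sp_word)

lemma Lf_Pl: "pvalid L \<Longrightarrow> Pl L \<in> Lf (Suc (dg L))"
proof (induction L)
  case Nil
  show ?case using Lf_ew[of "[]" 1] by (simp add: ew_def)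
next
  case (Cons p L)
  then show ?case using Lf_mult1[OF Lf_rv[of "fst (fst p)" "snd (fst p)" "snd p"]] by auto
qed

text \<open>The commutator of two neighbours is a combination of single root vectors of the same
  total level, which shortens the product by one, plus terms of lower level. The assumptions
  \<open>low\<close> and \<open>short\<close> are the hypotheses of the two nested
  inductions.\<close>

lemma swap_in_Sp:
  assumes low: "Lf m \<subseteq> Sp"
    and short: "\<And>L. pvalid L \<Longrightarrow> dg L \<le> m \<Longrightarrow> length L \<le> l \<Longrightarrow> Pl L \<in> Sp"
    and L: "pvalid (xs @ p # q # ys)" "dg (xs @ p # q # ys) \<le> m" "length (xs @ p # q # ys) = Suc l"
  shows "Pl (xs @ p # q # ys) - Pl (xs @ q # p # ys) \<in> Sp"
proof -
  let ?c = "cm (rv (fst p) (snd p)) (rv (fst q) (snd q))"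
  have "?c \<in> Lie (snd p + snd q)"
    using Lie_cm_rv_rv[of "fst (fst q)" "snd (fst q)" "fst (fst p)" "snd (fst p)"] L(1) by simp
  then have "Pl xs * ?c * Pl ys \<in> Sp"
  proof (induction rule: Lie.induct)
    case (Lie_Lf x)
    have "Pl xs * x \<in> Lf (dg xs + (snd p + snd q))"
      using Lf_mult[OF Lf_Pl Lie_Lf, of xs] L by simp
    then have "Pl xs * x * Pl ys \<in> Lf (dg xs + (snd p + snd q) + dg ys)"
      using Lf_mult[OF _ Lf_Pl, of _ _ ys] L by auto
    then show ?case using Lf_mono[of _ _ m] low L by auto
  next
    case (Lie_rv i j x c)
    have "Pl (xs @ ((i, j), snd p + snd q) # ys) \<in> Sp"
      by (rule short) (use L Lie_rv in auto)
    then have "cc c * Pl (xs @ ((i, j), snd p + snd q) # ys) + Pl xs * x * Pl ys \<in> Sp"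
      using Lie_rv by (intro Sp_add Sp_scal)
    then show ?case by (simp add: distrib_left distrib_right cc_commute mult.assoc)
  qed
  moreover have "Pl (xs @ p # q # ys) - Pl (xs @ q # p # ys) = Pl xs * ?c * Pl ys"
    by (simp add: cm_def algebra_simps)
  ultimately show ?thesis by simp
qed

text \<open>\<open>p\<close> moves right by swaps of neighbours, each at the cost of an element of
  \<open>Sp\<close>; \<open>xs\<close> collects the entries already passed.\<close>

lemma insort_in_Sp:
  assumes low: "Lf m \<subseteq> Sp"
    and short: "\<And>L. pvalid L \<Longrightarrow> dg L \<le> m \<Longrightarrow> length L \<le> l \<Longrightarrow> Pl L \<in> Sp"
  shows "pvalid (xs @ p # ys) \<Longrightarrow> dg (xs @ p # ys) \<le> m \<Longrightarrow> length (xs @ p # ys) = Suc l \<Longrightarrow>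
    Pl (xs @ p # ys) - Pl (xs @ insort_key pkey p ys) \<in> Sp"
proof (induction ys arbitrary: xs)
  case Nil
  show ?case by (simp add: Sp_zero)
next
  case (Cons q ys)
  show ?case
  proof (cases "pkey p \<le> pkey q")
    case True
    then show ?thesis by (simp add: Sp_zero)
  next
    case False
    have "Pl (xs @ p # q # ys) - Pl (xs @ q # p # ys) \<in> Sp"
      by (rule swap_in_Sp[OF low short]) (use Cons in auto)
    moreover have "Pl ((xs @ [q]) @ p # ys) - Pl ((xs @ [q]) @ insort_key pkey p ys) \<in> Sp"
      by (rule Cons.IH) (use Cons.prems in auto)
    ultimately have "(Pl (xs @ p # q # ys) - Pl (xs @ q # p # ys)) +
       (Pl ((xs @ [q]) @ p # ys) - Pl ((xs @ [q]) @ insort_key pkey p ys)) \<in> Sp" by (rule Sp_add)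
    moreover have "insort_key pkey p (q # ys) = q # insort_key pkey p ys"
      using False by (simp only: insort_key.simps if_False)
    ultimately show ?thesis by (simp add: mult.assoc del: insort_key.simps)
  qed
qed

lemma sort_in_Sp:
  assumes low: "Lf m \<subseteq> Sp"
    and short: "\<And>L. pvalid L \<Longrightarrow> dg L \<le> m \<Longrightarrow> length L \<le> l \<Longrightarrow> Pl L \<in> Sp"
  shows "pvalid (xs @ L) \<Longrightarrow> dg (xs @ L) \<le> m \<Longrightarrow> length (xs @ L) = Suc l \<Longrightarrow>
    Pl (xs @ L) - Pl (xs @ sort_key pkey L) \<in> Sp"
proof (induction L arbitrary: xs)
  case Nil
  show ?case by (simp add: Sp_zero)
next
  case (Cons p L)
  have d: "dg (sort_key pkey L) = dg L"
    by (simp add: dg_def flip: sum_mset_sum_list)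
  have "Pl ((xs @ [p]) @ L) - Pl ((xs @ [p]) @ sort_key pkey L) \<in> Sp"
    by (rule Cons.IH) (use Cons.prems in auto)
  moreover have "Pl (xs @ p # sort_key pkey L) - Pl (xs @ insort_key pkey p (sort_key pkey L)) \<in> Sp"
    by (rule insort_in_Sp[OF low short]) (use Cons.prems in \<open>auto simp: d pvalid_def\<close>)
  ultimately have "(Pl ((xs @ [p]) @ L) - Pl ((xs @ [p]) @ sort_key pkey L)) +
    (Pl (xs @ p # sort_key pkey L) - Pl (xs @ insort_key pkey p (sort_key pkey L))) \<in> Sp"
    by (rule Sp_add)
  then show ?case by (simp add: mult.assoc sort_key_def)
qed

text \<open>Inner induction on the length under a fixed bound for the level; the outer induction on
  the level supplies \<open>low\<close>.\<close>

lemma Pl_in_Sp: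
  assumes low: "Lf m \<subseteq> Sp"
  shows "pvalid L \<Longrightarrow> dg L \<le> m \<Longrightarrow> length L \<le> l \<Longrightarrow> Pl L \<in> Sp"
proof (induction l arbitrary: L)
  case 0
  have "Pl [] \<in> Sp" using Sp_word[OF _ _ Sp_zero, of "[]" 1] by (simp add: cc_1 psorted_def)
  then show ?case using 0 by simp
next
  case (Suc l)
  show ?case
  proof (cases "length L = Suc l")
    case True
    have "Pl ([] @ L) - Pl ([] @ sort_key pkey L) \<in> Sp"
      by (rule sort_in_Sp[OF low Suc.IH]) (use Suc.prems True in auto)
    moreover have "cc 1 * Pl (sort_key pkey L) + 0 \<in> Sp"
      using Suc.prems by (intro Sp_word Sp_zero) (auto simp: pvalid_def psorted_def)
    ultimately show ?thesis using Sp_add[of "Pl L - Pl (sort_key pkey L)" "Pl (sort_key pkey L)"]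
      by (simp add: cc_1)
  qed (use Suc in simp)
qed

lemma ew_eq_Pl: "ew w = Pl (map (\<lambda>(i, r). ((i, i), r)) w)"
  by (induction w) (auto simp: ew_def)

lemma Lf_subset_Sp: "Lf m \<subseteq> Sp"
proof (induction m)
  case 0
  show ?case
  proof
    show "x \<in> Sp" if "x \<in> Lf 0" for x
      using that by cases (auto intro: Sp_zero)
  qed
next
  case (Suc m)
  have "ew w \<in> Sp" if "dg w < Suc m" for w
  proof -
    have "dg (map (\<lambda>(i, r). ((i, i), r)) w) = dg w" by (induction w) auto
    then show ?thesis using that unfolding ew_eq_Pl
      by (intro Pl_in_Sp[OF Suc _ _ order_refl]) (auto simp: pvalid_def)
  qed
  note ew = this
  show ?case
  proof
    show "x \<in> Sp" if "x \<in> Lf (Suc m)" for x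
      using that by induction (auto intro: Sp_zero Sp_add Sp_scal ew)
  qed
qed

lemma ew_in_Sp: "ew w \<in> Sp"
  using Lf_ew[of w "Suc (dg w)"] Lf_subset_Sp by auto

end

section \<open>The free algebra and its quotient\<close>

lemma fmul_Nil: "fmul f g [] = f [] * g []"
  by (simp add: fmul_def)

text \<open>The cut lies either before the first letter or after it. This recursion on the word
  replaces index calculations with \<open>take\<close> and \<open>drop\<close>.\<close>

lemma fmul_Cons: "fmul f g (x # w) = f [] * g (x # w) + fmul (\<lambda>u. f (x # u)) g w"
  unfolding fmul_def by (simp only: list.size(4) add_Suc_right add_0_right sum.atMost_Suc_shift) simp

lemma fmul_add_left: "fmul (f + g) h = fmul f h + fmul g h"
  and fmul_add_right: "fmul h (f + g) = fmul h f + fmul h g"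
  and fmul_diff_left: "fmul (f - g) h = fmul f h - fmul g h"
  and fmul_diff_right: "fmul h (f - g) = fmul h f - fmul h g"
  and fmul_zero_left [simp]: "fmul 0 h = 0"
  and fmul_zero_right [simp]: "fmul h 0 = 0"
  and fmul_scal_left: "fmul (scal c f) h = scal c (fmul f h)"
  and fmul_scal_right: "fmul h (scal c f) = scal c (fmul h f)"
  by (auto simp: fmul_def scal_def fun_eq_iff algebra_simps sum.distrib sum_subtractf sum_negf
      sum_distrib_left intro!: sum.cong)

lemma fmul_assoc: "fmul (fmul f g) h = fmul f (fmul g h)"
proof
  fix w
  show "fmul (fmul f g) h w = fmul f (fmul g h) w"
  proof (induction w arbitrary: f)
    case (Cons x w)
    have "(\<lambda>u. fmul f g (x # u)) = scal (f []) (\<lambda>u. g (x # u)) + fmul (\<lambda>u. f (x # u)) g"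
      by (auto simp: fun_eq_iff fmul_Cons scal_def)
    then show ?case
      by (simp add: fmul_Cons[of "fmul f g"] fmul_Cons[of f "fmul g h"] fmul_Cons[of g h] fmul_add_left
          fmul_scal_left fmul_Nil Cons) (simp add: scal_def algebra_simps)
  qed (simp add: fmul_Nil)
qed

lemma comm_zero [simp]: "comm 0 f = 0" "comm f 0 = 0"
  by (simp_all add: comm_def)

definition wd :: "(nat \<times> nat) list \<Rightarrow> falg" where
  "wd u = (\<lambda>w. if w = u then 1 else 0)"

lemma gen_eq_wd: "gen x = wd [x]" and fone_eq_wd: "fone = wd []"
  by (auto simp: gen_def fone_def wd_def)

lemma fmul_wd: "fmul (wd u) (wd v) = wd (u @ v)"
proof
  show "fmul (wd u) (wd v) w = wd (u @ v) w" for w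
  proof (induction u arbitrary: w)
    case Nil
    show ?case
    proof (cases w)
      case (Cons y w')
      have "(\<lambda>u. wd [] (y # u)) = (0::falg)" by (auto simp: wd_def)
      then show ?thesis using Cons by (simp add: fmul_Cons) (simp add: wd_def)
    qed (simp add: fmul_Nil wd_def)
  next
    case (Cons x u)
    show ?case
    proof (cases w)
      case (Cons y w')
      have "(\<lambda>w. wd (x # u) (y # w)) = (if x = y then wd u else 0)" by (auto simp: wd_def)
      then show ?thesis using Cons.IH[of w'] Cons by (simp add: fmul_Cons) (auto simp: wd_def)
    qed (simp add: fmul_Nil wd_def)
  qed
qed

lemma fmul_one_left [simp]: "fmul fone f = f"
proof
  show "fmul fone f w = f w" for w
  proof (cases w)
    case (Cons y w')
    have "(\<lambda>u. fone (y # u)) = (0::falg)" by (auto simp: fone_def)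
    then show ?thesis using Cons by (simp add: fmul_Cons) (simp add: fone_def)
  qed (simp add: fmul_Nil fone_def)
qed

lemma fmul_one_right [simp]: "fmul f fone = f"
proof
  show "fmul f fone w = f w" for w
    by (induction w arbitrary: f) (simp_all add: fmul_Nil fmul_Cons, simp_all add: fone_def)
qed

lemma scal_simps: "scal c (f + g) = scal c f + scal c g" "scal (c + d) f = scal c f + scal d f"
  "scal c (scal d f) = scal (c * d) f" "scal 1 f = f" "scal 0 f = 0" "scal c 0 = 0"
  "scal (- 1) f = - f"
  by (auto simp: scal_def fun_eq_iff algebra_simps)

lemma scal_eq_fmul: "scal c f = fmul (scal c fone) f"
  by (simp add: fmul_scal_left)

definition Fin :: "falg set" where
  "Fin = {f. finite {w. f w \<noteq> 0}}"

lemma Fin_zero [simp]: "0 \<in> Fin"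
  by (simp add: Fin_def)

lemma Fin_wd [simp]: "wd u \<in> Fin"
proof -
  have "{w. wd u w \<noteq> 0} \<subseteq> {u}" by (auto simp: wd_def)
  then show ?thesis unfolding Fin_def by (auto intro: finite_subset)
qed

lemma Fin_gen [simp]: "gen x \<in> Fin" and Fin_fone [simp]: "fone \<in> Fin"
  by (simp_all add: gen_eq_wd fone_eq_wd)

lemma Fin_add [simp]: "f \<in> Fin \<Longrightarrow> g \<in> Fin \<Longrightarrow> f + g \<in> Fin"
  unfolding Fin_def by (auto intro: finite_subset[of _ "{w. f w \<noteq> 0} \<union> {w. g w \<noteq> 0}"])

lemma Fin_scal [simp]: "f \<in> Fin \<Longrightarrow> scal c f \<in> Fin"
  unfolding Fin_def scal_def by (auto intro: finite_subset[of _ "{w. f w \<noteq> 0}"])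

lemma Fin_minus [simp]: "f \<in> Fin \<Longrightarrow> - f \<in> Fin"
  using Fin_scal[of f "- 1"] by (simp add: scal_simps)

lemma Fin_diff [simp]: "f \<in> Fin \<Longrightarrow> g \<in> Fin \<Longrightarrow> f - g \<in> Fin"
  using Fin_add[of f "- g"] by simp

lemma Fin_fmul [simp]: "f \<in> Fin \<Longrightarrow> g \<in> Fin \<Longrightarrow> fmul f g \<in> Fin"
proof -
  assume fg: "f \<in> Fin" "g \<in> Fin"
  have "{w. fmul f g w \<noteq> 0} \<subseteq> (\<lambda>(u, v). u @ v) ` ({w. f w \<noteq> 0} \<times> {w. g w \<noteq> 0})"
  proof
    fix w assume "w \<in> {w. fmul f g w \<noteq> 0}"
    then obtain k where "f (take k w) * g (drop k w) \<noteq> 0"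
      unfolding fmul_def by (metis (mono_tags, lifting) mem_Collect_eq sum.neutral)
    then show "w \<in> (\<lambda>(u, v). u @ v) ` ({w. f w \<noteq> 0} \<times> {w. g w \<noteq> 0})"
      by (auto intro!: image_eqI[of _ _ "(take k w, drop k w)"])
  qed
  then show ?thesis using fg unfolding Fin_def by (auto intro: finite_subset)
qed

lemma Fin_comm [simp]: "f \<in> Fin \<Longrightarrow> g \<in> Fin \<Longrightarrow> comm f g \<in> Fin"
  by (simp add: comm_def)

lemma Fin_sum [simp]: "(\<And>a. a \<in> A \<Longrightarrow> f a \<in> Fin) \<Longrightarrow> sum f A \<in> Fin"
  by (induction A rule: infinite_finite_induct) auto

lemma Fin_induct [consumes 1, case_names zero word]:
  assumes "f \<in> Fin" and "P 0"
    and word: "\<And>c w f. f \<in> Fin \<Longrightarrow> P f \<Longrightarrow> P (scal c (wd w) + f)"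
  shows "P f"
proof -
  have "finite {w. f w \<noteq> 0}" using assms(1) by (simp add: Fin_def)
  then show ?thesis
  proof (induction "{w. f w \<noteq> 0}" arbitrary: f rule: finite_induct)
    case empty
    then have "f = 0" by (auto simp: fun_eq_iff)
    show "P f" unfolding \<open>f = 0\<close> by (rule assms(2))
  next
    case (insert u F)
    let ?g = "f - scal (f u) (wd u)"
    have F: "F = {w. ?g w \<noteq> 0}"
      using insert.hyps(2,4) by (auto simp: wd_def scal_def split: if_splits)
    then have "?g \<in> Fin" using insert.hyps(1) by (simp add: Fin_def)
    then have "P (scal (f u) (wd u) + ?g)" using insert.hyps(3)[OF F] by (intro word)
    then show ?case by simp
  qed
qed

lemma fpow_0 [simp]: "fpow f 0 = fone" and fpow_Suc: "fpow f (Suc t) = fmul f (fpow f t)"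
  by (simp_all add: fpow_def)

lemma Fin_fpow [simp]: "f \<in> Fin \<Longrightarrow> fpow f t \<in> Fin"
  by (induction t) (simp_all add: fpow_Suc)

text \<open>The algebra homomorphism setting generators of foreign colours to 0; it is
  multiplicative since a word uses only colours in \<open>Iset n\<close> iff both pieces of every
  cut do.\<close>

definition res :: "nat \<Rightarrow> falg \<Rightarrow> falg" where
  "res n f = (\<lambda>w. if fst ` set w \<subseteq> Iset n then f w else 0)"

lemma res_add: "res n (f + g) = res n f + res n g"
  and res_diff: "res n (f - g) = res n f - res n g"
  and res_scal: "res n (scal c f) = scal c (res n f)"
  and res_zero [simp]: "res n 0 = 0"
  and res_fone [simp]: "res n fone = fone"
  by (auto simp: res_def scal_def fone_def fun_eq_iff)

lemma res_wd: "res n (wd w) = (if fst ` set w \<subseteq> Iset n then wd w else 0)"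
  by (auto simp: res_def wd_def fun_eq_iff)

lemma res_fmul: "res n (fmul f g) = fmul (res n f) (res n g)"
proof
  fix w
  have "(if fst ` set (take k w) \<subseteq> Iset n then f (take k w) else 0) *
      (if fst ` set (drop k w) \<subseteq> Iset n then g (drop k w) else 0) =
      (if fst ` set w \<subseteq> Iset n then f (take k w) * g (drop k w) else 0)" for k
  proof -
    have "set w = set (take k w) \<union> set (drop k w)" by (metis append_take_drop_id set_append)
    then show ?thesis by (simp add: image_Un)
  qed
  then show "res n (fmul f g) w = fmul (res n f) (res n g) w"
    by (simp add: res_def fmul_def)
qed

lemma res_sum: "res n (sum f A) = (\<Sum>a\<in>A. res n (f a))"
  by (induction A rule: infinite_finite_induct)
     (simp_all only: sum.infinite sum.empty sum.insert res_add res_zero not_False_eq_True)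

lemma res_fpow: "res n (fpow f t) = fpow (res n f) t"
  by (induction t) (simp_all add: fpow_Suc res_fmul)

lemma res_comm: "res n (comm f g) = comm (res n f) (res n g)"
  by (simp add: comm_def res_diff res_fmul)

lemma fin_alg_iff: "f \<in> fin_alg n \<longleftrightarrow> f \<in> Fin \<and> res n f = f"
  unfolding fin_alg_def Fin_def res_def by (auto simp: fun_eq_iff)

lemma res_idem [simp]: "res n (res n f) = res n f"
  by (auto simp: res_def)

lemma res_in_fin_alg: "f \<in> Fin \<Longrightarrow> res n f \<in> fin_alg n"
  unfolding fin_alg_iff by (auto simp: Fin_def res_def intro: finite_subset[of _ "{w. f w \<noteq> 0}"])

lemma fin_alg_fmul: "f \<in> fin_alg n \<Longrightarrow> g \<in> fin_alg n \<Longrightarrow> fmul f g \<in> fin_alg n"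
  by (simp add: fin_alg_iff res_fmul)

lemma fin_alg_scal_fone: "scal c fone \<in> fin_alg n"
  by (simp add: fin_alg_iff res_scal)

lemma Jid_fmul_left: "x \<in> Jid n \<Longrightarrow> a \<in> fin_alg n \<Longrightarrow> fmul a x \<in> Jid n"
  by (induction rule: Jid.induct)
     (auto simp: fmul_add_right fmul_assoc[symmetric] intro: Jid_zero Jid_gen Jid_add fin_alg_fmul)

lemma Jid_fmul_right: "x \<in> Jid n \<Longrightarrow> a \<in> fin_alg n \<Longrightarrow> fmul x a \<in> Jid n"
proof (induction rule: Jid.induct)
  case (Jid_gen \<rho> u v)
  then show ?case by (simp add: fmul_assoc[of _ v] Jid.Jid_gen fin_alg_fmul)
qed (auto simp: fmul_add_left intro: Jid_zero Jid_add)

lemma Jid_scal: "x \<in> Jid n \<Longrightarrow> scal c x \<in> Jid n"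
  by (subst scal_eq_fmul) (intro Jid_fmul_left fin_alg_scal_fone)

lemma Jid_rel: "\<rho> \<in> rels n \<Longrightarrow> \<rho> \<in> Jid n"
  using Jid_gen[of \<rho> n fone fone] fin_alg_scal_fone[of 1 n] by (simp add: scal_simps)

text \<open>Relators have no constant term. This is what keeps 0 and 1 apart in the quotient
  ring.\<close>

lemma Jid_Nil: "x \<in> Jid n \<Longrightarrow> x [] = 0"
proof (induction rule: Jid.induct)
  case (Jid_gen \<rho> a b)
  then have "\<rho> [] = 0"
    by (auto simp: rels_def comm_def fmul_Nil gen_def scal_def)
  then show ?case by (simp add: fmul_Nil)
qed auto

text \<open>Quotienting by all the ideals \<open>Jid n\<close> at once, each seen through the projection killing the
  generators outside \<open>Iset n\<close>, gives a single ring type in which the relations hold for all colours.\<close>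

definition yeq :: "falg \<Rightarrow> falg \<Rightarrow> bool" where
  "yeq f g \<longleftrightarrow> f \<in> Fin \<and> g \<in> Fin \<and> (\<forall>n. res n (f - g) \<in> Jid n)"

lemma yeq_refl [simp]: "yeq f f \<longleftrightarrow> f \<in> Fin"
  by (simp add: yeq_def Jid_zero)

lemma yeq_sym: "yeq f g \<Longrightarrow> yeq g f"
proof -
  have *: "g - f = scal (- 1) (f - g)" by (simp add: scal_simps)
  show "yeq f g \<Longrightarrow> ?thesis" unfolding yeq_def * res_scal by (auto intro: Jid_scal)
qed

lemma yeq_trans: "yeq f g \<Longrightarrow> yeq g h \<Longrightarrow> yeq f h"
proof -
  have *: "f - h = (f - g) + (g - h)" by simp
  show "yeq f g \<Longrightarrow> yeq g h \<Longrightarrow> ?thesis" unfolding yeq_def * res_add by (auto intro: Jid_add)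
qed

lemma yeq_add: "yeq f f' \<Longrightarrow> yeq g g' \<Longrightarrow> yeq (f + g) (f' + g')"
proof -
  have *: "f + g - (f' + g') = (f - f') + (g - g')" by simp
  show "yeq f f' \<Longrightarrow> yeq g g' \<Longrightarrow> ?thesis" unfolding yeq_def * res_add by (auto intro: Jid_add)
qed

lemma yeq_minus: "yeq f f' \<Longrightarrow> yeq (- f) (- f')"
proof -
  have *: "- f - - f' = scal (- 1) (f - f')" by (simp add: scal_simps)
  show "yeq f f' \<Longrightarrow> ?thesis" unfolding yeq_def * res_scal by (auto intro: Jid_scal)
qed

lemma yeq_fmul: "yeq f f' \<Longrightarrow> yeq g g' \<Longrightarrow> yeq (fmul f g) (fmul f' g')"
proof -
  have *: "fmul f g - fmul f' g' = fmul (f - f') g + fmul f' (g - g')"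
    by (simp add: fmul_diff_left fmul_diff_right)
  show "yeq f f' \<Longrightarrow> yeq g g' \<Longrightarrow> ?thesis" unfolding yeq_def * res_add res_fmul
    by (auto intro: Jid_add Jid_fmul_left Jid_fmul_right res_in_fin_alg)
qed

quotient_type yang = falg / partial: yeq
proof (rule part_equivpI)
  show "\<exists>x. yeq x x" by (rule exI[of _ 0]) simp
  show "symp yeq" by (auto intro: sympI yeq_sym)
  show "transp yeq" by (auto intro: transpI yeq_trans)
qed

instantiation yang :: ring_1
begin

lift_definition zero_yang :: yang is "0 :: falg" by simp
lift_definition one_yang :: yang is fone by simp
lift_definition plus_yang :: "yang \<Rightarrow> yang \<Rightarrow> yang" is "(+) :: falg \<Rightarrow> _" by (rule yeq_add)
lift_definition uminus_yang :: "yang \<Rightarrow> yang" is "uminus :: falg \<Rightarrow> _" by (rule yeq_minus)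
lift_definition minus_yang :: "yang \<Rightarrow> yang \<Rightarrow> yang" is "(-) :: falg \<Rightarrow> _"
  by (simp only: diff_conv_add_uminus yeq_add yeq_minus)
lift_definition times_yang :: "yang \<Rightarrow> yang \<Rightarrow> yang" is fmul by (rule yeq_fmul)

instance
proof
  fix a b c :: yang
  show "a * b * c = a * (b * c)" by transfer (simp add: fmul_assoc)
  show "1 * a = a" by transfer simp
  show "a * 1 = a" by transfer simp
  show "a + b + c = a + (b + c)" by transfer (simp add: add.assoc)
  show "a + b = b + a" by transfer (simp add: add.commute)
  show "0 + a = a" by transfer simp
  show "- a + a = 0" by transfer simp
  show "a - b = a + - b" by transfer simp
  show "(a + b) * c = a * c + b * c" by transfer (simp add: fmul_add_left)
  show "a * (b + c) = a * b + a * c" by transfer (simp add: fmul_add_right)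
  show "(0::yang) \<noteq> 1"
  proof (transfer, rule notI)
    assume "yeq 0 fone"
    then have "res 0 (0 - fone) \<in> Jid 0" by (simp add: yeq_def)
    then have "res 0 (0 - fone) [] = 0" by (rule Jid_Nil)
    then show False by (simp add: res_def fone_def)
  qed
qed

end

section \<open>The quotient ring as a model of the abstract relations\<close>

definition cls :: "falg \<Rightarrow> yang" where "cls f = abs_yang f"

lemma cls_eq_iff: "f \<in> Fin \<Longrightarrow> g \<in> Fin \<Longrightarrow> cls f = cls g \<longleftrightarrow> (\<forall>n. res n (f - g) \<in> Jid n)"
  using Quotient_rel[OF Quotient_yang, of f g] by (simp add: cls_def yeq_def[of f g])

lemma cls_add: "f \<in> Fin \<Longrightarrow> g \<in> Fin \<Longrightarrow> cls (f + g) = cls f + cls g"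
  and cls_diff: "f \<in> Fin \<Longrightarrow> g \<in> Fin \<Longrightarrow> cls (f - g) = cls f - cls g"
  and cls_fmul: "f \<in> Fin \<Longrightarrow> g \<in> Fin \<Longrightarrow> cls (fmul f g) = cls f * cls g"
  and cls_fone: "cls fone = 1"
  and cls_zero: "cls 0 = 0"
  by (simp_all add: cls_def plus_yang.abs_eq minus_yang.abs_eq times_yang.abs_eq one_yang.abs_eq
      zero_yang.abs_eq)

lemma cls_scal: "f \<in> Fin \<Longrightarrow> cls (scal c f) = cls (scal c fone) * cls f"
  by (subst scal_eq_fmul) (simp add: cls_fmul)

lemma cls_comm: "f \<in> Fin \<Longrightarrow> g \<in> Fin \<Longrightarrow> cls (comm f g) = cm (cls f) (cls g)"
  by (simp add: comm_def cm_def cls_diff cls_fmul)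

lemma cls_0I: "f \<in> Fin \<Longrightarrow> (\<And>n. res n f \<in> Jid n) \<Longrightarrow> cls f = 0"
  unfolding cls_zero[symmetric] by (simp add: cls_eq_iff)

lemma res_gen: "res n (gen (i, r)) = (if i \<in> Iset n then gen (i, r) else 0)"
  by (simp add: gen_eq_wd res_wd)

text \<open>For each \<open>n\<close>, a relator either has all its colours in \<open>Iset n\<close>
  and belongs to \<open>rels n\<close>, or is sent to 0 by \<open>res n\<close>; so its class is 0
  in either case.\<close>

global_interpretation Y: yangian "\<lambda>c. cls (scal c fone)" "\<lambda>i r. cls (gen (i, r))"
  defines Yrv = Y.rv and YPl = Y.Pl and YDv = Y.Dv and YZalg = Y.Zalg and YSp = Y.Sp and Yew = Y.ew
proof
  fix a b :: complex and x :: yang and i j r s r1 r2 :: nat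
  show "cls (scal (a + b) fone) = cls (scal a fone) + cls (scal b fone)"
    by (simp add: scal_simps cls_add)
  show "cls (scal (a * b) fone) = cls (scal a fone) * cls (scal b fone)"
    by (simp add: cls_fmul[symmetric] fmul_scal_left scal_simps)
  show "cls (scal 1 fone) = 1" by (simp add: scal_simps cls_fone)
  show "cls (scal a fone) * x = x * cls (scal a fone)"
    unfolding cls_def by (induction x rule: yang.abs_induct)
      (simp add: times_yang.abs_eq fmul_scal_left fmul_scal_right)
  let ?e = "\<lambda>i r. gen (i, r)"
  let ?q = "comm (?e i (Suc r)) (?e j s) - comm (?e i r) (?e j (Suc s))
       - scal (cartan i j / 2) (fmul (?e i r) (?e j s) + fmul (?e j s) (?e i r))"
  have "cls ?q = 0"
  proof (rule cls_0I)
    fix n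
    show "res n ?q \<in> Jid n"
    proof (cases "i \<in> Iset n \<and> j \<in> Iset n")
      case True
      have "?q \<in> rels n" unfolding rels_def using True by blast
      then have "?q \<in> Jid n" by (rule Jid_rel)
      moreover have "res n ?q = ?q" using True
        by (simp add: res_diff res_comm res_scal res_add res_fmul res_gen)
      ultimately show ?thesis by simp
    next
      case False
      then have "res n ?q = 0"
        by (auto simp: res_diff res_comm res_scal res_add res_fmul res_gen scal_simps)
      then show ?thesis by (simp add: Jid_zero)
    qed
  qed simp
  then show "cm (cls (?e i (Suc r))) (cls (?e j s)) - cm (cls (?e i r)) (cls (?e j (Suc s))) =
      cls (scal (cartan i j / 2) fone) *
      (cls (?e i r) * cls (?e j s) + cls (?e j s) * cls (?e i r))"
    by (simp add: cls_diff cls_comm cls_add cls_fmul cls_scal[of "fmul _ _ + fmul _ _"])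
  show "cm (cls (?e i r)) (cls (?e j s)) = 0" if "cartan i j = 0"
  proof -
    have "cls (comm (?e i r) (?e j s)) = 0"
    proof (rule cls_0I)
      fix n
      show "res n (comm (?e i r) (?e j s)) \<in> Jid n"
      proof (cases "i \<in> Iset n \<and> j \<in> Iset n")
        case True
        have "comm (?e i r) (?e j s) \<in> rels n" unfolding rels_def using True that by blast
        then show ?thesis using True by (simp add: res_comm res_gen Jid_rel)
      next
        case False
        then show ?thesis by (auto simp: res_comm res_gen Jid_zero)
      qed
    qed simp
    then show ?thesis by (simp add: cls_comm)
  qed
  show "cm (cls (?e i r1)) (cm (cls (?e i r2)) (cls (?e j s))) +
      cm (cls (?e i r2)) (cm (cls (?e i r1)) (cls (?e j s))) = 0" if "cartan i j = - 1"
  proof -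
    let ?s = "comm (?e i r1) (comm (?e i r2) (?e j s)) + comm (?e i r2) (comm (?e i r1) (?e j s))"
    have "cls ?s = 0"
    proof (rule cls_0I)
      fix n
      show "res n ?s \<in> Jid n"
      proof (cases "i \<in> Iset n \<and> j \<in> Iset n")
        case True
        have "?s \<in> rels n" unfolding rels_def using True that by blast
        then show ?thesis using True by (simp add: res_add res_comm res_gen Jid_rel)
      next
        case False
        then show ?thesis by (auto simp: res_add res_comm res_gen Jid_zero)
      qed
    qed simp
    then show ?thesis by (simp add: cls_comm cls_add)
  qed
qed

lemma Fin_root_vec [simp]: "root_vec b r \<in> Fin"
proof (cases b)
  case (Pair i j)
  have "foldl (\<lambda>x k. comm x (gen (k, 0))) f ks \<in> Fin" if "f \<in> Fin" for f ks
    using that by (induction ks arbitrary: f) auto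
  then show ?thesis using Pair by simp
qed

lemma cls_root_vec: "cls (root_vec b r) = Yrv b r"
proof (cases b)
  case (Pair i j)
  have "cls (foldl (\<lambda>x k. comm x (gen (k, 0))) f ks) = foldl (\<lambda>x k. cm x (cls (gen (k, 0)))) (cls f) ks"
    if "f \<in> Fin" for f ks
    using that by (induction ks arbitrary: f) (auto simp: cls_comm)
  then show ?thesis using Pair by (simp add: Y.rv.simps del: upt_Suc)
qed

section \<open>The shuffle realization\<close>

text \<open>Goals produced by induction over \<open>falg\<close> contain \<open>\<eta>\<close>-expanded sums, which these rules would
  evaluate pointwise.\<close>

declare plus_fun_apply [simp del] zero_fun_apply [simp del]

type_synonym pt = "nat \<times> complex fls"

text \<open>For equal second components the quotient is 0 by convention and the kernel identities
  fail to make sense; evaluation therefore uses sets with \<open>inj_on snd\<close>.\<close>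

definition zt :: "pt \<Rightarrow> pt \<Rightarrow> complex fls" where
  "zt p q = 1 + fls_const (cartan (fst p) (fst q) / 2) / (snd p - snd q)"

definition Zt :: "pt set \<Rightarrow> pt set \<Rightarrow> complex fls" where
  "Zt A B = (\<Prod>p\<in>A. \<Prod>q\<in>B. zt p q)"

text \<open>Unfolded, this is a sum over all orderings of the points: the letters are matched with
  the points in turn, and each earlier point \<open>p\<close> and later point \<open>q\<close>
  contribute \<open>zt p q\<close>. Evaluating at sets makes symmetry within a colour
  automatic.\<close>

fun psi :: "(nat \<times> nat) list \<Rightarrow> pt set \<Rightarrow> complex fls" where
  "psi [] X = (if X = {} then 1 else 0)"
| "psi (a # w) X = (\<Sum>p\<in>X. (if fst p = fst a then snd p ^ snd a else 0) *
      (\<Prod>q\<in>X - {p}. zt p q) * psi w (X - {p}))"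

lemma Zt_insert_left: "finite A \<Longrightarrow> p \<notin> A \<Longrightarrow> Zt (insert p A) B = (\<Prod>q\<in>B. zt p q) * Zt A B"
  by (simp add: Zt_def)

lemma Zt_empty_left [simp]: "Zt {} B = 1"
  by (simp add: Zt_def)

text \<open>\<open>A\<close> is the set of points matched with the letters of \<open>u\<close>; all
  of them precede the points of \<open>X - A\<close>, which explains the factor
  \<open>Zt A (X - A)\<close>.\<close>

lemma psi_append:
  "finite X \<Longrightarrow> psi (u @ v) X = (\<Sum>A\<in>Pow X. psi u A * psi v (X - A) * Zt A (X - A))"
proof (induction u arbitrary: X)
  case Nil
  have "(\<Sum>A\<in>Pow X. psi [] A * psi v (X - A) * Zt A (X - A)) =
      (\<Sum>A\<in>Pow X. if A = {} then psi v X else 0)"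
    by (intro sum.cong) auto
  also have "\<dots> = psi v X" using Nil by (subst sum.delta) auto
  finally show ?case by simp
next
  case (Cons a u)
  let ?m = "\<lambda>p. if fst p = fst a then snd p ^ snd a else 0"
  have fin: "finite A" if "A \<subseteq> X" for A using that Cons.prems finite_subset by blast
  have "psi ((a # u) @ v) X = (\<Sum>p\<in>X. \<Sum>A\<in>Pow (X - {p}). ?m p * (\<Prod>q\<in>X - {p}. zt p q) *
      (psi u A * psi v (X - {p} - A) * Zt A (X - {p} - A)))"
    using Cons by (simp add: sum_distrib_left)
  also have "\<dots> = (\<Sum>(p, A)\<in>(SIGMA p:X. Pow (X - {p})). ?m p * (\<Prod>q\<in>X - {p}. zt p q) *
      (psi u A * psi v (X - {p} - A) * Zt A (X - {p} - A)))"
    using Cons.prems by (intro sum.Sigma) auto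
  \<comment> \<open>Choosing first the point \<open>p\<close> and then the rest of the points for
    \<open>u\<close> is the same as choosing all points for \<open>u\<close> and marking one of
    them.\<close>
  also have "\<dots> = (\<Sum>(A, p)\<in>(SIGMA A:Pow X. A). ?m p * (\<Prod>q\<in>A - {p}. zt p q) *
      psi u (A - {p}) * psi v (X - A) * Zt A (X - A))"
  proof (rule sum.reindex_bij_witness[where i = "\<lambda>(A, p). (p, A - {p})" and j = "\<lambda>(p, A). (insert p A, p)"],
      goal_cases)
    case (5 a)
    then obtain p A where a: "a = (p, A)" and A: "p \<in> X" "A \<subseteq> X - {p}" by auto
    let ?B = "X - insert p A"
    have B: "X - {p} - A = ?B" and A': "insert p A - {p} = A" using A by auto
    have fA: "finite A" using A fin by blast
    have "X - {p} = A \<union> ?B" using A by auto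
    then have "(\<Prod>q\<in>X - {p}. zt p q) = (\<Prod>q\<in>A \<union> ?B. zt p q)" by simp
    also have "\<dots> = (\<Prod>q\<in>A. zt p q) * (\<Prod>q\<in>?B. zt p q)"
      using Cons.prems fA by (intro prod.union_disjoint) auto
    finally have "(\<Prod>q\<in>X - {p}. zt p q) = (\<Prod>q\<in>A. zt p q) * (\<Prod>q\<in>?B. zt p q)" .
    moreover have "Zt (insert p A) ?B = (\<Prod>q\<in>?B. zt p q) * Zt A ?B"
      using A fA by (intro Zt_insert_left) auto
    ultimately show ?case
      unfolding a prod.case B A' by (simp add: mult_ac)
  qed auto
  also have "\<dots> = (\<Sum>A\<in>Pow X. \<Sum>p\<in>A. ?m p * (\<Prod>q\<in>A - {p}. zt p q) *
      psi u (A - {p}) * psi v (X - A) * Zt A (X - A))"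
    using Cons.prems fin by (intro sum.Sigma[symmetric]) auto
  finally show ?case by (simp add: sum_distrib_right)
qed

definition Psi :: "falg \<Rightarrow> pt set \<Rightarrow> complex fls" where
  "Psi f X = (\<Sum>w | f w \<noteq> 0. fls_const (f w) * psi w X)"

lemma Psi_superset:
  "finite T \<Longrightarrow> {w. f w \<noteq> 0} \<subseteq> T \<Longrightarrow> Psi f X = (\<Sum>w\<in>T. fls_const (f w) * psi w X)"
  unfolding Psi_def by (rule sum.mono_neutral_left) auto

lemma Psi_zero [simp]: "Psi 0 X = 0"
  by (simp add: Psi_def zero_fun_apply)

lemma Psi_add:
  assumes "f \<in> Fin" "g \<in> Fin"
  shows "Psi (f + g) X = Psi f X + Psi g X"
proof -
  let ?T = "{w. f w \<noteq> 0} \<union> {w. g w \<noteq> 0}"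
  have T: "finite ?T" using assms by (simp add: Fin_def)
  have "Psi f X = (\<Sum>w\<in>?T. fls_const (f w) * psi w X)" using T by (rule Psi_superset) auto
  moreover have "Psi g X = (\<Sum>w\<in>?T. fls_const (g w) * psi w X)" using T by (rule Psi_superset) auto
  moreover have "Psi (f + g) X = (\<Sum>w\<in>?T. fls_const ((f + g) w) * psi w X)"
    using T by (rule Psi_superset) (auto simp: plus_fun_apply)
  ultimately show ?thesis by (simp add: plus_fun_apply sum.distrib[symmetric] distrib_right flip: fls_plus_const)
qed

lemma Psi_scal: "Psi (scal c f) X = fls_const c * Psi f X"
proof (cases "c = 0")
  case False
  then have "{w. scal c f w \<noteq> 0} = {w. f w \<noteq> 0}" by (auto simp: scal_def)
  then show ?thesis
    by (simp add: Psi_def sum_distrib_left scal_def mult.assoc flip: fls_const_mult_const)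
qed (simp add: scal_simps)

lemma Psi_diff: "f \<in> Fin \<Longrightarrow> g \<in> Fin \<Longrightarrow> Psi (f - g) X = Psi f X - Psi g X"
  using Psi_add[of f "scal (- 1) g" X] Psi_scal[of "- 1" g X] by (simp add: scal_simps)

lemma Psi_sum: "(\<And>a. a \<in> A \<Longrightarrow> f a \<in> Fin) \<Longrightarrow> Psi (sum f A) X = (\<Sum>a\<in>A. Psi (f a) X)"
  by (induction A rule: infinite_finite_induct) (simp_all add: Psi_add)

lemma Psi_wd: "Psi (wd w) X = psi w X"
proof -
  have "{u. wd w u \<noteq> 0} = {w}" by (auto simp: wd_def)
  then show ?thesis by (simp add: Psi_def wd_def)
qed

lemma Psi_fmul:
  assumes "f \<in> Fin" "g \<in> Fin" "finite X"
  shows "Psi (fmul f g) X = (\<Sum>A\<in>Pow X. Psi f A * Psi g (X - A) * Zt A (X - A))"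
  using assms(1)
proof (induction rule: Fin_induct)
  case (word c u f)
  have "Psi (fmul (wd u) g) X = (\<Sum>A\<in>Pow X. psi u A * Psi g (X - A) * Zt A (X - A))"
    using assms(2)
  proof (induction rule: Fin_induct)
    case (word d v g)
    then show ?case
      by (simp add: fmul_add_right fmul_scal_right fmul_wd Psi_add Psi_scal Psi_wd psi_append assms(3)
          sum_distrib_left distrib_left distrib_right sum.distrib mult_ac)
  qed simp
  then show ?case using word assms(2)
    by (simp add: fmul_add_left fmul_scal_left Psi_add Psi_scal Psi_wd
          sum_distrib_left distrib_left distrib_right sum.distrib mult_ac)
qed simp

lemma Psi_gen_fmul:
  assumes "f \<in> Fin"
  shows "Psi (fmul (gen a) f) X = (\<Sum>p\<in>X. (if fst p = fst a then snd p ^ snd a else 0) *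
      (\<Prod>q\<in>X - {p}. zt p q) * Psi f (X - {p}))"
  using assms
proof (induction rule: Fin_induct)
  case (word c w f)
  let ?g = "\<lambda>p. (if fst p = fst a then snd p ^ snd a else 0) * (\<Prod>q\<in>X - {p}. zt p q)"
  have "Psi (fmul (gen a) (scal c (wd w) + f)) X = fls_const c * psi (a # w) X + Psi (fmul (gen a) f) X"
    using word.hyps
    by (simp add: fmul_add_right fmul_scal_right Psi_add Psi_scal gen_eq_wd fmul_wd Psi_wd del: psi.simps)
  also have "\<dots> = (\<Sum>p\<in>X. fls_const c * (?g p * psi w (X - {p})) + ?g p * Psi f (X - {p}))"
    unfolding word.IH by (simp only: psi.simps sum_distrib_left sum.distrib)
  also have "\<dots> = (\<Sum>p\<in>X. ?g p * Psi (scal c (wd w) + f) (X - {p}))"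
    using word.hyps by (intro sum.cong refl) (simp add: Psi_add Psi_scal Psi_wd distrib_left mult.left_commute)
  finally show ?case .
qed simp

lemma psi_card: "finite X \<Longrightarrow> psi w X \<noteq> 0 \<Longrightarrow> card X = length w"
proof (induction w arbitrary: X)
  case Nil
  then show ?case by (simp split: if_splits)
next
  case (Cons a w)
  from Cons.prems(2) obtain p where p: "p \<in> X" and "(if fst p = fst a then snd p ^ snd a else 0) *
      (\<Prod>q\<in>X - {p}. zt p q) * psi w (X - {p}) \<noteq> 0"
    unfolding psi.simps by (rule sum.not_neutral_contains_not_neutral)
  then have "psi w (X - {p}) \<noteq> 0" by (metis mult_zero_right)
  then have "card (X - {p}) = length w" using Cons.prems(1) by (intro Cons.IH) auto
  then show ?case using card.remove[OF Cons.prems(1) p] by simp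
qed

abbreviation mon :: "nat \<times> nat \<Rightarrow> pt \<Rightarrow> complex fls" where
  "mon a p \<equiv> (if fst p = fst a then snd p ^ snd a else 0)"

lemma psi_pair:
  "p \<noteq> q \<Longrightarrow> psi [a, b] {p, q} = mon a p * mon b q * zt p q + mon a q * mon b p * zt q p"
  by (simp add: insert_Diff_if)

lemma psi_triple:
  assumes "p \<noteq> q" "p \<noteq> s" "q \<noteq> s"
  shows "psi [a, b, c] {p, q, s} =
     mon a p * mon b q * mon c s * (zt p q * zt p s * zt q s) +
     mon a p * mon b s * mon c q * (zt p q * zt p s * zt s q) +
     mon a q * mon b p * mon c s * (zt q p * zt q s * zt p s) +
     mon a q * mon b s * mon c p * (zt q p * zt q s * zt s p) +
     mon a s * mon b p * mon c q * (zt s p * zt s q * zt p q) +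
     mon a s * mon b q * mon c p * (zt s p * zt s q * zt q p)"
proof -
  have d: "{p, q, s} - {p} = {q, s}" "{p, q, s} - {q} = {p, s}" "{p, q, s} - {s} = {p, q}"
    using assms by auto
  have "psi [a, b, c] {p, q, s} = mon a p * (zt p q * zt p s) * psi [b, c] {q, s} +
     mon a q * (zt q p * zt q s) * psi [b, c] {p, s} + mon a s * (zt s p * zt s q) * psi [b, c] {p, q}"
    using assms unfolding psi.simps(2)[of a] by (simp add: d add.assoc del: psi.simps)
  then show ?thesis
    unfolding psi_pair[OF assms(1)] psi_pair[OF assms(2)] psi_pair[OF assms(3)] by (simp only: algebra_simps)
qed

section \<open>Compatibility of the twist with the defining relations\<close>

lemma cartan_sym: "cartan i j = cartan j i"
  by (auto simp: cartan_def)

lemma zt_rev: "zt q p = 1 - fls_const (cartan (fst p) (fst q) / 2) / (snd p - snd q)"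
proof -
  have "x / (snd q - snd p) = - (x / (snd p - snd q))" for x :: "complex fls"
    by (metis minus_diff_eq minus_divide_right)
  then show ?thesis by (simp add: zt_def cartan_sym[of "fst q" "fst p"])
qed

text \<open>Exchanging the points only changes the sign of the fraction, so the sum of the two
  factors is 2 and their difference is twice the fraction.\<close>

lemma quad_kernel:
  assumes "snd p \<noteq> snd q"
  shows "(snd p - snd q) * (zt p q - zt q p) =
     fls_const (cartan (fst p) (fst q) / 2) * (zt p q + zt q p)"
  using assms unfolding zt_rev[of q p] unfolding zt_def by (simp add: field_simps)

text \<open>With \<open>h = 1/2\<close>, the first bracket is \<open>(v - u + 1) / (u * v)\<close>
  and \<open>1 + 1 / (u - v)\<close> is \<open>(u - v + 1) / (u - v)\<close>. Their product is
  antisymmetric in \<open>u\<close> and \<open>v\<close>, so the exchanged summand cancels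
  it.\<close>

lemma serre_kernel_aux:
  fixes u v h :: "'a::field"
  assumes "u \<noteq> 0" "v \<noteq> 0" "u \<noteq> v" "h + h = 1"
  shows "(1 + 1 / (u - v)) * ((1 - h / u) * (1 - h / v) - 2 * ((1 - h / u) * (1 + h / v)) + (1 + h / u) * (1 + h / v)) +
     (1 - 1 / (u - v)) * ((1 - h / v) * (1 - h / u) - 2 * ((1 - h / v) * (1 + h / u)) + (1 + h / v) * (1 + h / u)) = 0"
proof -
  have A: "(1 - h / x) * (1 - h / y) - 2 * ((1 - h / x) * (1 + h / y)) + (1 + h / x) * (1 + h / y) =
     (y - x + 1) / (x * y)" if "x \<noteq> 0" "y \<noteq> 0" for x y
  proof -
    have "(1 - h / x) * (1 - h / y) - 2 * ((1 - h / x) * (1 + h / y)) + (1 + h / x) * (1 + h / y) =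
      (h + h) / x - (h + h) / y + (h + h) * (h + h) / (x * y)"
      by (simp add: algebra_simps add_divide_distrib)
    also have "\<dots> = 1 / x - 1 / y + 1 / (x * y)" by (simp only: assms(4)) simp
    also have "\<dots> = (y - x + 1) / (x * y)" using that by (simp add: field_simps)
    finally show ?thesis .
  qed
  have d: "u - v \<noteq> 0" using assms by simp
  have "(1 + 1 / (u - v)) * ((v - u + 1) / (u * v)) + (1 - 1 / (u - v)) * ((u - v + 1) / (v * u)) = 0"
    using assms(1,2) d by (simp add: divide_simps) (simp add: algebra_simps)
  then show ?thesis by (simp only: A[OF assms(1,2)] A[OF assms(2,1)])
qed

lemma serre_kernel:
  assumes ij: "cartan i j = - 1" and c: "fst p = i" "fst q = i" "fst s = j"
    and d: "snd p \<noteq> snd q" "snd p \<noteq> snd s" "snd q \<noteq> snd s"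
  shows "zt p q * (zt p s * zt q s - 2 * (zt p s * zt s q) + zt s p * zt s q) +
      zt q p * (zt q s * zt p s - 2 * (zt q s * zt s p) + zt s q * zt s p) = 0"
proof -
  let ?u = "snd p - snd s" and ?v = "snd q - snd s" and ?h = "fls_const (1/2) :: complex fls"
  have h: "?h + ?h = 1" by (simp add: fls_plus_const)
  have [simp]: "cartan i i = 2" by (simp add: cartan_def)
  have ps: "zt p s = 1 - ?h / ?u" "zt s p = 1 + ?h / ?u"
    unfolding zt_rev[of s p] unfolding zt_def c ij by simp_all
  have qs: "zt q s = 1 - ?h / ?v" "zt s q = 1 + ?h / ?v"
    unfolding zt_rev[of s q] unfolding zt_def c ij by simp_all
  have pq: "zt p q = 1 + 1 / (?u - ?v)" "zt q p = 1 - 1 / (?u - ?v)"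
    unfolding zt_rev[of q p] unfolding zt_def c by simp_all
  show ?thesis unfolding ps qs pq by (rule serre_kernel_aux) (use d h in auto)
qed

text \<open>By \<open>psi_card\<close> only sets of two or three points matter; there each relator
  splits, by the assignment of letters to points, into multiples of the kernels above.\<close>

lemma Psi_rels:
  assumes X: "finite X" "inj_on snd X" and "\<rho> \<in> rels n"
  shows "Psi \<rho> X = 0"
proof -
  have card2: "(\<exists>p q. X = {p, q} \<and> p \<noteq> q \<and> snd p \<noteq> snd q) \<or> (\<forall>a b. psi [a, b] X = 0)"
  proof (cases "card X = 2")
    case True
    then obtain p q where X': "X = {p, q}" "p \<noteq> q" by (auto simp: card_2_iff)
    then have "snd p \<noteq> snd q" using X(2) by (auto simp: inj_on_def)
    then show ?thesis using X' by blast
  next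
    case False
    then show ?thesis using psi_card[OF X(1)] by (metis length_Cons list.size(3) numeral_2_eq_2 numeral_3_eq_3)
  qed
  have card3: "(\<exists>p q s. X = {p, q, s} \<and> p \<noteq> q \<and> p \<noteq> s \<and> q \<noteq> s \<and> snd p \<noteq> snd q \<and> snd p \<noteq> snd s \<and> snd q \<noteq> snd s)
     \<or> (\<forall>a b c. psi [a, b, c] X = 0)"
  proof (cases "card X = 3")
    case True
    then obtain p q s where X': "X = {p, q, s}" "p \<noteq> q" "p \<noteq> s" "q \<noteq> s" by (auto simp: card_3_iff)
    then have "snd p \<noteq> snd q" "snd p \<noteq> snd s" "snd q \<noteq> snd s" using X(2) by (auto simp: inj_on_def)
    then show ?thesis using X' by blast
  next
    case False
    then show ?thesis using psi_card[OF X(1)] by (metis length_Cons list.size(3) numeral_2_eq_2 numeral_3_eq_3)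
  qed
  consider (quad) i j r s where "\<rho> = comm (gen (i, Suc r)) (gen (j, s)) - comm (gen (i, r)) (gen (j, Suc s))
       - scal (cartan i j / 2) (fmul (gen (i, r)) (gen (j, s)) + fmul (gen (j, s)) (gen (i, r)))"
    | (far) i j r s where "\<rho> = comm (gen (i, r)) (gen (j, s))" "cartan i j = 0"
    | (serre) i j r1 r2 s where "\<rho> = comm (gen (i, r1)) (comm (gen (i, r2)) (gen (j, s)))
       + comm (gen (i, r2)) (comm (gen (i, r1)) (gen (j, s)))" "cartan i j = - 1"
    using assms(3) unfolding rels_def by blast
  then show ?thesis
  proof cases
    case quad
    have *: "Psi \<rho> X = psi [(i, Suc r), (j, s)] X - psi [(j, s), (i, Suc r)] X
       - (psi [(i, r), (j, Suc s)] X - psi [(j, Suc s), (i, r)] X)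
       - fls_const (cartan i j / 2) * (psi [(i, r), (j, s)] X + psi [(j, s), (i, r)] X)"
      unfolding quad by (simp add: comm_def gen_eq_wd fmul_wd Psi_add Psi_diff Psi_scal Psi_wd del: psi.simps)
    have k: "mon (i, Suc r) p * mon (j, s) q * (zt p q - zt q p) - mon (i, r) p * mon (j, Suc s) q * (zt p q - zt q p)
       = fls_const (cartan i j / 2) * (mon (i, r) p * mon (j, s) q * (zt p q + zt q p))"
      if "snd p \<noteq> snd q" for p q
    proof (cases "fst p = i \<and> fst q = j")
      case True
      have "snd p ^ r * snd q ^ s * ((snd p - snd q) * (zt p q - zt q p)) =
        snd p ^ r * snd q ^ s * (fls_const (cartan i j / 2) * (zt p q + zt q p))"
        using quad_kernel[OF that] True by simp
      then show ?thesis using True by (simp add: algebra_simps)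
    qed auto
    from card2 show ?thesis
    proof
      assume "\<exists>p q. X = {p, q} \<and> p \<noteq> q \<and> snd p \<noteq> snd q"
      then obtain p q where X': "X = {p, q}" "p \<noteq> q" "snd p \<noteq> snd q" by blast
      have "Psi \<rho> X = (mon (i, Suc r) p * mon (j, s) q * (zt p q - zt q p) - mon (i, r) p * mon (j, Suc s) q * (zt p q - zt q p)
        - fls_const (cartan i j / 2) * (mon (i, r) p * mon (j, s) q * (zt p q + zt q p))) +
        (mon (i, Suc r) q * mon (j, s) p * (zt q p - zt p q) - mon (i, r) q * mon (j, Suc s) p * (zt q p - zt p q)
        - fls_const (cartan i j / 2) * (mon (i, r) q * mon (j, s) p * (zt q p + zt p q)))"
        unfolding * unfolding X'(1) psi_pair[OF X'(2)] by (simp only: algebra_simps)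
      then show ?thesis using k[OF X'(3)] k[OF X'(3)[symmetric]] by simp
    qed (simp add: *)
  next
    case far
    have *: "Psi \<rho> X = psi [(i, r), (j, s)] X - psi [(j, s), (i, r)] X"
      unfolding far by (simp add: comm_def gen_eq_wd fmul_wd Psi_diff Psi_wd del: psi.simps)
    have "mon (i, r) p * mon (j, s) q * zt p q = mon (i, r) p * mon (j, s) q"
      "mon (i, r) p * mon (j, s) q * zt q p = mon (i, r) p * mon (j, s) q" for p q
      using far cartan_sym[of i j] by (auto simp: zt_def)
    note k = this
    from card2 show ?thesis
    proof
      assume "\<exists>p q. X = {p, q} \<and> p \<noteq> q \<and> snd p \<noteq> snd q"
      then obtain p q where X': "X = {p, q}" "p \<noteq> q" by blast
      show ?thesis unfolding * unfolding X'(1) psi_pair[OF X'(2)]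
        using k[of p q] k[of q p] by (simp only: mult.commute[of "mon (j, s) _" "mon (i, r) _"]) simp
    qed (simp add: *)
  next
    case serre
    let ?a = "(i, r1)" and ?b = "(i, r2)" and ?c = "(j, s)"
    have *: "Psi \<rho> X = psi [?a, ?b, ?c] X - psi [?a, ?c, ?b] X - (psi [?b, ?c, ?a] X - psi [?c, ?b, ?a] X)
       + (psi [?b, ?a, ?c] X - psi [?b, ?c, ?a] X - (psi [?a, ?c, ?b] X - psi [?c, ?a, ?b] X))"
      unfolding serre by (simp only: comm_def gen_eq_wd fmul_diff_left fmul_diff_right fmul_wd append.simps
          Psi_add Psi_diff Psi_wd Fin_add Fin_diff Fin_wd)
    let ?K = "\<lambda>p q s. zt p q * (zt p s * zt q s - 2 * (zt p s * zt s q) + zt s p * zt s q) +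
      zt q p * (zt q s * zt p s - 2 * (zt q s * zt s p) + zt s q * zt s p)"
    have k: "mon ?a p * mon ?b q * mon ?c t * ?K p q t = 0"
      if "snd p \<noteq> snd q" "snd p \<noteq> snd t" "snd q \<noteq> snd t" for p q t
    proof (cases "fst p = i \<and> fst q = i \<and> fst t = j")
      case True
      then have "?K p q t = 0" using that serre by (intro serre_kernel) auto
      then show ?thesis by simp
    qed auto
    \<comment> \<open>A polynomial identity, with \<open>A1\<close> for the value of the first
      letter at the first point and \<open>z12\<close> for the twist from the first to the second
      point. Eight words in six orderings regroup into six Serre kernels.\<close>
    have ex: "(A1*B2*C3*(z12*z13*z23) + A1*B3*C2*(z12*z13*z32) + A2*B1*C3*(z21*z23*z13) + A2*B3*C1*(z21*z23*z31)
         + A3*B1*C2*(z31*z32*z12) + A3*B2*C1*(z31*z32*z21))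
       - (A1*C2*B3*(z12*z13*z23) + A1*C3*B2*(z12*z13*z32) + A2*C1*B3*(z21*z23*z13) + A2*C3*B1*(z21*z23*z31)
         + A3*C1*B2*(z31*z32*z12) + A3*C2*B1*(z31*z32*z21))
       - ((B1*C2*A3*(z12*z13*z23) + B1*C3*A2*(z12*z13*z32) + B2*C1*A3*(z21*z23*z13) + B2*C3*A1*(z21*z23*z31)
         + B3*C1*A2*(z31*z32*z12) + B3*C2*A1*(z31*z32*z21))
       - (C1*B2*A3*(z12*z13*z23) + C1*B3*A2*(z12*z13*z32) + C2*B1*A3*(z21*z23*z13) + C2*B3*A1*(z21*z23*z31)
         + C3*B1*A2*(z31*z32*z12) + C3*B2*A1*(z31*z32*z21)))
       + ((B1*A2*C3*(z12*z13*z23) + B1*A3*C2*(z12*z13*z32) + B2*A1*C3*(z21*z23*z13) + B2*A3*C1*(z21*z23*z31)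
         + B3*A1*C2*(z31*z32*z12) + B3*A2*C1*(z31*z32*z21))
       - (B1*C2*A3*(z12*z13*z23) + B1*C3*A2*(z12*z13*z32) + B2*C1*A3*(z21*z23*z13) + B2*C3*A1*(z21*z23*z31)
         + B3*C1*A2*(z31*z32*z12) + B3*C2*A1*(z31*z32*z21))
       - ((A1*C2*B3*(z12*z13*z23) + A1*C3*B2*(z12*z13*z32) + A2*C1*B3*(z21*z23*z13) + A2*C3*B1*(z21*z23*z31)
         + A3*C1*B2*(z31*z32*z12) + A3*C2*B1*(z31*z32*z21))
       - (C1*A2*B3*(z12*z13*z23) + C1*A3*B2*(z12*z13*z32) + C2*A1*B3*(z21*z23*z13) + C2*A3*B1*(z21*z23*z31)
         + C3*A1*B2*(z31*z32*z12) + C3*A2*B1*(z31*z32*z21)))) =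
       A1*B2*C3*(z12*(z13*z23 - 2*(z13*z32) + z31*z32) + z21*(z23*z13 - 2*(z23*z31) + z32*z31)) +
       A2*B1*C3*(z21*(z23*z13 - 2*(z23*z31) + z32*z31) + z12*(z13*z23 - 2*(z13*z32) + z31*z32)) +
       A1*B3*C2*(z13*(z12*z32 - 2*(z12*z23) + z21*z23) + z31*(z32*z12 - 2*(z32*z21) + z23*z21)) +
       A3*B1*C2*(z31*(z32*z12 - 2*(z32*z21) + z23*z21) + z13*(z12*z32 - 2*(z12*z23) + z21*z23)) +
       A2*B3*C1*(z23*(z21*z31 - 2*(z21*z13) + z12*z13) + z32*(z31*z21 - 2*(z31*z12) + z13*z12)) +
       A3*B2*C1*(z32*(z31*z21 - 2*(z31*z12) + z13*z12) + z23*(z21*z31 - 2*(z21*z13) + z12*z13))"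
      for A1 A2 A3 B1 B2 B3 C1 C2 C3 z12 z13 z21 z23 z31 z32 :: "complex fls"
      by (simp add: algebra_simps)
    from card3 show ?thesis
    proof
      assume "\<exists>p q s. X = {p, q, s} \<and> p \<noteq> q \<and> p \<noteq> s \<and> q \<noteq> s \<and> snd p \<noteq> snd q \<and> snd p \<noteq> snd s \<and> snd q \<noteq> snd s"
      then obtain p q t where X': "X = {p, q, t}" "p \<noteq> q" "p \<noteq> t" "q \<noteq> t"
        and d: "snd p \<noteq> snd q" "snd p \<noteq> snd t" "snd q \<noteq> snd t" by blast
      have "Psi \<rho> X = mon ?a p * mon ?b q * mon ?c t * ?K p q t + mon ?a q * mon ?b p * mon ?c t * ?K q p t +
        mon ?a p * mon ?b t * mon ?c q * ?K p t q + mon ?a t * mon ?b p * mon ?c q * ?K t p q +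
        mon ?a q * mon ?b t * mon ?c p * ?K q t p + mon ?a t * mon ?b q * mon ?c p * ?K t q p"
        unfolding * unfolding X'(1) psi_triple[OF X'(2-4)] by (rule ex)
      also have "\<dots> = 0" 
        using k[OF d] k[OF d(1)[symmetric] d(3) d(2)] k[OF d(2) d(1) d(3)[symmetric]]
          k[OF d(2,3)[symmetric] d(1)] k[OF d(3) d(1,2)[symmetric]] k[OF d(3)[symmetric] d(2)[symmetric] d(1)[symmetric]]
        by (simp only: add_0_right)
      finally show ?thesis .
    qed (simp add: *)
  qed
qed

lemma Fin_rels: "\<rho> \<in> rels n \<Longrightarrow> \<rho> \<in> Fin"
  by (auto simp: rels_def)

lemma Fin_Jid: "x \<in> Jid n \<Longrightarrow> x \<in> Fin"
  by (induction rule: Jid.induct) (auto simp: fin_alg_iff Fin_rels)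

text \<open>A product distributes the points over its factors, and every subset inherits
  \<open>inj_on snd\<close>, so the relator is always evaluated where \<open>Psi_rels\<close>
  applies.\<close>

lemma Psi_Jid:
  "x \<in> Jid n \<Longrightarrow> finite X \<Longrightarrow> inj_on snd X \<Longrightarrow> Psi x X = 0"
proof (induction arbitrary: X rule: Jid.induct)
  case (Jid_gen \<rho> a b)
  have sub: "finite A" "inj_on snd A" if "A \<subseteq> X" for A
    using that Jid_gen.prems by (auto intro: finite_subset inj_on_subset)
  have "Psi (fmul a \<rho>) A = 0" if "A \<subseteq> X" for A
  proof -
    have "Psi \<rho> (A - B) = 0" for B
      using sub[of "A - B"] that by (intro Psi_rels[OF _ _ Jid_gen(1)]) auto
    then show ?thesis using Jid_gen sub[OF that] by (simp add: Psi_fmul fin_alg_iff Fin_rels)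
  qed
  then show ?case using Jid_gen by (simp add: Psi_fmul fin_alg_iff Fin_rels)
qed (auto simp: Psi_add Fin_Jid)

text \<open>As a function of \<open>u\<close> the product has simple poles at the
  \<open>g p\<close>, whose residues are the products over the other points, and tends to 1 at
  infinity.\<close>

lemma partial_fractions:
  fixes g :: "'b \<Rightarrow> 'a::field"
  assumes "finite X"
  shows "inj_on g X \<Longrightarrow> u \<notin> g ` X \<Longrightarrow> (\<Prod>p\<in>X. 1 + 1 / (u - g p)) =
     1 + (\<Sum>p\<in>X. (\<Prod>q\<in>X - {p}. 1 + 1 / (g p - g q)) / (u - g p))"
  using assms
proof (induction X arbitrary: u rule: finite_induct)
  case (insert v X)
  let ?R = "\<lambda>p. \<Prod>q\<in>X - {p}. 1 + 1 / (g p - g q)"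
  have inj: "inj_on g X" and u: "u \<noteq> g v" "u \<notin> g ` X" and v: "g v \<notin> g ` X"
    using insert.prems insert.hyps by (auto simp: inj_on_def)
  have Rp: "(\<Prod>q\<in>insert v X - {p}. 1 + 1 / (g p - g q)) = (1 + 1 / (g p - g v)) * ?R p" if "p \<in> X" for p
  proof -
    have "insert v X - {p} = insert v (X - {p})" using that insert.hyps by auto
    then show ?thesis using insert.hyps by simp
  qed
  have Rv: "(\<Prod>q\<in>insert v X - {v}. 1 + 1 / (g v - g q)) = 1 + (\<Sum>p\<in>X. ?R p / (g v - g p))"
    using insert.IH[OF inj v] insert.hyps by simp
  have t: "(1 + 1 / (g p - g v)) * ?R p / (u - g p) + ?R p / (g v - g p) / (u - g v) =
     ?R p / (u - g p) * (1 + 1 / (u - g v))" if "p \<in> X" for p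
  proof -
    have "g p \<noteq> g v" using v that by (metis imageI)
    then have nz: "u - g p \<noteq> 0" "g p - g v \<noteq> 0" "u - g v \<noteq> 0" using u that by auto
    have "(1 + 1 / b) * R / a + R / (- b) / c = R / a * (1 + 1 / c)"
      if "a \<noteq> 0" "b \<noteq> 0" "c \<noteq> 0" "c = a + b" for a b c R :: 'a
      using that(1-3) by (simp add: divide_simps) (simp add: that(4) algebra_simps)
    from this[OF nz, of "?R p"] show ?thesis by simp
  qed
  have "(\<Sum>p\<in>insert v X. (\<Prod>q\<in>insert v X - {p}. 1 + 1 / (g p - g q)) / (u - g p)) =
     (1 + (\<Sum>p\<in>X. ?R p / (g v - g p))) / (u - g v) + (\<Sum>p\<in>X. (1 + 1 / (g p - g v)) * ?R p / (u - g p))"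
    using insert.hyps Rv Rp by (simp cong: sum.cong)
  also have "\<dots> = 1 / (u - g v) + (\<Sum>p\<in>X. (1 + 1 / (g p - g v)) * ?R p / (u - g p) + ?R p / (g v - g p) / (u - g v))"
    by (simp add: add_divide_distrib sum_divide_distrib sum.distrib)
  also have "\<dots> = 1 / (u - g v) + (\<Sum>p\<in>X. ?R p / (u - g p)) * (1 + 1 / (u - g v))"
    unfolding sum_distrib_right by (intro arg_cong2[of _ _ _ _ "(+)"] refl sum.cong t)
  finally show ?case using insert.IH[OF inj u(2)] insert.hyps by (simp add: algebra_simps)
qed simp

text \<open>A new point \<open>v\<close> changes each old summand by a term
  \<open>?R p / (g p - g v)\<close>. Its own summand, by partial fractions at
  \<open>u = g v\<close>, is 1 minus all these changes, so the total grows by 1.\<close>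

lemma lagrange_sum:
  fixes g :: "'b \<Rightarrow> 'a::field"
  assumes "finite X"
  shows "inj_on g X \<Longrightarrow> (\<Sum>p\<in>X. \<Prod>q\<in>X - {p}. 1 + 1 / (g p - g q)) = of_nat (card X)"
  using assms
proof (induction X rule: finite_induct)
  case (insert v X)
  let ?R = "\<lambda>p. \<Prod>q\<in>X - {p}. 1 + 1 / (g p - g q)"
  have inj: "inj_on g X" and v: "g v \<notin> g ` X"
    using insert.prems insert.hyps by (auto simp: inj_on_def)
  have Rp: "(\<Prod>q\<in>insert v X - {p}. 1 + 1 / (g p - g q)) = (1 + 1 / (g p - g v)) * ?R p" if "p \<in> X" for p
  proof -
    have "insert v X - {p} = insert v (X - {p})" using that insert.hyps by auto
    then show ?thesis using insert.hyps by simp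
  qed
  have Rv: "(\<Prod>q\<in>insert v X - {v}. 1 + 1 / (g v - g q)) = 1 + (\<Sum>p\<in>X. ?R p / (g v - g p))"
    using partial_fractions[OF insert.hyps(1) inj v] insert.hyps by simp
  have "?R p / (g v - g p) = - (?R p / (g p - g v))" for p
    by (metis minus_diff_eq minus_divide_right)
  then have "(\<Sum>p\<in>X. ?R p / (g v - g p)) + (\<Sum>p\<in>X. (1 + 1 / (g p - g v)) * ?R p) = (\<Sum>p\<in>X. ?R p)"
    by (simp add: sum_negf algebra_simps sum.distrib)
  then show ?case using insert Rv Rp inj by (simp cong: sum.cong)
qed simp

text \<open>For points of one colour half the Cartan entry is 1, so \<open>lagrange_sum\<close>
  applies: each choice of a first point contributes the number of points left, \<open>fact t\<close>
  in all. This is exactly the denominator of the divided power.\<close>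

lemma Psi_fpow_gen:
  "finite X \<Longrightarrow> inj_on snd X \<Longrightarrow> Psi (fpow (gen (i, r)) t) X =
     (if card X = t \<and> fst ` X \<subseteq> {i} then of_nat (fact t) * (\<Prod>p\<in>X. snd p ^ r) else 0)"
proof (induction t arbitrary: X)
  case 0
  then show ?case by (simp add: fone_eq_wd Psi_wd)
next
  case (Suc t)
  have IH: "Psi (fpow (gen (i, r)) t) (X - {p}) = (if card (X - {p}) = t \<and> fst ` (X - {p}) \<subseteq> {i}
     then of_nat (fact t) * (\<Prod>p\<in>X - {p}. snd p ^ r) else 0)" for p
    by (rule Suc.IH) (use Suc.prems in \<open>auto intro: inj_on_subset\<close>)
  let ?P = "\<Prod>p\<in>X. snd p ^ r"
  show ?case
  proof (cases "card X = Suc t \<and> fst ` X \<subseteq> {i}")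
    case True
    then have i: "fst p = i" if "p \<in> X" for p using that by auto
    have ii: "cartan i i = 2" by (simp add: cartan_def)
    have z: "zt p q = 1 + 1 / (snd p - snd q)" if "p \<in> X" "q \<in> X" for p q
      using i that by (simp add: zt_def ii)
    have "Psi (fpow (gen (i, r)) (Suc t)) X = (\<Sum>p\<in>X. snd p ^ r * (\<Prod>q\<in>X - {p}. zt p q) *
        (of_nat (fact t) * (\<Prod>p\<in>X - {p}. snd p ^ r)))"
      unfolding fpow_Suc Psi_gen_fmul[OF Fin_fpow[OF Fin_gen]] IH
      using True i Suc.prems by (intro sum.cong refl) auto
    also have "\<dots> = (\<Sum>p\<in>X. of_nat (fact t) * ?P * (\<Prod>q\<in>X - {p}. 1 + 1 / (snd p - snd q)))"
    proof (intro sum.cong refl)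
      fix p assume p: "p \<in> X"
      have "?P = snd p ^ r * (\<Prod>p\<in>X - {p}. snd p ^ r)" using p Suc.prems by (simp add: prod.remove)
      moreover have "(\<Prod>q\<in>X - {p}. zt p q) = (\<Prod>q\<in>X - {p}. 1 + 1 / (snd p - snd q))"
        using p by (intro prod.cong refl z) auto
      ultimately show "snd p ^ r * (\<Prod>q\<in>X - {p}. zt p q) * (of_nat (fact t) * (\<Prod>p\<in>X - {p}. snd p ^ r)) =
         of_nat (fact t) * ?P * (\<Prod>q\<in>X - {p}. 1 + 1 / (snd p - snd q))"
        by (simp add: mult_ac)
    qed
    also have "\<dots> = of_nat (fact t) * ?P * of_nat (card X)"
      using lagrange_sum[OF Suc.prems] by (simp add: sum_distrib_left[symmetric])
    finally show ?thesis using True by (simp add: algebra_simps)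
  next
    case False
    have "(if fst p = i then snd p ^ r else 0) * (\<Prod>q\<in>X - {p}. zt p q) * Psi (fpow (gen (i, r)) t) (X - {p}) = 0"
      if "p \<in> X" for p
    proof -
      have "\<not> (fst p = i \<and> card (X - {p}) = t \<and> fst ` (X - {p}) \<subseteq> {i})"
        using False that Suc.prems card_Suc_Diff1[of X p] by auto
      then show ?thesis unfolding IH by auto
    qed
    then have "Psi (fpow (gen (i, r)) (Suc t)) X = 0"
      unfolding fpow_Suc Psi_gen_fmul[OF Fin_fpow[OF Fin_gen]] fst_conv snd_conv by (intro sum.neutral ballI)
    then show ?thesis by (simp only: False if_False)
  qed
qed

notation fls_nth (infixl "$$" 75)

section \<open>Dyadic Laurent series and leading terms\<close>

lemma dyadicI: "x = of_int k / 2 ^ m \<Longrightarrow> x \<in> dyadic"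
  by (auto simp: dyadic_def)

lemma dyadic_of_int [simp]: "of_int k \<in> dyadic"
  by (rule dyadicI[of _ k 0]) simp

lemma dyadic_0 [simp]: "0 \<in> dyadic" and dyadic_1 [simp]: "1 \<in> dyadic"
  using dyadic_of_int[of 0] dyadic_of_int[of 1] by simp_all

lemma dyadic_add [simp]: "x \<in> dyadic \<Longrightarrow> y \<in> dyadic \<Longrightarrow> x + y \<in> dyadic"
proof -
  assume "x \<in> dyadic" "y \<in> dyadic"
  then obtain a m b l where "x = of_int a / 2 ^ m" "y = of_int b / 2 ^ l" by (auto simp: dyadic_def)
  then have "x + y = of_int (a * 2 ^ l + b * 2 ^ m) / 2 ^ (m + l)" by (simp add: power_add add_divide_distrib)
  then show ?thesis by (rule dyadicI)
qed

lemma dyadic_mult [simp]: "x \<in> dyadic \<Longrightarrow> y \<in> dyadic \<Longrightarrow> x * y \<in> dyadic"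
proof -
  assume "x \<in> dyadic" "y \<in> dyadic"
  then obtain a m b l where "x = of_int a / 2 ^ m" "y = of_int b / 2 ^ l" by (auto simp: dyadic_def)
  then have "x * y = of_int (a * b) / 2 ^ (m + l)" by (simp add: power_add)
  then show ?thesis by (rule dyadicI)
qed

lemma dyadic_minus [simp]: "x \<in> dyadic \<Longrightarrow> - x \<in> dyadic"
  using dyadic_mult[of "of_int (- 1)" x] dyadic_of_int[of "- 1"] by simp

lemma dyadic_diff [simp]: "x \<in> dyadic \<Longrightarrow> y \<in> dyadic \<Longrightarrow> x - y \<in> dyadic"
  using dyadic_add[of x "- y"] by simp

lemma dyadic_half [simp]: "of_nat k / 2 \<in> dyadic"
  by (rule dyadicI[of _ "int k" 1]) simp

lemma dyadic_sum: "(\<And>a. a \<in> A \<Longrightarrow> f a \<in> dyadic) \<Longrightarrow> sum f A \<in> dyadic"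
  by (induction A rule: infinite_finite_induct) auto

definition DR :: "complex fls set" where
  "DR = {f. \<forall>k. f $$ k \<in> dyadic}"

lemma DR_add: "f \<in> DR \<Longrightarrow> g \<in> DR \<Longrightarrow> f + g \<in> DR"
  and DR_diff: "f \<in> DR \<Longrightarrow> g \<in> DR \<Longrightarrow> f - g \<in> DR"
  by (auto simp: DR_def)

lemma DR_mult: "f \<in> DR \<Longrightarrow> g \<in> DR \<Longrightarrow> f * g \<in> DR"
  by (auto simp: DR_def fls_times_nth(2) intro!: dyadic_sum)

lemma DR_const: "c \<in> dyadic \<Longrightarrow> fls_const c \<in> DR"
  by (auto simp: DR_def)

lemma DR_0: "0 \<in> DR" and DR_1: "1 \<in> DR"
  using DR_const[of 0] DR_const[of 1] by simp_all

lemma DR_X_inv: "fls_X_inv ^ m \<in> DR"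
  by (auto simp: DR_def)

lemma DR_power: "f \<in> DR \<Longrightarrow> f ^ m \<in> DR"
  by (induction m) (auto intro: DR_mult DR_1)

lemma DR_prod: "(\<And>a. a \<in> A \<Longrightarrow> f a \<in> DR) \<Longrightarrow> prod f A \<in> DR"
  by (induction A rule: infinite_finite_induct) (auto intro: DR_mult DR_1)

lemma DR_sum: "(\<And>a. a \<in> A \<Longrightarrow> f a \<in> DR) \<Longrightarrow> sum f A \<in> DR"
  by (induction A rule: infinite_finite_induct) (auto intro: DR_add DR_0)

text \<open>Solving \<open>f * g = 1\<close> coefficient by coefficient divides only by the leading
  coefficient of \<open>f\<close>, here 1 or -1.\<close>

lemma DR_inverse:
  assumes f: "f \<in> DR" and u: "f $$ fls_subdegree f \<in> {1, - 1}"
  shows "inverse f \<in> DR"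
proof -
  define N g where "N = fls_subdegree f" and "g = inverse f"
  have "f \<noteq> 0" using u by auto
  then have fg: "f * g = 1" by (simp add: g_def)
  have sg: "fls_subdegree g = - N" by (simp add: g_def N_def)
  have "g $$ (- N + int m) \<in> dyadic" for m
  proof (induction m rule: less_induct)
    case (less m)
    let ?k = "- N + int m"
    have "(f * g) $$ int m = (\<Sum>i=N..N + int m. f $$ i * g $$ (int m - i))"
      by (subst fls_times_nth(2)) (simp add: sg N_def[symmetric] algebra_simps)
    also have "{N..N + int m} = insert N {N + 1..N + int m}" by auto
    finally have e: "f $$ N * g $$ ?k = (f * g) $$ int m - (\<Sum>i=N + 1..N + int m. f $$ i * g $$ (int m - i))"
      by simp
    have "g $$ (int m - i) \<in> dyadic" if "i \<in> {N + 1..N + int m}" for i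
    proof -
      have "int m - i = - N + int (nat (int m - i + N))" "nat (int m - i + N) < m" using that by auto
      then show ?thesis using less.IH[of "nat (int m - i + N)"] by metis
    qed
    then have "f $$ N * g $$ ?k \<in> dyadic" unfolding e fg using f
      by (intro dyadic_diff dyadic_sum dyadic_mult) (auto simp: DR_def)
    then show ?case using u dyadic_minus[of "- g $$ ?k"] by (auto simp: N_def)
  qed
  then have "g $$ k \<in> dyadic" for k
  proof (cases "k < - N")
    case False
    then have "k = - N + int (nat (k + N))" by simp
    then show ?thesis using \<open>\<And>m. g $$ (- N + int m) \<in> dyadic\<close> by metis
  qed (simp add: sg fls_eq0_below_subdegree)
  then show ?thesis by (simp add: DR_def g_def)
qed

text \<open>\<open>c\<close> may be 0: a series of higher order then also has leading data at
  \<open>N\<close>, so sums in which some terms do not reach the order \<open>N\<close> need no case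
  distinction.\<close>

definition lead :: "int \<Rightarrow> complex \<Rightarrow> complex fls \<Rightarrow> bool" where
  "lead N c f \<longleftrightarrow> (\<forall>k<N. f $$ k = 0) \<and> f $$ N = c"

lemma lead_add: "lead N c f \<Longrightarrow> lead N d g \<Longrightarrow> lead N (c + d) (f + g)"
  by (simp add: lead_def)

lemma lead_0: "lead N 0 0"
  by (simp add: lead_def)

lemma lead_sum: "(\<And>a. a \<in> A \<Longrightarrow> lead N (c a) (f a)) \<Longrightarrow> lead N (sum c A) (sum f A)"
  by (induction A rule: infinite_finite_induct) (auto intro: lead_add lead_0)

lemma lead_less: "lead N c f \<Longrightarrow> M < N \<Longrightarrow> lead M 0 f"
  by (auto simp: lead_def)

lemma lead_mult:
  assumes f: "lead N c f" and g: "lead M d g"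
  shows "lead (N + M) (c * d) (f * g)"
proof -
  have z: "f $$ i * g $$ (n - i) = (if i = N \<and> n = N + M then c * d else 0)" if "n \<le> N + M" for i n
    using that f g by (cases i N rule: linorder_cases) (auto simp: lead_def)
  have "(f * g) $$ n = 0" if "n < N + M" for n
    using that by (simp add: fls_times_nth(2) z)
  moreover have "(f * g) $$ (N + M) = c * d"
  proof (cases "N \<in> {fls_subdegree f..N + M - fls_subdegree g}")
    case True
    then show ?thesis by (simp add: fls_times_nth(2) z sum.delta)
  next
    case False
    \<comment> \<open>The index \<open>N\<close> falls outside the summation range only if one of
      the named coefficients is 0, and then the claimed value is 0 as well.\<close>
    then have "N < fls_subdegree f \<or> M < fls_subdegree g" by auto
    then have "c * d = 0" using f g by (auto simp: lead_def)
    then show ?thesis using False by (simp add: fls_times_nth(2) z sum.delta)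
  qed
  ultimately show ?thesis by (simp add: lead_def)
qed

lemma lead_1: "lead 0 1 1"
  by (simp add: lead_def)

lemma lead_const: "lead 0 c (fls_const c)"
  by (simp add: lead_def)

lemma lead_prod: "(\<And>a. a \<in> A \<Longrightarrow> lead 0 1 (f a)) \<Longrightarrow> lead 0 1 (prod f A)"
proof (induction A rule: infinite_finite_induct)
  case (insert a A)
  then show ?case using lead_mult[of 0 1 "f a" 0 1 "prod f A"] by simp
qed (auto intro: lead_1)

lemma lead_power: "lead N 1 f \<Longrightarrow> lead (int r * N) 1 (f ^ r)"
proof (induction r)
  case (Suc r)
  then show ?case using lead_mult[of N 1 f "int r * N" 1 "f ^ r"] by (simp add: algebra_simps)
qed (simp add: lead_1)

section \<open>Strings of points\<close>

text \<open>\<open>M\<close> identifies the string. The step 1/2 per colour is forced by the wish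
  that the twist vanish between neighbouring colours, see \<open>zt_spt_up\<close>.\<close>

definition spt :: "nat \<Rightarrow> nat \<Rightarrow> pt" where
  "spt M k = (k, fls_X_inv ^ M - fls_const (of_nat k / 2))"

definition str :: "(nat \<times> nat) \<times> nat \<Rightarrow> pt set" where
  "str s = spt (snd s) ` {fst (fst s)..snd (fst s)}"

definition XS :: "((nat \<times> nat) \<times> nat) list \<Rightarrow> pt set" where
  "XS S = (\<Union>s\<in>set S. str s)"

text \<open>Different positive exponents make points of different strings differ by a series with a
  pole, which no constant shift can cancel.\<close>

definition sgood :: "((nat \<times> nat) \<times> nat) list \<Rightarrow> bool" where
  "sgood S \<longleftrightarrow> pvalid S \<and> (\<forall>s\<in>set S. 0 < snd s) \<and> distinct (map snd S)"

lemma fst_spt [simp]: "fst (spt M k) = k"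
  by (simp add: spt_def)

lemma spt_diff: "snd (spt M k) - snd (spt M' k') =
    fls_X_inv ^ M - fls_X_inv ^ M' + fls_const (of_nat k' / 2 - of_nat k / 2)"
  by (simp add: spt_def flip: fls_minus_const)

text \<open>The higher of the two powers of \<open>fls_X_inv\<close> dominates the other power and
  the constant shift; its coefficient is 1 or -1, as \<open>DR_inverse\<close> demands.\<close>

lemma spt_diff_lead:
  fixes M M' k k' :: nat
  assumes "M \<noteq> M'" "0 < M" "0 < M'"
  defines "d \<equiv> snd (spt M k) - snd (spt M' k')"
  shows "d \<noteq> 0" "fls_subdegree d < 0" "d $$ fls_subdegree d \<in> {1, - 1}" "d \<in> DR"
proof -
  let ?N = "- int (max M M')"
  have n: "d $$ k = 0" if "k < ?N" for k
    using that assms by (auto simp: spt_diff)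
  have N: "d $$ ?N \<in> {1, - 1}" using assms by (auto simp: spt_diff max_def)
  then have s: "fls_subdegree d = ?N" using n by (intro fls_subdegree_eqI) auto
  show "d \<noteq> 0" using N by auto
  show "fls_subdegree d < 0" "d $$ fls_subdegree d \<in> {1, - 1}" using s N assms by auto
  show "d \<in> DR" unfolding d_def spt_diff by (intro DR_add DR_diff DR_X_inv DR_const) auto
qed

lemma spt_same_diff: "snd (spt M k) - snd (spt M k') = fls_const (of_nat k' / 2 - of_nat k / 2)"
  by (simp add: spt_diff)

lemma snd_spt_eq_iff:
  assumes "0 < M" "0 < M'"
  shows "snd (spt M k) = snd (spt M' k') \<longleftrightarrow> M = M' \<and> k = k'"
proof (cases "M = M'")
  case True
  then show ?thesis using spt_same_diff[of M k k'] by auto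
next
  case False
  then show ?thesis using spt_diff_lead(1)[of M M' k k'] assms by auto
qed

text \<open>\<open>1 + (-1/2) / (1/2) = 0\<close>. In the opposite direction the denominator changes
  sign and the value is 2.\<close>

lemma zt_spt_up: "zt (spt M k) (spt M (Suc k)) = 0"
proof -
  have "cartan k (Suc k) = - 1" by (simp add: cartan_def)
  moreover have "of_nat (Suc k) / 2 - of_nat k / 2 = (1 / 2 :: complex)" by (simp add: field_simps)
  ultimately show ?thesis unfolding zt_def spt_same_diff fst_spt
    by (simp only: fls_const_divide_const) simp
qed

lemma zt_spt_down: "zt (spt M (Suc k)) (spt M k) = fls_const 2"
proof -
  have "cartan (Suc k) k = - 1" by (simp add: cartan_def)
  moreover have "of_nat k / 2 - of_nat (Suc k) / 2 = (- 1 / 2 :: complex)" by (simp add: field_simps)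
  ultimately show ?thesis unfolding zt_def spt_same_diff fst_spt
    by (simp only: fls_const_divide_const) simp
qed

lemma zt_far: "cartan (fst p) (fst q) = 0 \<Longrightarrow> zt p q = 1"
  by (simp add: zt_def)

text \<open>The difference of the points has a pole, so its inverse has positive order: different
  strings do not interact in the leading term.\<close>

lemma zt_spt_lead:
  assumes "M \<noteq> M'" "0 < M" "0 < M'"
  shows "lead 0 1 (zt (spt M k) (spt M' k'))"
proof -
  let ?d = "snd (spt M k) - snd (spt M' k')"
  have "fls_subdegree (inverse ?d) > 0" using spt_diff_lead(2)[OF assms] by simp
  then have "inverse ?d $$ j = 0" if "j \<le> 0" for j using that by (intro fls_eq0_below_subdegree) simp
  then have "lead 0 0 (inverse ?d)" by (simp add: lead_def)
  from lead_mult[OF lead_const[of "cartan k k' / 2"] this]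
  have "lead 0 0 (fls_const (cartan k k' / 2) * inverse ?d)" by simp
  from lead_add[OF lead_1 this] have "lead 0 1 (1 + fls_const (cartan k k' / 2) * inverse ?d)" by simp
  then show ?thesis by (simp only: zt_def divide_inverse fst_spt)
qed

lemma cartan_half_dyadic [simp]: "cartan i j / 2 \<in> dyadic"
proof -
  have "- 1 / 2 \<in> dyadic" by (rule dyadicI[of _ "- 1" 1]) simp
  then show ?thesis by (auto simp: cartan_def)
qed

lemma zt_spt_DR:
  assumes "0 < M" "0 < M'" "(M, k) \<noteq> (M', k')"
  shows "zt (spt M k) (spt M' k') \<in> DR"
proof (cases "M = M'")
  case False
  have "inverse (snd (spt M k) - snd (spt M' k')) \<in> DR"
    using spt_diff_lead[OF False] assms by (intro DR_inverse) auto
  then show ?thesis unfolding zt_def divide_inverse by (intro DR_add DR_1 DR_mult DR_const) auto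
next
  case True
  consider "k' = Suc k" | "k = Suc k'" | "cartan k k' = 0" 
    using assms True by (cases "k = Suc k' \<or> k' = Suc k") (auto simp: cartan_def)
  then show ?thesis
  proof cases
    case 1
    then show ?thesis using True by (simp add: zt_spt_up DR_0)
  next
    case 2
    then show ?thesis using True zt_spt_down[of M k'] DR_const[of 2] dyadic_of_int[of 2] by simp
  next
    case 3
    then show ?thesis by (simp add: zt_far DR_1)
  qed
qed

lemma spt_cases:
  assumes "p \<in> XS S" "sgood S"
  obtains s k where "s \<in> set S" "p = spt (snd s) k" "fst (fst s) \<le> k" "k \<le> snd (fst s)" "0 < snd s"
  using assms by (auto simp: XS_def str_def sgood_def)

lemma finite_XS [simp]: "finite (XS S)"
  by (simp add: XS_def str_def)

lemma sgood_inj: "sgood S \<Longrightarrow> s \<in> set S \<Longrightarrow> s' \<in> set S \<Longrightarrow> snd s = snd s' \<Longrightarrow> s = s'"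
  by (auto simp: sgood_def distinct_map inj_on_def)

lemma inj_snd_XS: "sgood S \<Longrightarrow> inj_on snd (XS S)"
proof (rule inj_onI)
  fix p q assume S: "sgood S" and "p \<in> XS S" "q \<in> XS S" "snd p = snd q"
  then show "p = q" by (elim spt_cases[OF _ S]) (simp add: snd_spt_eq_iff)
qed

lemma zt_XS_DR:
  assumes S: "sgood S" and "p \<in> XS S" "q \<in> XS S" "p \<noteq> q"
  shows "zt p q \<in> DR"
  using assms by (elim spt_cases[OF _ S]) (auto intro!: zt_spt_DR)

lemma snd_XS_DR:
  assumes S: "sgood S" and "p \<in> XS S"
  shows "snd p \<in> DR"
  using assms by (elim spt_cases[OF _ S]) (auto simp: spt_def intro!: DR_diff DR_X_inv DR_const)

lemma Zt_XS_DR: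
  assumes "sgood S" "A \<subseteq> XS S" "B \<subseteq> XS S" "A \<inter> B = {}"
  shows "Zt A B \<in> DR"
  unfolding Zt_def using assms by (intro DR_prod zt_XS_DR[OF assms(1)]) auto

text \<open>A product distributes the points over its factors, so the induction has to cover all
  subsets of \<open>XS S\<close>. Generators cause no denominators by
  \<open>Psi_fpow_gen\<close>.\<close>

lemma Psi_zsub_DR:
  assumes S: "sgood S"
  shows "x \<in> zsub n \<Longrightarrow> x \<in> Fin \<and> (\<forall>A\<subseteq>XS S. Psi x A \<in> DR)"
proof (induction rule: zsub.induct)
  case zsub_one
  then show ?case by (auto simp: fone_eq_wd Psi_wd DR_0 DR_1)
next
  case (zsub_gen x)
  then obtain i r t where x: "x = scal (1 / fact t) (fpow (gen (i, r)) t)" by (auto simp: divpow_gens_def)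
  have "Psi x A \<in> DR" if A: "A \<subseteq> XS S" for A
  proof -
    have "finite A" "inj_on snd A"
      using A inj_snd_XS[OF S] by (auto intro: finite_subset inj_on_subset)
    note P = Psi_fpow_gen[OF this, of i r t]
    have f: "fls_const (1 / fact t) * of_nat (fact t) = (1 :: complex fls)"
      by (simp add: fls_of_nat)
    have "Psi x A = 0 \<or> Psi x A = (\<Prod>p\<in>A. snd p ^ r)"
      unfolding x Psi_scal P mult.assoc[symmetric] f by (simp add: mult.assoc[symmetric] f[simplified])
    moreover have "(\<Prod>p\<in>A. snd p ^ r) \<in> DR"
      using A by (intro DR_prod DR_power snd_XS_DR[OF S]) auto
    ultimately show ?thesis using DR_0 by auto
  qed
  then show ?case by (auto simp: x)
next
  case (zsub_mul x y)
  have "Psi (fmul x y) A \<in> DR" if A: "A \<subseteq> XS S" for A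
  proof -
    have "finite A" using A by (rule finite_subset) simp
    then have "Psi (fmul x y) A = (\<Sum>B\<in>Pow A. Psi x B * Psi y (A - B) * Zt B (A - B))"
      using zsub_mul.IH by (simp add: Psi_fmul)
    moreover have "Psi x B * Psi y (A - B) * Zt B (A - B) \<in> DR" if "B \<in> Pow A" for B
    proof -
      have B: "B \<subseteq> XS S" "A - B \<subseteq> XS S" using that A by auto
      then have "Psi x B \<in> DR" "Psi y (A - B) \<in> DR" using zsub_mul.IH by simp_all
      then show ?thesis by (intro DR_mult Zt_XS_DR[OF S B]) auto
    qed
    ultimately show ?thesis by (simp only:) (rule DR_sum)
  qed
  then show ?case using zsub_mul by simp
next
  case (zsub_add x y)
  then show ?case by (auto simp: Psi_add DR_add)
next
  case (zsub_scal c x)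
  then show ?case by (auto simp: Psi_scal intro!: DR_mult DR_const)
qed

section \<open>Root vectors on strings\<close>

lemma psi_single: "psi [a] {p} = mon a p"
  by simp

lemma Psi_fmul_gen:
  assumes "f \<in> Fin" "finite X"
  shows "Psi (fmul f (gen a)) X = (\<Sum>p\<in>X. mon a p * (\<Prod>q\<in>X - {p}. zt q p) * Psi f (X - {p}))"
proof -
  let ?g = "\<lambda>A. Psi f A * psi [a] (X - A) * Zt A (X - A)"
  have "Psi (fmul f (gen a)) X = (\<Sum>A\<in>Pow X. ?g A)"
    using assms by (simp add: Psi_fmul gen_eq_wd Psi_wd del: psi.simps)
  \<comment> \<open>The last letter takes exactly one point, so only complements of single points
    contribute.\<close>
  also have "\<dots> = (\<Sum>A\<in>(\<lambda>p. X - {p}) ` X. ?g A)"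
  proof (rule sum.mono_neutral_right)
    show "\<forall>A\<in>Pow X - (\<lambda>p. X - {p}) ` X. ?g A = 0"
    proof
      fix A assume A: "A \<in> Pow X - (\<lambda>p. X - {p}) ` X"
      have "psi [a] (X - A) = 0"
      proof (rule ccontr)
        assume "psi [a] (X - A) \<noteq> 0"
        then have "card (X - A) = 1" using psi_card[of "X - A" "[a]"] assms by simp
        then obtain p where p: "X - A = {p}" by (auto simp: card_1_singleton_iff)
        then have "A = X - {p}" "p \<in> X" using A by auto
        then show False using A by blast
      qed
      then show "?g A = 0" by (simp only: mult_zero_right mult_zero_left)
    qed
  qed (use assms in auto)
  also have "\<dots> = (\<Sum>p\<in>X. ?g (X - {p}))"
    by (subst sum.reindex) (auto simp: inj_on_def)
  also have "\<dots> = (\<Sum>p\<in>X. mon a p * (\<Prod>q\<in>X - {p}. zt q p) * Psi f (X - {p}))"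
  proof (rule sum.cong[OF refl])
    fix p assume "p \<in> X"
    then have "X - (X - {p}) = {p}" by auto
    then show "?g (X - {p}) = mon a p * (\<Prod>q\<in>X - {p}. zt q p) * Psi f (X - {p})"
      by (simp add: psi_single Zt_def mult_ac del: psi.simps)
  qed
  finally show ?thesis .
qed

lemma Psi_comm_gen:
  assumes "f \<in> Fin" "finite X"
  shows "Psi (comm f (gen a)) X =
    (\<Sum>p\<in>X. mon a p * ((\<Prod>q\<in>X - {p}. zt q p) - (\<Prod>q\<in>X - {p}. zt p q)) * Psi f (X - {p}))"
  using assms unfolding comm_def
  by (simp add: Psi_diff Psi_fmul_gen Psi_gen_fmul sum_subtractf[symmetric])
     (simp only: right_diff_distrib left_diff_distrib)

lemma root_vec_simple: "root_vec (i, i) r = gen (i, r)"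
  and root_vec_Suc: "i \<le> j \<Longrightarrow> root_vec (i, Suc j) r = comm (root_vec (i, j) r) (gen (Suc j, 0))"
  by simp_all

declare root_vec.simps [simp del]

text \<open>Each bracket consumes one further point, of the next colour, so exactly one point of
  each colour in the root is used.\<close>

lemma Psi_root_vec_support:
  "i \<le> j \<Longrightarrow> finite A \<Longrightarrow> Psi (root_vec (i, j) r) A \<noteq> 0 \<Longrightarrow> inj_on fst A \<and> fst ` A = {i..j}"
proof (induction j arbitrary: A rule: dec_induct)
  case base
  have p: "psi [(i, r)] A \<noteq> 0" using base by (simp only: root_vec_simple gen_eq_wd Psi_wd) simp
  then have "card A = 1" using psi_card[OF base(1) p] by simp
  then obtain p where A: "A = {p}" by (auto simp: card_1_singleton_iff)
  then show ?case using p unfolding A psi_single by (auto split: if_splits)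
next
  case (step k)
  have "Psi (comm (root_vec (i, k) r) (gen (Suc k, 0))) A \<noteq> 0"
    using step.prems step.hyps by (simp only: root_vec_Suc) simp
  then obtain p where p: "p \<in> A" and "mon (Suc k, 0) p * ((\<Prod>q\<in>A - {p}. zt q p) - (\<Prod>q\<in>A - {p}. zt p q)) *
      Psi (root_vec (i, k) r) (A - {p}) \<noteq> 0"
    unfolding Psi_comm_gen[OF Fin_root_vec step.prems(1)] by (rule sum.not_neutral_contains_not_neutral)
  then have c: "fst p = Suc k" and "Psi (root_vec (i, k) r) (A - {p}) \<noteq> 0" by (auto split: if_splits)
  then have IH: "inj_on fst (A - {p})" "fst ` (A - {p}) = {i..k}"
    using step.IH[of "A - {p}"] step.prems(1) by auto
  have A: "A = insert p (A - {p})" using p by auto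
  have "inj_on fst (insert p (A - {p}))" unfolding inj_on_insert using IH c by auto
  moreover have "fst ` insert p (A - {p}) = {i..Suc k}" 
    unfolding image_insert IH(2) c using step.hyps by auto
  ultimately show ?case using A by metis
qed

lemma str_Suc: "i \<le> Suc j \<Longrightarrow> str ((i, Suc j), M) = insert (spt M (Suc j)) (str ((i, j), M))"
  by (simp add: str_def atLeastAtMostSuc_conv)

lemma finite_str [simp]: "finite (str s)"
  by (simp add: str_def)

text \<open>The point of the new colour \<open>Suc k\<close> is determined. Placed last it meets the
  vanishing twist from colour \<open>k\<close>; placed first it gives 2 with colour \<open>k\<close>
  and 1 with the others. Each bracket thus contributes -2.\<close>

lemma Psi_root_vec_str:
  "i \<le> j \<Longrightarrow> Psi (root_vec (i, j) r) (str ((i, j), M)) = fls_const ((- 2) ^ (j - i)) * snd (spt M i) ^ r"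
proof (induction j rule: dec_induct)
  case base
  have "str ((i, i), M) = {spt M i}" by (simp add: str_def)
  then show ?case by (simp add: root_vec_simple gen_eq_wd Psi_wd)
next
  case (step k)
  let ?p = "spt M (Suc k)" and ?A = "str ((i, k), M)" and ?f = "root_vec (i, k) r"
  have col: "i \<le> fst q" "fst q \<le> k" "q = spt M (fst q)" if "q \<in> ?A" for q
    using that by (auto simp: str_def)
  have p: "?p \<notin> ?A" using col(2) by fastforce
  have X: "str ((i, Suc k), M) = insert ?p ?A" using step by (intro str_Suc) auto
  have k: "spt M k \<in> ?A" using step by (auto simp: str_def)
  have up: "(\<Prod>q\<in>?A. zt q ?p) = 0" using k zt_spt_up by (intro prod_zero) auto
  have "(\<Prod>q\<in>?A. zt ?p q) = zt ?p (spt M k) * (\<Prod>q\<in>?A - {spt M k}. zt ?p q)"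
    using k by (intro prod.remove) auto
  also have "(\<Prod>q\<in>?A - {spt M k}. zt ?p q) = 1"
  proof (intro prod.neutral ballI zt_far)
    fix q assume q: "q \<in> ?A - {spt M k}"
    then have "fst q \<noteq> k" using col(3)[of q] by auto
    then show "cartan (fst ?p) (fst q) = 0" using col(2)[of q] q by (auto simp: cartan_def)
  qed
  finally have down: "(\<Prod>q\<in>?A. zt ?p q) = fls_const 2" by (simp add: zt_spt_down)
  have z: "mon (Suc k, 0) q = 0" if "q \<in> ?A" for q using col(2)[OF that] by auto
  have "Psi (root_vec (i, Suc k) r) (insert ?p ?A) = mon (Suc k, 0) ?p *
      ((\<Prod>q\<in>insert ?p ?A - {?p}. zt q ?p) - (\<Prod>q\<in>insert ?p ?A - {?p}. zt ?p q)) * Psi ?f (insert ?p ?A - {?p})"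
    using step p unfolding root_vec_Suc[OF step(1)] Psi_comm_gen[OF Fin_root_vec finite.insertI[OF finite_str]]
    by (subst sum.insert) (auto simp only: finite_str z mult_zero_left sum.neutral_const add_0_right cong: sum.cong)
  also have "insert ?p ?A - {?p} = ?A" using p by auto
  also have "mon (Suc k, 0) ?p * ((\<Prod>q\<in>?A. zt q ?p) - (\<Prod>q\<in>?A. zt ?p q)) * Psi ?f ?A =
      - fls_const 2 * (fls_const ((- 2) ^ (k - i)) * snd (spt M i) ^ r)"
    unfolding up down step.IH by (simp del: fls_const_mult_const)
  also have "\<dots> = fls_const ((- 2) ^ (Suc k - i)) * snd (spt M i) ^ r"
  proof -
    have "- fls_const 2 * fls_const ((- 2) ^ (k - i)) = fls_const ((- 2) ^ (Suc k - i) :: complex)"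
      using step.hyps by (simp add: Suc_diff_le del: fls_const_numeral flip: fls_const_uminus)
    then show ?thesis by (simp only: mult.assoc[symmetric])
  qed
  finally show ?case unfolding X .
qed

section \<open>Ordered monomials on unions of strings\<close>

fun PF :: "((nat \<times> nat) \<times> nat) list \<Rightarrow> falg" where
  "PF [] = fone"
| "PF (p # L) = fmul (root_vec (fst p) (snd p)) (PF L)"

lemma Fin_PF [simp]: "PF L \<in> Fin"
  by (induction L) auto

lemma Psi_PF_Cons:
  "finite X \<Longrightarrow> Psi (PF (g # L)) X =
    (\<Sum>A\<in>Pow X. Psi (root_vec (fst g) (snd g)) A * Psi (PF L) (X - A) * Zt A (X - A))"
  by (simp add: Psi_fmul)

lemma Psi_PF_nonzeroE:
  assumes "Psi (PF (g # L)) X \<noteq> 0" "finite X"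
  obtains A where "A \<subseteq> X" "Psi (root_vec (fst g) (snd g)) A \<noteq> 0" "Psi (PF L) (X - A) \<noteq> 0" "Zt A (X - A) \<noteq> 0"
proof -
  from assms(1) obtain A where "A \<in> Pow X"
    "Psi (root_vec (fst g) (snd g)) A * Psi (PF L) (X - A) * Zt A (X - A) \<noteq> 0"
    unfolding Psi_PF_Cons[OF assms(2)] by (rule sum.not_neutral_contains_not_neutral)
  then show ?thesis by (intro that[of A]) auto
qed

text \<open>Every point is consumed by a factor whose root contains its colour. This rules out
  strings that begin below all remaining roots.\<close>

lemma Psi_PF_colours:
  "finite X \<Longrightarrow> pvalid L \<Longrightarrow> Psi (PF L) X \<noteq> 0 \<Longrightarrow> q \<in> X \<Longrightarrow> \<exists>g\<in>set L. fst (fst g) \<le> fst q"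
proof (induction L arbitrary: X)
  case Nil
  then show ?case by (simp add: fone_eq_wd Psi_wd split: if_splits)
next
  case (Cons g L)
  obtain A where A: "A \<subseteq> X" "Psi (root_vec (fst g) (snd g)) A \<noteq> 0" "Psi (PF L) (X - A) \<noteq> 0"
    using Psi_PF_nonzeroE[OF Cons.prems(3,1)] by blast
  show ?case
  proof (cases "q \<in> A")
    case True
    have "finite A" using A(1) Cons.prems(1) by (rule finite_subset)
    then have "fst ` A = {fst (fst g)..snd (fst g)}"
      using Psi_root_vec_support[of "fst (fst g)" "snd (fst g)" A "snd g"] A(2) Cons.prems(2) by simp
    then have "fst q \<in> {fst (fst g)..snd (fst g)}" using True by blast
    then show ?thesis by auto
  next
    case False
    then have "\<exists>g\<in>set L. fst (fst g) \<le> fst q"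
      using Cons.prems A(3) by (intro Cons.IH[of "X - A"]) auto
    then show ?thesis by auto
  qed
qed

text \<open>The factor \<open>zt\<close> vanishes from colour \<open>k\<close> to colour \<open>k + 1\<close> of one string, so a set of points
  with a non-zero contribution contains the upper part of every string that it meets.\<close>

lemma first_factor_contains_string:
  assumes S: "sgood S" and A: "A \<subseteq> XS S" and ij: "i \<le> j" and L: "pvalid L"
    and start: "\<And>g. g \<in> set L \<Longrightarrow> i \<le> fst (fst g)"
    and nz: "Psi (root_vec (i, j) r) A \<noteq> 0" "Psi (PF L) (XS S - A) \<noteq> 0" "Zt A (XS S - A) \<noteq> 0"
  obtains s where "s \<in> set S" "fst s \<le> (i, j)" "fst s = (i, j) \<Longrightarrow> A = str s"
proof -
  have fA: "finite A" using A finite_XS by (rule finite_subset)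
  have sup: "inj_on fst A" "fst ` A = {i..j}" using Psi_root_vec_support[OF ij fA nz(1)] by auto
  then obtain q where q: "q \<in> A" "fst q = i" using ij by (metis atLeastAtMost_iff imageE order_refl)
  from q(1) A have "q \<in> XS S" by auto
  then obtain s k where s: "s \<in> set S" "q = spt (snd s) k" "fst (fst s) \<le> k" "k \<le> snd (fst s)"
    using S by (rule spt_cases) blast
  let ?a = "fst (fst s)" and ?b = "snd (fst s)" and ?M = "snd s"
  have k: "k = i" using s(2) q(2) by simp
  have mem: "spt ?M l \<in> XS S" if "?a \<le> l" "l \<le> ?b" for l
    unfolding XS_def str_def using that s(1) by (intro UN_I[of s] imageI) auto
  \<comment> \<open>If the string began below \<open>i\<close>, its first point could not lie in
    \<open>A\<close> and would be left to factors whose roots all begin at \<open>i\<close> or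
    later.\<close>
  have "i \<le> ?a"
  proof (cases "spt ?M ?a \<in> A")
    case True
    then have "fst (spt ?M ?a) \<in> {i..j}" using sup(2) by blast
    then show ?thesis by simp
  next
    case False
    then have "spt ?M ?a \<in> XS S - A" using mem[of ?a] s(3,4) by auto
    from Psi_PF_colours[OF finite_Diff[OF finite_XS] L nz(2) this]
    obtain g where "g \<in> set L" "fst (fst g) \<le> fst (spt ?M ?a)" by blast
    then show ?thesis using start by fastforce
  qed
  then have a: "?a = i" using s(3) k by simp
  have up: "spt ?M l \<in> A" if "i \<le> l" "l \<le> ?b" for l
    using that
  proof (induction l rule: dec_induct)
    case base
    show ?case using q s(2) k by simp
  next
    case (step m)
    then have m: "spt ?M m \<in> A" by simp
    show ?case
    proof (rule ccontr)
      assume "spt ?M (Suc m) \<notin> A"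
      then have "spt ?M (Suc m) \<in> XS S - A" using mem[of "Suc m"] step a by auto
      then have "(\<Prod>q\<in>XS S - A. zt (spt ?M m) q) = 0"
        using zt_spt_up by (intro prod_zero) auto
      then have "Zt A (XS S - A) = 0" unfolding Zt_def using m fA by (intro prod_zero) auto
      then show False using nz(3) by simp
    qed
  qed
  then have sub: "str s \<subseteq> A" using a by (auto simp: str_def)
  have "spt ?M ?b \<in> A" using up s(4) k by simp
  then have "fst (spt ?M ?b) \<in> {i..j}" using sup(2) by blast
  then have b: "?b \<le> j" by simp
  have "fst s \<le> (i, j)" using a b by (cases "fst s") auto
  moreover have "A = str s" if "fst s = (i, j)"
  proof
    show "A \<subseteq> str s"
    proof
      fix p assume p: "p \<in> A"
      then have "fst p \<in> {i..j}" using sup(2) by blast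
      then have "spt ?M (fst p) \<in> str s" using that by (auto simp: str_def)
      moreover from this have "spt ?M (fst p) \<in> A" using sub by blast
      then have "p = spt ?M (fst p)" using sup(1) p by (auto dest!: inj_onD[of fst A p "spt ?M (fst p)"])
      ultimately show "p \<in> str s" by simp
    qed
  qed (rule sub)
  ultimately show ?thesis using that s(1) by blast
qed

lemma str_disjoint:
  assumes "sgood S" "s \<in> set S" "s' \<in> set S" "s \<noteq> s'"
  shows "str s \<inter> str s' = {}"
proof -
  have "snd s \<noteq> snd s'" using sgood_inj[OF assms(1-3)] assms(4) by auto
  moreover have "0 < snd s" "0 < snd s'" using assms by (auto simp: sgood_def)
  ultimately have "spt (snd s) k \<noteq> spt (snd s') k'" for k k'
    using snd_spt_eq_iff[of "snd s" "snd s'" k k'] by auto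
  then show ?thesis unfolding str_def by blast
qed

lemma sgood_remove1: "sgood S \<Longrightarrow> sgood (remove1 s S)"
  using set_remove1_subset[of s S] unfolding sgood_def pvalid_def distinct_map
  by (blast intro: inj_on_subset distinct_remove1)

lemma XS_remove1:
  assumes "sgood S" "s \<in> set S"
  shows "XS S - str s = XS (remove1 s S)"
proof -
  have "distinct S" using assms(1) by (auto simp: sgood_def distinct_map)
  then have "set (remove1 s S) = set S - {s}" by (rule set_remove1_eq)
  then show ?thesis using str_disjoint[OF assms] assms(2) unfolding XS_def by fastforce
qed

lemma str_nonempty: "sgood S \<Longrightarrow> s \<in> set S \<Longrightarrow> str s \<noteq> {}"
  by (auto simp: sgood_def pvalid_def str_def)

lemma psorted_nth:
  assumes "psorted K" "a \<le> b" "b < length K"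
  shows "fst (K ! a) \<le> fst (K ! b)" "fst (K ! a) = fst (K ! b) \<Longrightarrow> snd (K ! b) \<le> snd (K ! a)"
proof -
  have "pkey (K ! a) \<le> pkey (K ! b)"
    using sorted_nth_mono[of "map pkey K" a b] assms by (simp add: psorted_def)
  then have "fst (K ! a) < fst (K ! b) \<or> fst (K ! a) \<le> fst (K ! b) \<and> snd (K ! b) \<le> snd (K ! a)"
    unfolding less_eq_prod_def[of "pkey (K ! a)" "pkey (K ! b)"] by simp
  then show "fst (K ! a) \<le> fst (K ! b)" "fst (K ! a) = fst (K ! b) \<Longrightarrow> snd (K ! b) \<le> snd (K ! a)"
    by auto
qed

lemma psorted_fst: "psorted K \<Longrightarrow> sorted (map fst K)"
  unfolding sorted_iff_nth_mono by (auto intro: psorted_nth)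

lemma psorted_ConsD: "psorted (g # L) \<Longrightarrow> psorted L"
  by (simp add: psorted_def)

lemma psorted_start: "psorted (g # L) \<Longrightarrow> h \<in> set L \<Longrightarrow> fst (fst g) \<le> fst (fst h)"
  using psorted_fst[of "g # L"] by (auto simp: less_eq_prod_def)

text \<open>The string actually consumed need not be the first in the list, but having the same root
  it leaves the same sorted list of roots.\<close>

lemma map_fst_remove1:
  assumes "sorted (map fst (s0 # S))" "s \<in> set (s0 # S)" "fst s = fst s0"
  shows "map fst (remove1 s (s0 # S)) = map fst S"
proof -
  have "sorted (map fst (remove1 s (s0 # S)))" using assms(1) by (rule sorted_map_remove1)
  moreover have "mset (map fst (remove1 s (s0 # S))) = mset (map fst S)"
    using assms(2,3) by (simp only: mset_map mset_remove1 image_mset_Diff in_multiset_in_set[symmetric]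
        subseteq_mset_def single_subset_iff) (simp add: image_mset_Diff)
  moreover have "sorted (map fst S)" using assms(1) by simp
  ultimately show ?thesis by (metis properties_for_sort)
qed

text \<open>In a non-zero contribution the first factor meets a string with root at most its own, so
  the smallest string root is at most the first root of \<open>L\<close>. If it is smaller, the
  lists compare at once; if equal, a whole string is removed and the induction goes on.\<close>

lemma Psi_PF_vanish:
  "sgood S \<Longrightarrow> sorted (map fst S) \<Longrightarrow> psorted L \<Longrightarrow> pvalid L \<Longrightarrow> Psi (PF L) (XS S) \<noteq> 0 \<Longrightarrow>
    map fst S \<le> map fst L"
proof (induction L arbitrary: S)
  case Nil
  then have "XS S = {}" by (simp add: fone_eq_wd Psi_wd split: if_splits)
  then have "S = []" using str_nonempty[OF Nil.prems(1)] by (cases S) (auto simp: XS_def)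
  then show ?case by simp
next
  case (Cons g L)
  obtain i j where g: "fst g = (i, j)" by (cases "fst g")
  obtain A where A: "A \<subseteq> XS S" "Psi (root_vec (i, j) (snd g)) A \<noteq> 0" "Psi (PF L) (XS S - A) \<noteq> 0"
    "Zt A (XS S - A) \<noteq> 0"
    using Psi_PF_nonzeroE[OF Cons.prems(5) finite_XS] unfolding g by blast
  obtain s where s: "s \<in> set S" "fst s \<le> (i, j)" "fst s = (i, j) \<Longrightarrow> A = str s"
    by (rule first_factor_contains_string[OF Cons.prems(1) A(1) _ _ _ A(2-4)])
       (use Cons.prems g psorted_start[of g L] in auto)
  obtain s0 S' where S: "S = s0 # S'" using s(1) by (cases S) auto
  have "fst s0 \<le> fst s" using Cons.prems(2) s(1) unfolding S by auto
  then consider "fst s0 < (i, j)" | "fst s0 = (i, j)" "fst s = (i, j)"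
    using s(2) by (metis order.trans order_le_imp_less_or_eq order_antisym)
  then show ?case
  proof cases
    case 1
    then show ?thesis using g unfolding S by simp
  next
    case 2
    have "Psi (PF L) (XS (remove1 s S)) \<noteq> 0"
      using A(3) s(3)[OF 2(2)] XS_remove1[OF Cons.prems(1) s(1)] by simp
    then have "map fst (remove1 s S) \<le> map fst L"
      using Cons.prems by (intro Cons.IH sgood_remove1 sorted_map_remove1 psorted_ConsD[of g L]) auto
    moreover have "map fst (remove1 s S) = map fst S'"
      using map_fst_remove1[of s0 S' s] Cons.prems(2) s(1) 2 unfolding S by simp
    ultimately show ?thesis using 2 g unfolding S by simp
  qed
qed

section \<open>Leading terms of ordered monomials\<close>

text \<open>The pole order of a product of powers with exponents \<open>rs\<close> of points whose
  pole orders are \<open>Ms\<close>.\<close>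

definition val :: "nat list \<Rightarrow> nat list \<Rightarrow> nat" where
  "val rs Ms = sum_list (map2 (*) rs Ms)"

lemma val_Nil [simp]: "val [] Ms = 0" and val_Cons [simp]: "val (r # rs) (M # Ms) = r * M + val rs Ms"
  by (simp_all add: val_def)

text \<open>One step of the rearrangement inequality: the first level is paired with the
  \<open>p\<close>-th exponent, the others keep their order. Nothing is lost exactly when the levels
  up to position \<open>p\<close> are all equal, which for weakly decreasing levels is an equality
  of the first and the \<open>p\<close>-th.\<close>

lemma val_delete:
  "length Ms = Suc (length rs) \<Longrightarrow> sorted_wrt (>) Ms \<Longrightarrow> p < length Ms \<Longrightarrow>
   (\<And>a. a < p \<Longrightarrow> (r # rs) ! Suc a \<le> (r # rs) ! a) \<Longrightarrow>
   r * Ms ! p + val rs (take p Ms @ drop (Suc p) Ms) \<le> val (r # rs) Ms \<and>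
   (r * Ms ! p + val rs (take p Ms @ drop (Suc p) Ms) = val (r # rs) Ms \<longleftrightarrow> (r # rs) ! p = r) \<and>
   (r # rs) ! p \<le> r"
proof (induction p arbitrary: r rs Ms)
  case 0
  then show ?case by (cases Ms) auto
next
  case (Suc p)
  obtain M Ms' where Ms: "Ms = M # Ms'" using Suc.prems(1) by (cases Ms) auto
  obtain r1 rs' where rs: "rs = r1 # rs'" using Suc.prems(1,3) unfolding Ms by (cases rs) auto
  let ?m = "Ms' ! p" and ?w = "val rs' (take p Ms' @ drop (Suc p) Ms')"
  have IH: "r1 * ?m + ?w \<le> val (r1 # rs') Ms'"
    "r1 * ?m + ?w = val (r1 # rs') Ms' \<longleftrightarrow> (r1 # rs') ! p = r1" "(r1 # rs') ! p \<le> r1"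
  proof -
    have "(r1 # rs') ! Suc a \<le> (r1 # rs') ! a" if "a < p" for a
      using Suc.prems(4)[of "Suc a"] that unfolding rs by simp
    then show "r1 * ?m + ?w \<le> val (r1 # rs') Ms'"
      "r1 * ?m + ?w = val (r1 # rs') Ms' \<longleftrightarrow> (r1 # rs') ! p = r1" "(r1 # rs') ! p \<le> r1"
      using Suc.IH[of Ms' rs' r1] Suc.prems unfolding Ms rs by auto
  qed
  have "r1 \<le> r" using Suc.prems(4)[of 0] unfolding rs by simp
  then obtain c where c: "r = r1 + c" using le_Suc_ex by blast
  have "?m < M" using Suc.prems unfolding Ms by auto
  then obtain d where d: "M = Suc (?m + d)" using less_imp_Suc_add by blast
  \<comment> \<open>The loss has two parts: \<open>c * Suc d\<close> from exchanging the exponents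
    of the first two levels, and the loss in the tail.\<close>
  have e: "val (r # rs) Ms = r * ?m + (r1 * M + val rs' (take p Ms' @ drop (Suc p) Ms')) +
      (c * Suc d + (val (r1 # rs') Ms' - (r1 * ?m + ?w)))"
  proof -
    have "val (r1 # rs') Ms' = (r1 * ?m + ?w) + (val (r1 # rs') Ms' - (r1 * ?m + ?w))" using IH(1) by simp
    moreover have "r * M + (r1 * ?m + ?w) = r * ?m + (r1 * M + ?w) + c * Suc d"
      unfolding c by (subst (1 2) d) (simp add: algebra_simps)
    ultimately show ?thesis unfolding Ms rs val_Cons[of r] by linarith
  qed
  have l: "r * Ms ! Suc p + val rs (take (Suc p) Ms @ drop (Suc (Suc p)) Ms) =
      r * ?m + (r1 * M + val rs' (take p Ms' @ drop (Suc p) Ms'))"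
    unfolding Ms rs by simp
  have "(r # rs) ! Suc p = r \<longleftrightarrow> c = 0 \<and> (r1 # rs') ! p = r1"
    unfolding rs c using IH(3) by auto
  then show ?case unfolding e l using IH c unfolding rs by auto
qed

text \<open>The product of the factorials of the multiplicities, arranged so that each step counts
  the choices open to the first factor in \<open>Psi_PF_lead\<close>.\<close>

fun cf :: "((nat \<times> nat) \<times> nat) list \<Rightarrow> nat" where
  "cf [] = 1"
| "cf (x # L) = count_list (x # L) x * cf L"

definition cst :: "((nat \<times> nat) \<times> nat) list \<Rightarrow> complex" where
  "cst L = prod_list (map (\<lambda>g. (- 2) ^ (snd (fst g) - fst (fst g))) L)"

lemma cst_simps [simp]: "cst [] = 1"
  "cst (g # L) = (- 2) ^ (snd (fst g) - fst (fst g)) * cst L"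
  by (simp_all add: cst_def)

lemma remove1_nth: "distinct S \<Longrightarrow> p < length S \<Longrightarrow> remove1 (S ! p) S = take p S @ drop (Suc p) S"
proof (induction S arbitrary: p)
  case (Cons s S)
  then show ?case by (cases p) auto
qed simp

text \<open>The first factor takes a whole string with its own root. By \<open>val_delete\<close>
  the maximal pole order survives exactly if the factor in that position equals \<open>g\<close>,
  which happens \<open>count_list (g # L) g\<close> times; the remaining strings are handled by
  induction.\<close>

lemma Psi_PF_lead:
  "sgood S \<Longrightarrow> sorted_wrt (>) (map snd S) \<Longrightarrow> map fst S = map fst L \<Longrightarrow> psorted L \<Longrightarrow> pvalid L \<Longrightarrow>
    lead (- int (val (map snd L) (map snd S))) (cst L * of_nat (cf L)) (Psi (PF L) (XS S))"
proof (induction L arbitrary: S)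
  case Nil
  then show ?case by (simp add: XS_def fone_eq_wd Psi_wd lead_1)
next
  case (Cons g L)
  obtain i j where g: "fst g = (i, j)" by (cases "fst g")
  define r where "r = snd g"
  have ij: "i \<le> j" and vL: "pvalid L" and sL: "psorted L"
    using Cons.prems g by (auto dest: psorted_ConsD)
  have len: "length S = Suc (length L)" using Cons.prems(3) by (metis length_Cons length_map)
  have fS: "fst (S ! p) = fst ((g # L) ! p)" if "p < length S" for p
    using that Cons.prems(3) by (metis length_map nth_map)
  have dS: "distinct S" using Cons.prems(1) by (auto simp: sgood_def distinct_map)
  have sS: "sorted (map fst S)" using Cons.prems(3,4) by (simp only: psorted_fst)
  define T where "T A = Psi (root_vec (i, j) r) A * Psi (PF L) (XS S - A) * Zt A (XS S - A)" for A
  define I where "I = {p. p < length S \<and> fst (S ! p) = (i, j)}"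
  have fI: "finite I" by (simp add: I_def)
  let ?s = "\<lambda>p. str (S ! p)"
  have inj: "inj_on ?s I"
  proof (rule inj_onI, rule ccontr)
    fix p q assume pq: "p \<in> I" "q \<in> I" "?s p = ?s q" "p \<noteq> q"
    then have "S ! p \<noteq> S ! q" using dS by (auto simp: I_def nth_eq_iff_index_eq)
    then have "?s p \<inter> ?s q = {}" using pq by (intro str_disjoint[OF Cons.prems(1)]) (auto simp: I_def)
    moreover have "?s p \<noteq> {}" using pq by (intro str_nonempty[OF Cons.prems(1)]) (auto simp: I_def)
    ultimately show False using pq(3) by simp
  qed
  have supp: "A \<in> ?s ` I" if A: "A \<subseteq> XS S" "T A \<noteq> 0" for A
  proof -
    have nz: "Psi (root_vec (i, j) r) A \<noteq> 0" "Psi (PF L) (XS S - A) \<noteq> 0" "Zt A (XS S - A) \<noteq> 0"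
      using A(2) by (auto simp: T_def)
    obtain s where s: "s \<in> set S" "fst s \<le> (i, j)" "fst s = (i, j) \<Longrightarrow> A = str s"
      by (rule first_factor_contains_string[OF Cons.prems(1) A(1) ij vL _ nz])
         (use Cons.prems(4) g psorted_start[of g L] in auto)
    then obtain p where p: "p < length S" "S ! p = s" by (auto simp: in_set_conv_nth)
    \<comment> \<open>The root of \<open>g\<close> is already the smallest among the strings, so the
      bound on the root of \<open>s\<close> is an equality.\<close>
    have "fst (S ! 0) \<le> fst (S ! p)" using sorted_nth_mono[OF sS, of 0 p] p len by simp
    then have "fst s = (i, j)" using s(2) fS[of 0] len g p(2) by auto
    then show ?thesis using s(3) p by (auto simp: I_def)
  qed
  have "Psi (PF (g # L)) (XS S) = (\<Sum>A\<in>Pow (XS S). T A)"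
    unfolding Psi_PF_Cons[OF finite_XS] g T_def r_def ..
  also have "\<dots> = (\<Sum>A\<in>?s ` I. T A)"
  proof (rule sum.mono_neutral_right)
    show "?s ` I \<subseteq> Pow (XS S)" unfolding I_def XS_def using nth_mem by blast
    show "\<forall>A\<in>Pow (XS S) - ?s ` I. T A = 0" using supp by blast
  qed simp
  also have "\<dots> = (\<Sum>p\<in>I. T (?s p))" using inj by (subst sum.reindex) auto
  finally have P: "Psi (PF (g # L)) (XS S) = (\<Sum>p\<in>I. T (?s p))" .
  define v C where "v = val (map snd (g # L)) (map snd S)" and "C = cst (g # L) * of_nat (cf L)"
  \<comment> \<open>The value 0 stands for the strings in positions of lower level, whose
    contribution has a smaller pole.\<close>
  have t: "lead (- int v) (if (g # L) ! p = g then C else 0) (T (?s p))" if "p \<in> I" for p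
  proof -
    have p: "p < length S" "fst (S ! p) = (i, j)" using that by (auto simp: I_def)
    define M where "M = snd (S ! p)"
    have sp: "S ! p \<in> set S" "S ! p = ((i, j), M)" using p by (auto simp: M_def prod_eq_iff)
    have M: "0 < M" using Cons.prems(1) sp by (auto simp: sgood_def)
    let ?S = "remove1 (S ! p) S"
    have rem: "?S = take p S @ drop (Suc p) S" using remove1_nth[OF dS p(1)] .
    have X: "XS S - ?s p = XS ?S" using XS_remove1[OF Cons.prems(1) sp(1)] .
    obtain s0 S' where S0: "S = s0 # S'" using len by (cases S) auto
    have "map fst ?S = map fst S'" unfolding S0
    proof (rule map_fst_remove1)
      show "sorted (map fst (s0 # S'))" using sS unfolding S0 .
      show "(s0 # S') ! p \<in> set (s0 # S')" using sp(1) unfolding S0 .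
      show "fst ((s0 # S') ! p) = fst s0" using p(2) Cons.prems(3) g unfolding S0 by simp
    qed
    also have "\<dots> = map fst L" using Cons.prems(3) unfolding S0 by simp
    finally have "lead (- int (val (map snd L) (map snd ?S))) (cst L * of_nat (cf L)) (Psi (PF L) (XS ?S))"
    proof (intro Cons.IH sgood_remove1 Cons.prems(1) sL vL)
      show "sorted_wrt (>) (map snd ?S)"
      proof -
        have "S = take p S @ S ! p # drop (Suc p) S" using p(1) by (rule id_take_nth_drop)
        then have "sorted_wrt (>) (map snd (take p S @ S ! p # drop (Suc p) S))" using Cons.prems(2) by simp
        then show ?thesis unfolding rem by (auto simp only: map_append list.map sorted_wrt_append sorted_wrt.simps list.set)
      qed
    qed
    note l1 = this
    have "lead (- int M) 1 (snd (spt M i))" using M by (auto simp: lead_def spt_def)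
    from lead_mult[OF lead_const lead_power[OF this, of r]]
    have l2: "lead (- int (r * M)) ((- 2) ^ (j - i)) (Psi (root_vec (i, j) r) (?s p))"
      unfolding sp(2) Psi_root_vec_str[OF ij] by simp
    have l3: "lead 0 1 (Zt (?s p) (XS ?S))"
      unfolding Zt_def
    proof (intro lead_prod)
      fix a b assume ab: "a \<in> ?s p" "b \<in> XS ?S"
      obtain s k where b: "s \<in> set ?S" "b = spt (snd s) k" "0 < snd s"
        using ab(2) sgood_remove1[OF Cons.prems(1)] by (rule spt_cases) blast
      have "s \<in> set S" "s \<noteq> S ! p" using b(1) dS by auto
      then have "snd s \<noteq> M" using sgood_inj[OF Cons.prems(1) _ sp(1), of s] by (auto simp: M_def)
      then show "lead 0 1 (zt a b)" using ab(1) b M unfolding sp(2)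
        by (auto simp: str_def intro!: zt_spt_lead)
    qed
    have l: "lead (- int (r * M + val (map snd L) (map snd ?S))) C (T (?s p))"
      using lead_mult[OF lead_mult[OF l2 l1] l3] g unfolding T_def X C_def by (simp add: algebra_simps)
    have Ms: "map snd S ! p = M" "map snd ?S = take p (map snd S) @ drop (Suc p) (map snd S)"
      using p by (simp_all add: M_def rem take_map drop_map)
    \<comment> \<open>Up to position \<open>p\<close> all roots coincide, because the list is sorted
      and its \<open>p\<close>-th root is that of \<open>g\<close>; there sortedness means
      decreasing levels.\<close>
    have dec: "(r # map snd L) ! Suc a \<le> (r # map snd L) ! a" if "a < p" for a
    proof -
      have b: "fst g \<le> fst ((g # L) ! a)" "fst ((g # L) ! a) \<le> fst ((g # L) ! Suc a)"
        "fst ((g # L) ! Suc a) \<le> fst ((g # L) ! p)"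
        using psorted_nth(1)[OF Cons.prems(4), of 0 a] psorted_nth(1)[OF Cons.prems(4), of a "Suc a"]
          psorted_nth(1)[OF Cons.prems(4), of "Suc a" p] that p(1) len by auto
      have "fst ((g # L) ! p) = fst g" using fS[OF p(1)] p(2) g by simp
      then have "fst ((g # L) ! a) = fst ((g # L) ! Suc a)" using b by order
      then have "snd ((g # L) ! Suc a) \<le> snd ((g # L) ! a)"
        using psorted_nth(2)[OF Cons.prems(4), of a "Suc a"] that p(1) len by simp
      moreover have "(r # map snd L) ! b = snd ((g # L) ! b)" if "b < Suc (length L)" for b
        using that nth_map[of b "g # L" snd] by (simp add: r_def)
      ultimately show ?thesis using that p(1) len by simp
    qed
    have vd: "r * M + val (map snd L) (map snd ?S) \<le> v"
      "r * M + val (map snd L) (map snd ?S) = v \<longleftrightarrow> (r # map snd L) ! p = r"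
      using val_delete[of "map snd S" "map snd L" p r] len Cons.prems(2) p(1) dec Ms
      unfolding v_def by (auto simp: r_def)
    have "(g # L) ! p = g \<longleftrightarrow> (r # map snd L) ! p = r"
    proof -
      have "(r # map snd L) ! p = snd ((g # L) ! p)"
        using nth_map[of p "g # L" snd] p(1) len by (simp add: r_def)
      moreover have "fst ((g # L) ! p) = fst g" using fS[OF p(1)] p(2) g by simp
      ultimately show ?thesis by (auto simp: r_def prod_eq_iff)
    qed
    note eq = this
    show ?thesis
    proof (cases "(g # L) ! p = g")
      case True
      then have "r * M + val (map snd L) (map snd ?S) = v" using vd(2) eq by simp
      then show ?thesis using l True by (simp only: if_True refl)
    next
      case False
      then have "r * M + val (map snd L) (map snd ?S) < v" using vd eq by linarith
      then have "- int v < - int (r * M + val (map snd L) (map snd ?S))" by linarith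
      from lead_less[OF l this] show ?thesis using False by simp
    qed
  qed
  have "lead (- int v) (\<Sum>p\<in>I. if (g # L) ! p = g then C else 0) (Psi (PF (g # L)) (XS S))"
    unfolding P by (rule lead_sum) (rule t)
  also have "(\<Sum>p\<in>I. if (g # L) ! p = g then C else 0) = (\<Sum>p\<in>{p \<in> I. (g # L) ! p = g}. C)"
    using fI by (subst sum.inter_filter[symmetric]) auto
  also have "{p \<in> I. (g # L) ! p = g} = {p. p < length (g # L) \<and> (g # L) ! p = g}"
    using fS g len by (auto simp: I_def)
  also have "(\<Sum>p\<in>\<dots>. C) = cst (g # L) * of_nat (cf (g # L))"
  proof -
    have "card {p. p < length (g # L) \<and> (g # L) ! p = g} = count_list (g # L) g"
      by (simp only: count_list_eq_length_filter length_filter_conv_card) (metis (mono_tags))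
    then show ?thesis by (simp add: C_def del: count_list.simps)
  qed
  finally show ?case unfolding v_def .
qed

section \<open>Detecting coefficients\<close>

text \<open>With these exponents \<open>val\<close> is \<open>B\<close> times the number with the
  levels as digits in base \<open>B\<close>, so it determines levels below \<open>B\<close>.\<close>

fun Mseq :: "nat \<Rightarrow> nat \<Rightarrow> nat list" where
  "Mseq B 0 = []"
| "Mseq B (Suc N) = B ^ Suc N # Mseq B N"

lemma length_Mseq [simp]: "length (Mseq B N) = N"
  by (induction N) auto

lemma Mseq_bound: "2 \<le> B \<Longrightarrow> M \<in> set (Mseq B N) \<Longrightarrow> 0 < M \<and> M \<le> B ^ N"
proof (induction N)
  case (Suc N)
  have 1: "B ^ N \<le> B ^ Suc N" "0 < B ^ Suc N" using Suc.prems by simp_all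
  have "M = B ^ Suc N \<or> M \<in> set (Mseq B N)" using Suc.prems(2) by simp
  then show ?case
  proof
    assume "M \<in> set (Mseq B N)"
    then show ?thesis using Suc.IH[OF Suc.prems(1)] 1 by linarith
  qed (use 1 in simp)
qed simp

lemma Mseq_sorted: "2 \<le> B \<Longrightarrow> sorted_wrt (>) (Mseq B N)"
proof (induction N)
  case (Suc N)
  have "B ^ N < B ^ Suc N" using Suc.prems by simp
  then have "M < B ^ Suc N" if "M \<in> set (Mseq B N)" for M
    using Mseq_bound[OF Suc.prems that] by linarith
  then show ?case using Suc by simp
qed simp

lemma sorted_wrt_irrefl_distinct: "sorted_wrt R xs \<Longrightarrow> (\<And>x. \<not> R x x) \<Longrightarrow> distinct xs"
  by (induction xs) auto

lemma val_Mseq_less: "\<forall>r\<in>set rs. r < B \<Longrightarrow> 0 < B \<Longrightarrow> val rs (Mseq B (length rs)) < B ^ Suc (length rs)"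
proof (induction rs)
  case (Cons r rs)
  let ?Q = "B ^ Suc (length rs)"
  have "r * ?Q + val rs (Mseq B (length rs)) < r * ?Q + ?Q" using Cons by simp
  also have "\<dots> = Suc r * ?Q" by simp
  also have "\<dots> \<le> B * ?Q" using Cons.prems by (intro mult_right_mono) auto
  finally show ?case by simp
qed simp

lemma val_Mseq_inj:
  "length rs = length rs' \<Longrightarrow> \<forall>r\<in>set rs. r < B \<Longrightarrow> \<forall>r\<in>set rs'. r < B \<Longrightarrow>
    val rs (Mseq B (length rs)) = val rs' (Mseq B (length rs)) \<Longrightarrow> rs = rs'"
proof (induction rs rs' rule: list_induct2)
  case (Cons r rs r' rs')
  let ?Q = "B ^ Suc (length rs)"
  have B: "0 < B" using Cons.prems by auto
  have v: "val rs (Mseq B (length rs)) < ?Q" "val rs' (Mseq B (length rs)) < ?Q"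
    using val_Mseq_less[of rs B] val_Mseq_less[of rs' B] Cons B by auto
  have e: "r * ?Q + val rs (Mseq B (length rs)) = r' * ?Q + val rs' (Mseq B (length rs))"
    using Cons.prems(3) by simp
  then have "(r * ?Q + val rs (Mseq B (length rs))) div ?Q = (r' * ?Q + val rs' (Mseq B (length rs))) div ?Q"
    by simp
  then have "r = r'" using v B by simp
  then show ?case using e Cons by simp
qed simp

text \<open>Used for \<open>dyadic\<close>, where it gives integrality of coefficients, and for
  \<open>{0}\<close>, where it gives linear independence.\<close>

definition dyadic_module :: "complex set \<Rightarrow> bool" where
  "dyadic_module D \<longleftrightarrow> 0 \<in> D \<and> (\<forall>x\<in>D. \<forall>y\<in>D. x - y \<in> D) \<and> (\<forall>a\<in>dyadic. \<forall>x\<in>D. a * x \<in> D)"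

lemma cst_nonzero: "cst L \<noteq> 0"
  by (induction L) auto

lemma inverse_cst_dyadic: "inverse (cst L) \<in> dyadic"
proof (induction L)
  case (Cons g L)
  have "inverse ((- 2) ^ k) \<in> dyadic" for k
    by (rule dyadicI[of _ "(- 1) ^ k" k]) (simp add: field_simps flip: power_mult_distrib)
  then show ?case using Cons by (simp add: dyadic_mult)
qed simp

lemma cf_pos: "0 < cf L"
proof (induction L)
  case (Cons x L)
  then show ?case by simp
qed simp

text \<open>Strings for the largest root list among \<open>Ls\<close> kill all monomials with
  another root list. Among the rest the base-\<open>B\<close> exponents give every monomial its own
  pole order, and the largest order isolates one coefficient; \<open>cf\<close> cancels the
  denominator.\<close>

lemma coefficient_of_dominant_term:
  fixes c :: "((nat \<times> nat) \<times> nat) list \<Rightarrow> complex"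
  assumes Ls: "finite Ls" "Ls \<noteq> {}" "\<And>L. L \<in> Ls \<Longrightarrow> pvalid L \<and> psorted L"
  obtains L S k where "L \<in> Ls" "sgood S"
    "(\<Sum>K\<in>Ls. fls_const (c K / of_nat (cf K)) * Psi (PF K) (XS S)) $$ k = c L * cst L"
proof -
  define \<gamma> where "\<gamma> = Max (map fst ` Ls)"
  have \<gamma>: "\<gamma> \<in> map fst ` Ls" "\<And>L. L \<in> Ls \<Longrightarrow> map fst L \<le> \<gamma>"
    using Ls by (auto simp: \<gamma>_def)
  define Ls' where "Ls' = {L \<in> Ls. map fst L = \<gamma>}"
  have Ls': "finite Ls'" "Ls' \<noteq> {}" using Ls \<gamma> by (auto simp: Ls'_def)
  \<comment> \<open>Larger than every level that occurs; adding 2 also guarantees a proper base when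
    all levels are 0.\<close>
  define B where "B = (\<Sum>L\<in>Ls. sum_list (map snd L)) + 2"
  have B: "2 \<le> B" "r < B" if "L \<in> Ls" "r \<in> set (map snd L)" for L r
  proof -
    have "r \<le> sum_list (map snd L)" using member_le_sum_list[OF that(2)] by simp
    also have "\<dots> \<le> (\<Sum>L\<in>Ls. sum_list (map snd L))" using that(1) Ls(1) by (intro member_le_sum) auto
    finally show "r < B" by (simp add: B_def)
  qed (simp add: B_def)
  have B2: "2 \<le> B" by (simp add: B_def)
  define N where "N = length \<gamma>"
  define S where "S = zip \<gamma> (Mseq B N)"
  have S: "map fst S = \<gamma>" "map snd S = Mseq B N" by (simp_all add: S_def N_def)
  obtain L0 where L0: "L0 \<in> Ls" "\<gamma> = map fst L0" using \<gamma>(1) by blast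
  have good: "sgood S"
    unfolding sgood_def
  proof (intro conjI ballI)
    show "distinct (map snd S)" unfolding S by (rule sorted_wrt_irrefl_distinct[OF Mseq_sorted[OF B2]]) simp
    show "0 < snd s" if "s \<in> set S" for s
    proof -
      have "snd s \<in> set (map snd S)" using that by auto
      then show ?thesis unfolding S using Mseq_bound[OF B2] by blast
    qed
    have "fst x \<le> snd x" if "x \<in> set \<gamma>" for x
      using that Ls(3)[OF L0(1)] unfolding L0(2) by (auto simp: pvalid_def)
    then show "pvalid S" unfolding pvalid_def S(1)[symmetric] by auto
  qed
  define v where "v L = val (map snd L) (Mseq B N)" for L :: "((nat \<times> nat) \<times> nat) list"
  have "Max (v ` Ls') \<in> v ` Ls'" using Ls' by (intro Max_in) auto
  then obtain L where L: "L \<in> Ls'" "v L = Max (v ` Ls')" by auto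
  have vmax: "v K < v L" if "K \<in> Ls'" "K \<noteq> L" for K
  proof -
    have "v K \<le> v L" using that Ls' L(2) by simp
    moreover have "v K \<noteq> v L"
    proof
      assume e: "v K = v L"
      have f: "map fst K = map fst L" "length K = N" "length L = N"
        using that L(1) by (auto simp: Ls'_def N_def dest: arg_cong[of _ _ length])
      have "map snd K = map snd L"
        by (rule val_Mseq_inj[of _ _ B])
           (use e f B(2) that L(1) in \<open>auto simp: v_def Ls'_def\<close>)
      then have "K = L" using f(1) by (metis zip_map_fst_snd)
      then show False using that by simp
    qed
    ultimately show ?thesis by simp
  qed
  have lead: "lead (- int (v K)) (cst K * of_nat (cf K)) (Psi (PF K) (XS S))" if "K \<in> Ls'" for K
    using Psi_PF_lead[OF good, of K] Mseq_sorted[OF B2, of N] Ls(3)[of K] that unfolding S v_def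
    by (auto simp: Ls'_def)
  have 1: "fls_const (c K / of_nat (cf K)) * Psi (PF K) (XS S) = 0" if "K \<in> Ls - Ls'" for K
  proof (rule ccontr)
    assume "\<not> ?thesis"
    then have "Psi (PF K) (XS S) \<noteq> 0" by auto
    then have "map fst S \<le> map fst K"
      using Ls(3)[of K] that psorted_fst[of L0] Ls(3)[OF L0(1)] L0(2)
      by (intro Psi_PF_vanish[OF good]) (auto simp: S)
    then have "map fst K = \<gamma>" using \<gamma>(2)[of K] that S by auto
    then show False using that by (auto simp: Ls'_def)
  qed
  have "lead (- int (v L)) (\<Sum>K\<in>Ls'. if K = L then c L * cst L else 0)
      (\<Sum>K\<in>Ls'. fls_const (c K / of_nat (cf K)) * Psi (PF K) (XS S))"
  proof (rule lead_sum)
    fix K assume K: "K \<in> Ls'"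
    have "lead (- int (v K)) (c K / of_nat (cf K) * (cst K * of_nat (cf K)))
        (fls_const (c K / of_nat (cf K)) * Psi (PF K) (XS S))"
      using lead_mult[OF lead_const lead[OF K], of "c K / of_nat (cf K)"] by simp
    moreover have "c K / of_nat (cf K) * (cst K * of_nat (cf K)) = c K * cst K" using cf_pos[of K] by simp
    ultimately have l: "lead (- int (v K)) (c K * cst K) (fls_const (c K / of_nat (cf K)) * Psi (PF K) (XS S))"
      by simp
    show "lead (- int (v L)) (if K = L then c L * cst L else 0)
        (fls_const (c K / of_nat (cf K)) * Psi (PF K) (XS S))"
    proof (cases "K = L")
      case False
      then have "- int (v L) < - int (v K)" using vmax[OF K] by simp
      from lead_less[OF l this] show ?thesis using False by simp
    qed (use l in simp)
  qed
  also have "(\<Sum>K\<in>Ls'. if K = L then c L * cst L else 0) = c L * cst L" using L(1) Ls' by simp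
  also have "(\<Sum>K\<in>Ls'. fls_const (c K / of_nat (cf K)) * Psi (PF K) (XS S)) =
      (\<Sum>K\<in>Ls. fls_const (c K / of_nat (cf K)) * Psi (PF K) (XS S))"
    using Ls(1) 1 by (intro sum.mono_neutral_left) (auto simp: Ls'_def)
  finally show ?thesis using L(1) good by (intro that[of L S "- int (v L)"]) (auto simp: lead_def Ls'_def)
qed

text \<open>Once the dominant coefficient is known to lie in \<open>D\<close>, its term can be
  subtracted: the normalized monomials have dyadic values, so the remaining sums keep their
  coefficients in \<open>D\<close>.\<close>

lemma coefficients_in_module:
  fixes c :: "((nat \<times> nat) \<times> nat) list \<Rightarrow> complex"
  assumes D: "dyadic_module D"
  shows "finite Ls \<Longrightarrow> (\<And>L. L \<in> Ls \<Longrightarrow> pvalid L \<and> psorted L) \<Longrightarrow>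
    (\<And>L S. L \<in> Ls \<Longrightarrow> sgood S \<Longrightarrow> fls_const (1 / of_nat (cf L)) * Psi (PF L) (XS S) \<in> DR) \<Longrightarrow>
    (\<And>S k. sgood S \<Longrightarrow> (\<Sum>L\<in>Ls. fls_const (c L / of_nat (cf L)) * Psi (PF L) (XS S)) $$ k \<in> D) \<Longrightarrow>
    L \<in> Ls \<Longrightarrow> c L \<in> D"
proof (induction "card Ls" arbitrary: Ls)
  case 0
  then show ?case by simp
next
  case (Suc m)
  have "Ls \<noteq> {}" using Suc.hyps(2) by auto
  from Suc.prems(1) this Suc.prems(2) obtain K S k where K: "K \<in> Ls" "sgood S"
    "(\<Sum>K\<in>Ls. fls_const (c K / of_nat (cf K)) * Psi (PF K) (XS S)) $$ k = c K * cst K"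
    by (rule coefficient_of_dominant_term[where c = c])
  have D_scal: "a * x \<in> D" if "a \<in> dyadic" "x \<in> D" for a x using D that by (simp add: dyadic_module_def)
  have D_diff: "x - y \<in> D" if "x \<in> D" "y \<in> D" for x y using D that by (simp add: dyadic_module_def)
  have "c K * cst K \<in> D" using Suc.prems(4)[OF K(2), of k] K(3) by simp
  \<comment> \<open>\<open>cst K\<close> is a power of -2, hence a unit in
    \<open>dyadic\<close>.\<close>
  then have "inverse (cst K) * (c K * cst K) \<in> D" by (rule D_scal[OF inverse_cst_dyadic])
  then have cK: "c K \<in> D" using cst_nonzero[of K] by (simp add: field_simps)
  have "(\<Sum>L\<in>Ls - {K}. fls_const (c L / of_nat (cf L)) * Psi (PF L) (XS S)) $$ k \<in> D" if "sgood S" for S k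
  proof -
    let ?t = "\<lambda>L. fls_const (c L / of_nat (cf L)) * Psi (PF L) (XS S)"
    have "?t K = fls_const (c K) * (fls_const (1 / of_nat (cf K)) * Psi (PF K) (XS S))"
      by (simp flip: mult.assoc)
    then have "?t K $$ k = (fls_const (1 / of_nat (cf K)) * Psi (PF K) (XS S)) $$ k * c K"
      by (simp only: fls_mult_const_nth mult.commute)
    moreover have "(fls_const (1 / of_nat (cf K)) * Psi (PF K) (XS S)) $$ k \<in> dyadic"
      using Suc.prems(3)[OF K(1) that] by (simp add: DR_def)
    ultimately have "?t K $$ k \<in> D" by (simp only: D_scal cK)
    moreover have "(\<Sum>L\<in>Ls - {K}. ?t L) $$ k = (\<Sum>L\<in>Ls. ?t L) $$ k - ?t K $$ k"
      using Suc.prems(1) K(1) by (simp add: sum.remove[of Ls K ?t])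
    ultimately show ?thesis using D_diff[OF Suc.prems(4)[OF that, of k]] by simp
  qed
  note rest = this
  show ?case
  proof (cases "L = K")
    case False
    show ?thesis
      by (rule Suc.hyps(1)[of "Ls - {K}"])
         (use Suc.hyps(2) Suc.prems K(1) rest False in auto)
  qed (use cK in simp)
qed

section \<open>Assembling the basis\<close>

lemma sorted_wrt_concat_map:
  "sorted_wrt P xs \<Longrightarrow> (\<And>x. x \<in> set xs \<Longrightarrow> sorted_wrt R (f x)) \<Longrightarrow>
    (\<And>x y a b. P x y \<Longrightarrow> a \<in> set (f x) \<Longrightarrow> b \<in> set (f y) \<Longrightarrow> R a b) \<Longrightarrow> sorted_wrt R (concat (map f xs))"
  by (induction xs) (auto simp: sorted_wrt_append)

lemma set_roots_list: "set (roots_list n) = posroots n"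
proof -
  have "(i, j) \<in> set (roots_list n) \<longleftrightarrow> 1 \<le> i \<and> i < n \<and> i \<le> j \<and> j < n" for i j
    by (auto simp: roots_list_def intro!: bexI[of _ i])
  then show ?thesis by (auto simp: posroots_def)
qed

lemma sorted_roots_list: "sorted_wrt (<) (roots_list n)"
  unfolding roots_list_def
  by (rule sorted_wrt_concat_map[where P = "(<)"]) (auto simp: sorted_wrt_map)

section \<open>Exponent functions and sorted lists\<close>

definition plist :: "nat \<Rightarrow> nat \<Rightarrow> ((nat \<times> nat) \<times> nat) list" where
  "plist n b = concat (map (\<lambda>\<beta>. map (Pair \<beta>) (rev [0..<b])) (roots_list n))"

lemma set_plist: "set (plist n b) = posroots n \<times> {..<b}"
  by (auto simp: plist_def set_roots_list)

lemma sorted_plist: "sorted_wrt (\<lambda>p q. pkey p < pkey q) (plist n b)"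
  unfolding plist_def
proof (rule sorted_wrt_concat_map[OF sorted_roots_list])
  show "sorted_wrt (\<lambda>p q. pkey p < pkey q) (map (Pair \<beta>) (rev [0..<b]))" for \<beta>
    by (simp add: sorted_wrt_map sorted_wrt_rev)
qed auto

definition mlist :: "((nat \<times> nat) \<times> nat \<Rightarrow> nat) \<Rightarrow> ((nat \<times> nat) \<times> nat) list \<Rightarrow> ((nat \<times> nat) \<times> nat) list" where
  "mlist h ps = concat (map (\<lambda>p. replicate (h p) p) ps)"

lemma mlist_simps [simp]: "mlist h [] = []" "mlist h (p # ps) = replicate (h p) p @ mlist h ps"
  by (simp_all add: mlist_def)

lemma set_mlist: "set (mlist h ps) = {p \<in> set ps. h p \<noteq> 0}"
  by (auto simp: mlist_def)

lemma sorted_mlist: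
  assumes "sorted_wrt (\<lambda>p q. pkey p < pkey q) ps"
  shows "psorted (mlist h ps)"
proof -
  have "sorted_wrt (\<lambda>p q. pkey p \<le> pkey q) (mlist h ps)"
    unfolding mlist_def
    by (rule sorted_wrt_concat_map[OF assms])
       (auto simp: sorted_wrt_iff_nth_less simp del: less_prod_simp less_eq_prod_simp split: if_splits)
  then show ?thesis by (simp add: psorted_def sorted_wrt_map)
qed

lemma count_mlist: "distinct ps \<Longrightarrow> count_list (mlist h ps) p = (if p \<in> set ps then h p else 0)"
proof (induction ps)
  case (Cons q ps)
  have "count_list (replicate k q) p = (if p = q then k else 0)" for k by (induction k) auto
  then show ?case using Cons by (auto simp: count_list_append)
qed simp

lemma cf_replicate: "p \<notin> set L \<Longrightarrow> cf (replicate k p @ L) = fact k * cf L"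
proof (induction k)
  case (Suc k)
  have "count_list (replicate k p) p = k" by (induction k) auto
  then have "count_list (p # replicate k p @ L) p = Suc k"
    using Suc.prems by (simp add: count_list_append)
  then show ?case using Suc by (simp add: algebra_simps del: count_list.simps)
qed simp

lemma fpow_fmul_PF: "PF (replicate k p @ L) = fmul (fpow (root_vec (fst p) (snd p)) k) (PF L)"
  by (induction k) (simp_all add: fpow_Suc fmul_assoc)

lemma foldr_divided_powers:
  "distinct ps \<Longrightarrow>
    foldr fmul (map (\<lambda>p. scal (1 / fact (h p)) (fpow (root_vec (fst p) (snd p)) (h p))) ps) fone =
    scal (1 / of_nat (cf (mlist h ps))) (PF (mlist h ps))"
proof (induction ps)
  case (Cons p ps)
  have "p \<notin> set (mlist h ps)" using Cons.prems by (simp add: set_mlist)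
  then show ?case using Cons
    by (simp add: fpow_fmul_PF cf_replicate fmul_scal_left fmul_scal_right scal_simps mult.commute)
qed (simp add: scal_simps)

text \<open>Inverse to \<open>count_list\<close> between exponent functions and sorted lists of
  valid roots; it translates between \<open>Eh\<close> and \<open>PF\<close>.\<close>

definition Lof :: "nat \<Rightarrow> ((nat \<times> nat) \<times> nat \<Rightarrow> nat) \<Rightarrow> ((nat \<times> nat) \<times> nat) list" where
  "Lof n h = mlist h (plist n (rbound h))"

lemma Eh_foldr: "Eh n h = foldr fmul
    (map (\<lambda>p. scal (1 / fact (h p)) (fpow (root_vec (fst p) (snd p)) (h p))) (plist n (rbound h))) fone"
  by (simp add: Eh_def plist_def map_concat comp_def)

lemma distinct_plist: "distinct (plist n b)"
  by (rule sorted_wrt_irrefl_distinct[OF sorted_plist]) simp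

lemma Eh_eq_PF: "Eh n h = scal (1 / of_nat (cf (Lof n h))) (PF (Lof n h))"
  unfolding Eh_foldr Lof_def by (rule foldr_divided_powers[OF distinct_plist])

lemma FS_in_plist:
  assumes h: "h \<in> FS n" "h p \<noteq> 0"
  shows "p \<in> set (plist n (rbound h))"
proof -
  obtain \<beta> r where p: "p = (\<beta>, r)" by (cases p)
  have "{r. \<exists>\<beta>. h (\<beta>, r) \<noteq> 0} = snd ` {p. h p \<noteq> 0}" by force
  then have "finite {r. \<exists>\<beta>. h (\<beta>, r) \<noteq> 0}" using h(1) by (simp add: FS_def)
  moreover have "r \<in> {r. \<exists>\<beta>. h (\<beta>, r) \<noteq> 0}" using h(2) unfolding p by blast
  ultimately have "r < rbound h" unfolding rbound_def using Max_ge less_Suc_eq_le by blast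
  moreover have "\<beta> \<in> posroots n" using h unfolding p FS_def by blast
  ultimately show ?thesis by (simp add: set_plist p)
qed

lemma count_Lof: "h \<in> FS n \<Longrightarrow> count_list (Lof n h) p = h p"
  using FS_in_plist[of h n p] by (auto simp: Lof_def count_mlist distinct_plist)

definition roots_in :: "nat \<Rightarrow> ((nat \<times> nat) \<times> nat) list \<Rightarrow> bool" where
  "roots_in n L \<longleftrightarrow> fst ` set L \<subseteq> posroots n"

lemma roots_in_pvalid: "roots_in n L \<Longrightarrow> pvalid L"
  by (force simp: roots_in_def pvalid_def posroots_def)

lemma Lof_props: "roots_in n (Lof n h)" "psorted (Lof n h)"
  by (auto simp: Lof_def roots_in_def set_mlist set_plist intro: sorted_mlist sorted_plist)

lemma psorted_unique:
  assumes "psorted L" "psorted L'" "\<And>p. count_list L p = count_list L' p"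
  shows "L = L'"
proof -
  have "mset L = mset L'" using assms(3) by (intro multiset_eqI) (simp add: count_mset)
  then have "mset (map pkey L) = mset (map pkey L')" by (simp only: mset_map)
  then have "sort (map pkey L') = map pkey L" using assms(1) unfolding psorted_def by (rule properties_for_sort)
  moreover have "sort (map pkey L') = map pkey L'"
    using assms(2) unfolding psorted_def by (rule sorted_sort_id)
  ultimately have "map pkey L = map pkey L'" by simp
  moreover have "inj pkey" by (auto intro!: injI simp: prod_eq_iff)
  ultimately show ?thesis by (simp add: inj_map_eq_map)
qed

lemma count_list_FS: "roots_in n L \<Longrightarrow> count_list L \<in> FS n"
proof -
  assume L: "roots_in n L"
  have "{p. count_list L p \<noteq> 0} = set L" by (auto simp: count_list_0_iff)
  moreover have "\<beta> \<in> posroots n" if "count_list L (\<beta>, r) \<noteq> 0" for \<beta> r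
  proof -
    have "(\<beta>, r) \<in> set L" using that by (simp add: count_list_0_iff)
    then show ?thesis using L unfolding roots_in_def by force
  qed
  moreover have "finite {p. count_list L p \<noteq> 0}" unfolding calculation(1) by simp
  ultimately show ?thesis unfolding FS_def by blast
qed

lemma Lof_count_list: "roots_in n L \<Longrightarrow> psorted L \<Longrightarrow> Lof n (count_list L) = L"
  by (rule psorted_unique[OF Lof_props(2)]) (simp_all add: count_Lof count_list_FS)

section \<open>Return from all colours to a fixed bound \<open>n\<close>\<close>

lemma res_root_vec:
  "i \<le> j \<Longrightarrow> res n (root_vec (i, j) r) = (if {i..j} \<subseteq> Iset n then root_vec (i, j) r else 0)"
proof (induction j rule: dec_induct)
  case base
  show ?case by (simp add: root_vec_simple res_gen)
next
  case (step k)
  have "{i..Suc k} = insert (Suc k) {i..k}" using step by auto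
  then show ?case using step by (simp add: root_vec_Suc res_comm res_gen)
qed

lemma posroots_iff: "i \<le> j \<Longrightarrow> (i, j) \<in> posroots n \<longleftrightarrow> {i..j} \<subseteq> Iset n"
  by (auto simp: posroots_def Iset_def atLeastAtMost_subseteq_atLeastLessThan_iff)

lemma res_PF: "pvalid L \<Longrightarrow> res n (PF L) = (if roots_in n L then PF L else 0)"
proof (induction L)
  case (Cons p L)
  obtain i j where p: "fst p = (i, j)" by (cases "fst p")
  have "i \<le> j" using Cons.prems p by simp
  then show ?case using Cons p
    by (auto simp: res_fmul res_root_vec posroots_iff[symmetric] roots_in_def)
qed (simp add: roots_in_def)

lemma cls_fpow: "f \<in> Fin \<Longrightarrow> cls (fpow f t) = cls f ^ t"
  by (induction t) (simp_all add: fpow_Suc cls_fmul cls_fone)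

lemma cls_divided_power: "f \<in> Fin \<Longrightarrow> cls (scal (1 / fact t) (fpow f t)) = YDv (cls f) t"
  by (simp add: cls_scal[of "fpow f t"] cls_fpow Y.Dv_def)

lemma cls_PF: "cls (PF L) = YPl L"
  by (induction L) (simp_all add: cls_fone cls_fmul cls_root_vec)

lemma cls_foldr_in_Zalg:
  "pvalid ps \<Longrightarrow>
    cls (foldr fmul (map (\<lambda>p. scal (1 / fact (h p)) (fpow (root_vec (fst p) (snd p)) (h p))) ps) fone) \<in> YZalg
    \<and> foldr fmul (map (\<lambda>p. scal (1 / fact (h p)) (fpow (root_vec (fst p) (snd p)) (h p))) ps) fone \<in> Fin"
proof (induction ps)
  case Nil
  then show ?case by (simp add: cls_fone Y.Zalg_one)
next
  case (Cons p ps)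
  obtain i j where p: "fst p = (i, j)" by (cases "fst p")
  have "YDv (Yrv (i, j) (snd p)) (h p) \<in> YZalg" using Cons.prems p by (intro Y.Zalg_Dv_rv) simp
  then show ?case using Cons p
    by (simp add: cls_fmul cls_divided_power cls_root_vec Y.Zalg_mult)
qed

lemma zsub_zero: "0 \<in> zsub n"
  using zsub_scal[OF dyadic_0 zsub_one] by (simp add: scal_simps)

text \<open>Elements of \<open>YZalg\<close> may involve colours outside \<open>Iset n\<close>, so
  only the restriction of a representative can be expected in \<open>zsub n\<close>.\<close>

lemma Zalg_lift: "y \<in> YZalg \<Longrightarrow> \<exists>f\<in>Fin. cls f = y \<and> res n f \<in> zsub n"
proof (induction rule: Y.Zalg.induct)
  case Zalg_one
  show ?case by (intro bexI[of _ fone]) (simp_all add: cls_fone zsub_one)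
next
  case (Zalg_gen i r t)
  let ?f = "scal (1 / fact t) (fpow (gen (i, r)) t)"
  have "res n ?f \<in> zsub n"
  proof (cases "i \<in> Iset n")
    case True
    have "?f \<in> divpow_gens n" using True unfolding divpow_gens_def by blast
    then show ?thesis using True by (simp add: res_scal res_fpow res_gen zsub_gen)
  next
    case False
    \<comment> \<open>A generator of a foreign colour restricts to 0, but its zeroth power is still
      the unit.\<close>
    have "fpow 0 t = (if t = 0 then fone else 0)" by (cases t) (simp_all add: fpow_Suc)
    then show ?thesis using False
      by (simp add: res_scal res_fpow res_gen scal_simps zsub_one zsub_zero)
  qed
  then show ?case by (intro bexI[of _ ?f]) (simp_all add: cls_divided_power)
next
  case (Zalg_mult x y)
  then obtain f g where "f \<in> Fin" "cls f = x" "res n f \<in> zsub n" "g \<in> Fin" "cls g = y" "res n g \<in> zsub n" by blast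
  then show ?case by (intro bexI[of _ "fmul f g"]) (simp_all add: cls_fmul res_fmul zsub_mul)
next
  case (Zalg_add x y)
  then obtain f g where "f \<in> Fin" "cls f = x" "res n f \<in> zsub n" "g \<in> Fin" "cls g = y" "res n g \<in> zsub n" by blast
  then show ?case by (intro bexI[of _ "f + g"]) (simp_all add: cls_add res_add zsub_add)
next
  case (Zalg_scal c x)
  then obtain f where "f \<in> Fin" "cls f = x" "res n f \<in> zsub n" by blast
  then show ?case using Zalg_scal(1)
    by (intro bexI[of _ "scal c f"]) (simp_all add: cls_scal[of f] res_scal zsub_scal)
qed

lemma Fin_Eh: "Eh n h \<in> Fin"
  by (simp add: Eh_eq_PF)

lemma Eh_in_zsub: "\<exists>a\<in>zsub n. Eh n h - a \<in> Jid n"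
proof -
  have "pvalid (plist n (rbound h))" by (auto simp: pvalid_def set_plist posroots_def)
  then have "cls (Eh n h) \<in> YZalg" unfolding Eh_foldr using cls_foldr_in_Zalg by blast
  then obtain f where f: "f \<in> Fin" "cls f = cls (Eh n h)" "res n f \<in> zsub n" using Zalg_lift by blast
  then have "res n (Eh n h - f) \<in> Jid n" using cls_eq_iff[OF Fin_Eh f(1)] by metis
  moreover have "res n (Eh n h) = Eh n h"
    using Lof_props(1)[of n h] by (simp add: Eh_eq_PF res_scal res_PF roots_in_pvalid)
  ultimately show ?thesis using f(3) by (auto simp: res_diff)
qed

text \<open>\<open>Eh\<close> is only congruent to an element of \<open>zsub n\<close>, but
  evaluation does not see elements of \<open>Jid n\<close>.\<close>

lemma Psi_Eh_DR:
  assumes "sgood S"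
  shows "Psi (Eh n h) (XS S) \<in> DR"
proof -
  obtain a where a: "a \<in> zsub n" "Eh n h - a \<in> Jid n" using Eh_in_zsub by blast
  have "a \<in> Fin" "Psi a (XS S) \<in> DR" using Psi_zsub_DR[OF assms a(1)] by auto
  moreover have "Psi (Eh n h - a) (XS S) = 0" using a(2) inj_snd_XS[OF assms] by (intro Psi_Jid) auto
  ultimately show ?thesis by (simp add: Psi_diff Fin_Eh)
qed

lemma cls_wd: "cls (wd w) = Yew w"
proof (induction w)
  case Nil
  show ?case by (simp add: Y.ew_def cls_fone flip: fone_eq_wd)
next
  case (Cons a w)
  have "wd (a # w) = fmul (gen a) (wd w)" by (simp add: gen_eq_wd fmul_wd)
  then show ?case using Cons by (cases a) (simp add: cls_fmul Y.ew_def)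
qed

lemma cls_in_Sp: "f \<in> Fin \<Longrightarrow> cls f \<in> YSp"
proof (induction rule: Fin_induct)
  case zero
  show ?case by (simp only: cls_zero) (rule Y.Sp_zero)
next
  case (word c w f)
  have "cls (scal c (wd w) + f) = cls (scal c fone) * Yew w + cls f"
    using word.hyps by (simp add: cls_add cls_scal[of "wd w"] cls_wd)
  also have "\<dots> \<in> YSp" using word.IH by (intro Y.Sp_add Y.Sp_scal Y.ew_in_Sp)
  finally show ?case .
qed

lemma Sp_expansion:
  "y \<in> YSp \<Longrightarrow> \<exists>Ls c. finite Ls \<and> (\<forall>L\<in>Ls. pvalid L \<and> psorted L) \<and> y = cls (\<Sum>L\<in>Ls. scal (c L) (PF L))"
proof (induction rule: Y.Sp.induct)
  case Sp_zero
  show ?case by (rule exI[of _ "{}"]) (simp add: cls_zero)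
next
  case (Sp_word K x a)
  then obtain Ls c where Ls: "finite Ls" "\<forall>L\<in>Ls. pvalid L \<and> psorted L" "x = cls (\<Sum>L\<in>Ls. scal (c L) (PF L))"
    by blast
  \<comment> \<open>\<open>K\<close> may already occur in \<open>Ls\<close>; its coefficients are
    then added.\<close>
  define d where "d = (\<lambda>L. (if L \<in> Ls then c L else 0) + (if L = K then a else 0))"
  have "(\<Sum>L\<in>insert K Ls. scal (d L) (PF L)) = (\<Sum>L\<in>insert K Ls. scal (if L \<in> Ls then c L else 0) (PF L)) +
      (\<Sum>L\<in>insert K Ls. scal (if L = K then a else 0) (PF L))"
    by (simp only: d_def scal_simps sum.distrib)
  also have "(\<Sum>L\<in>insert K Ls. scal (if L \<in> Ls then c L else 0) (PF L)) = (\<Sum>L\<in>Ls. scal (c L) (PF L))"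
    using Ls(1) by (intro sum.mono_neutral_cong_right) (auto simp: scal_simps)
  also have "(\<Sum>L\<in>insert K Ls. scal (if L = K then a else 0) (PF L)) = (\<Sum>L\<in>{K}. scal a (PF L))"
    using Ls(1) by (intro sum.mono_neutral_cong_right) (auto simp: scal_simps)
  finally have "cls (\<Sum>L\<in>insert K Ls. scal (d L) (PF L)) = cls (scal a fone) * YPl K + x"
    using Ls(3) by (simp add: cls_add cls_scal[of "PF K"] cls_PF add.commute)
  then show ?case using Ls Sp_word.hyps by (intro exI[of _ "insert K Ls"] exI[of _ d]) auto
qed

lemma zsub_fin_alg: "x \<in> zsub n \<Longrightarrow> x \<in> fin_alg n"
proof (induction rule: zsub.induct)
  case (zsub_gen x)
  then show ?case by (auto simp: divpow_gens_def fin_alg_iff res_scal res_fpow res_gen)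
qed (auto simp: fin_alg_iff res_add res_scal res_fmul)

lemma scal_Eh:
  assumes "roots_in n L" "psorted L"
  shows "scal (c * of_nat (cf L)) (Eh n (count_list L)) = scal c (PF L)"
  using cf_pos[of L] by (simp add: Eh_eq_PF Lof_count_list[OF assms] scal_simps)

lemma count_list_Lof: "h \<in> FS n \<Longrightarrow> count_list (Lof n h) = h"
  by (intro ext) (rule count_Lof)

lemma inj_Lof: "inj_on (Lof n) (FS n)"
  by (rule inj_on_inverseI[of _ count_list]) (rule count_list_Lof)

text \<open>Straightening happens in the ring for all colours. Applying \<open>res n\<close> fixes
  \<open>x\<close> and discards exactly the monomials with a root outside
  \<open>posroots n\<close>.\<close>

lemma PF_span:
  assumes x: "x \<in> zsub n"
  shows "\<exists>Ls c. finite Ls \<and> (\<forall>L\<in>Ls. roots_in n L \<and> psorted L) \<and>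
    x - (\<Sum>L\<in>Ls. scal (c L) (PF L)) \<in> Jid n"
proof -
  have xf: "x \<in> Fin" "res n x = x" using zsub_fin_alg[OF x] by (auto simp: fin_alg_iff)
  obtain Ls c where Ls: "finite Ls" "\<forall>L\<in>Ls. pvalid L \<and> psorted L" "cls x = cls (\<Sum>L\<in>Ls. scal (c L) (PF L))"
    using Sp_expansion[OF cls_in_Sp[OF xf(1)]] by blast
  have "res n (x - (\<Sum>L\<in>Ls. scal (c L) (PF L))) \<in> Jid n"
    using Ls(3) cls_eq_iff[of x "\<Sum>L\<in>Ls. scal (c L) (PF L)"] xf(1) by auto
  also have "res n (x - (\<Sum>L\<in>Ls. scal (c L) (PF L))) = x - (\<Sum>L\<in>Ls. scal (c L) (if roots_in n L then PF L else 0))"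
    unfolding res_diff res_sum xf(2) res_scal using Ls(2) by (simp add: res_PF cong: sum.cong)
  also have "(\<Sum>L\<in>Ls. scal (c L) (if roots_in n L then PF L else 0)) = (\<Sum>L\<in>{L \<in> Ls. roots_in n L}. scal (c L) (PF L))"
    using Ls(1) by (intro sum.mono_neutral_cong_right) (auto simp: scal_simps)
  finally have "x - (\<Sum>L\<in>{L \<in> Ls. roots_in n L}. scal (c L) (PF L)) \<in> Jid n" .
  moreover have "finite {L \<in> Ls. roots_in n L}" "\<forall>L\<in>{L \<in> Ls. roots_in n L}. roots_in n L \<and> psorted L"
    using Ls by auto
  ultimately show ?thesis by blast
qed

lemma dyadic_module_dyadic: "dyadic_module dyadic" and dyadic_module_zero: "dyadic_module {0}"
  by (simp_all add: dyadic_module_def)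

lemma Eh_coefficients_in_module:
  assumes D: "dyadic_module D" and Ls: "finite Ls" "\<And>L. L \<in> Ls \<Longrightarrow> roots_in n L \<and> psorted L"
    and sums: "\<And>S k. sgood S \<Longrightarrow> (\<Sum>L\<in>Ls. fls_const (c L / of_nat (cf L)) * Psi (PF L) (XS S)) $$ k \<in> D"
    and L: "L \<in> Ls"
  shows "c L \<in> D"
proof (rule coefficients_in_module[OF D Ls(1) _ _ sums L])
  show "pvalid L \<and> psorted L" if "L \<in> Ls" for L using Ls(2)[OF that] roots_in_pvalid by blast
  show "fls_const (1 / of_nat (cf L)) * Psi (PF L) (XS S) \<in> DR" if "L \<in> Ls" "sgood S" for L S
    using Psi_Eh_DR[OF that(2), of n "count_list L"] Ls(2)[OF that(1)]
    by (simp add: Eh_eq_PF Lof_count_list Psi_scal)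
qed

theorem theorem2p8:
  fixes n :: nat
  assumes "n \<ge> 2"
  shows "(\<forall>h\<in>FS n. \<exists>a\<in>zsub n. Eh n h - a \<in> Jid n)
       \<and> (\<forall>x\<in>zsub n. \<exists>H c. finite H \<and> H \<subseteq> FS n \<and> (\<forall>h\<in>H. c h \<in> dyadic)
              \<and> x - (\<Sum>h\<in>H. scal (c h) (Eh n h)) \<in> Jid n)
       \<and> (\<forall>H c. finite H \<and> H \<subseteq> FS n \<and> (\<forall>h\<in>H. c h \<in> dyadic)
              \<and> (\<Sum>h\<in>H. scal (c h) (Eh n h)) \<in> Jid n \<longrightarrow> (\<forall>h\<in>H. c h = 0))"
proof (intro conjI ballI allI impI)
  show "\<exists>a\<in>zsub n. Eh n h - a \<in> Jid n" for h by (rule Eh_in_zsub)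
next
  fix x assume x: "x \<in> zsub n"
  obtain Ls c where fin: "finite Ls" and srt: "\<forall>L\<in>Ls. roots_in n L \<and> psorted L"
    and J: "x - (\<Sum>L\<in>Ls. scal (c L) (PF L)) \<in> Jid n"
    using PF_span[OF x] by (elim exE conjE)
  note Ls = fin bspec[OF srt]
  \<comment> \<open>The coefficients \<open>c L\<close> are complex numbers so far. The coefficient
    of the divided-power monomial is \<open>c L * of_nat (cf L)\<close>, and this is the number to
    be shown dyadic.\<close>
  have "c L * of_nat (cf L) \<in> dyadic" if "L \<in> Ls" for L
  proof (rule Eh_coefficients_in_module[OF dyadic_module_dyadic Ls _ that])
    fix S k assume S: "sgood S"
    have "Psi (x - (\<Sum>L\<in>Ls. scal (c L) (PF L))) (XS S) = 0"
      using J inj_snd_XS[OF S] by (intro Psi_Jid) auto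
    moreover have "x \<in> Fin" "Psi x (XS S) \<in> DR" using Psi_zsub_DR[OF S x] by auto
    ultimately have "(\<Sum>L\<in>Ls. fls_const (c L) * Psi (PF L) (XS S)) \<in> DR"
      by (simp add: Psi_diff Psi_sum Psi_scal)
    then show "(\<Sum>L\<in>Ls. fls_const (c L * of_nat (cf L) / of_nat (cf L)) * Psi (PF L) (XS S)) $$ k \<in> dyadic"
      using cf_pos by (simp add: DR_def)
  qed
  note dy = this
  let ?H = "count_list ` Ls" and ?c = "\<lambda>h. c (Lof n h) * of_nat (cf (Lof n h))"
  have Lof: "Lof n (count_list L) = L" if "L \<in> Ls" for L using Ls(2)[OF that] by (intro Lof_count_list) auto
  have "inj_on count_list Ls" using Lof by (metis inj_on_inverseI)
  then have "(\<Sum>h\<in>?H. scal (?c h) (Eh n h)) = (\<Sum>L\<in>Ls. scal (?c (count_list L)) (Eh n (count_list L)))"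
    by (rule sum.reindex_cong) auto
  also have "\<dots> = (\<Sum>L\<in>Ls. scal (c L) (PF L))"
    using Ls(2) by (intro sum.cong refl) (simp add: Lof scal_Eh)
  finally have 1: "x - (\<Sum>h\<in>?H. scal (?c h) (Eh n h)) \<in> Jid n" using J by simp
  have 2: "?H \<subseteq> FS n" using Ls(2) count_list_FS by blast
  have 3: "\<forall>h\<in>?H. ?c h \<in> dyadic" using dy Lof by auto
  show "\<exists>H c. finite H \<and> H \<subseteq> FS n \<and> (\<forall>h\<in>H. c h \<in> dyadic)
      \<and> x - (\<Sum>h\<in>H. scal (c h) (Eh n h)) \<in> Jid n"
    by (intro exI[of _ ?H] exI[of _ ?c] conjI finite_imageI fin 1 2 3)
next
  fix H c h
  assume H: "finite H \<and> H \<subseteq> FS n \<and> (\<forall>h\<in>H. c h \<in> dyadic) \<and> (\<Sum>h\<in>H. scal (c h) (Eh n h)) \<in> Jid n"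
    and h: "h \<in> H"
  have inj: "inj_on (Lof n) H" using H inj_on_subset[OF inj_Lof] by blast
  have cnt: "count_list (Lof n h) = h" if "h \<in> H" for h using that H by (intro count_list_Lof) blast
  \<comment> \<open>Here the values of the combination vanish, so the module \<open>{0}\<close> can
    be used in place of \<open>dyadic\<close>.\<close>
  have "c (count_list (Lof n h)) \<in> {0}"
  proof (rule Eh_coefficients_in_module[OF dyadic_module_zero, of "Lof n ` H" n "\<lambda>L. c (count_list L)"])
    fix S k assume S: "sgood S"
    have "(\<Sum>L\<in>Lof n ` H. fls_const (c (count_list L) / of_nat (cf L)) * Psi (PF L) (XS S)) =
        (\<Sum>h\<in>H. fls_const (c h / of_nat (cf (Lof n h))) * Psi (PF (Lof n h)) (XS S))"
      using inj by (rule sum.reindex_cong) (simp_all add: cnt)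
    also have "\<dots> = Psi (\<Sum>h\<in>H. scal (c h) (Eh n h)) (XS S)"
      by (simp add: Psi_sum Fin_Eh) (simp add: Eh_eq_PF scal_simps Psi_scal)
    also have "\<dots> = 0" using H by (intro Psi_Jid[OF _ finite_XS inj_snd_XS[OF S]]) blast
    finally show "(\<Sum>L\<in>Lof n ` H. fls_const (c (count_list L) / of_nat (cf L)) * Psi (PF L) (XS S)) $$ k \<in> {0}"
      by simp
  next
    show "finite (Lof n ` H)" using H by blast
    show "roots_in n L \<and> psorted L" if "L \<in> Lof n ` H" for L using that Lof_props by blast
    show "Lof n h \<in> Lof n ` H" using h by (rule imageI)
  qed
  then show "c h = 0" using cnt[OF h] by simp
qed

end
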